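(* Fix $x\in(0,+\infty)$ and let $\beta=\beta(d)\ge -1$ be any sequence of real numbers (indexed by integers $d\ge 2$). Let $k=k(d)\in\{1,\ldots,d\}$ be a sequence of natural numbers diverging to infinity as $d\to\infty$, and let $n=n(d)$ be a sequence of natural numbers of the form $$n=\Bigl(\frac{k}{2x+o(1)}\Bigr)^{d/2+\beta},$$ where $o(1)$ denotes a real sequence converging to $0$ as $d\to\infty$. Then $$\lim_{d\to\infty}\frac{\mathbf{E}\,V_k(P_{n,d}^{\beta})}{V_k(\mathbb{B}^d)}=e^{-x}.$$
   Context: For an integer $d\ge 2$, $\mathbb{B}^d$ is the closed Euclidean unit ball in $\mathbb{R}^d$, $\mathbb{S}^{d-1}$ its boundary, $\|\cdot\|$ the Euclidean norm, $\mathrm{vol}_d$ the Lebesgue measure on $\mathbb{R}^d$ and $\kappa_d=\mathrm{vol}_d(\mathbb{B}^d)=\pi^{d/2}/\Gamma(1+d/2)$ (with $\kappa_0=1$, $\kappa_1=2$). For a convex body $L\subset\mathbb{R}^d$ and $k\in\{0,\dots,d\}$, the $k$-th intrinsic volume $V_k(L)$ is defined through the Steiner formula: $\mathrm{vol}_d(L+t\mathbb{B}^d)=\sum_{k=0}^d t^{d-k}\kappa_{d-k}V_k(L)$ for every $t\ge 0$. The beta distribution on $\mathbb{R}^d$ with parameter $\beta>-1$ is the probability measure with density $$x\mapsto\frac{\Gamma(\frac d2+\beta+1)}{\pi^{d/2}\,\Gamma(\beta+1)}(1-\|x\|^2)^{\beta}\quad\text{for }\|x\|<1,$$ and $0$ elsewhere;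 the beta distribution with parameter $\beta=-1$ is the uniform distribution on $\mathbb{S}^{d-1}$. The beta polytope $P_{n,d}^{\beta}$ is the convex hull of $n$ i.i.d. random points $X_1,\dots,X_n$ in $\mathbb{R}^d$ with the beta distribution of parameter $\beta$. $\mathbf{E}$ denotes expectation. The parameter $\beta$ may depend on $d$. *)

theory Defs
  imports "HOL-Probability.Probability"
begin

text \<open>
  The dimension \<open>d\<close> tends to infinity, so it cannot be a type parameter. A point of \<open>d\<close>-dimensional
  space is a function \<open>{..<d} \<rightarrow>\<^sub>E UNIV\<close>, i.e. an element of the space of the product Lebesgue
  measure below, and its Euclidean norm is \<open>L2_set x {..<d}\<close>.
\<close>

abbreviation lborel_rd :: "nat \<Rightarrow> (nat \<Rightarrow> real) measure" where
  "lborel_rd d \<equiv> \<Pi>\<^sub>M i\<in>{..<d}. (lborel :: real measure)"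

abbreviation norm_rd :: "nat \<Rightarrow> (nat \<Rightarrow> real) \<Rightarrow> real" where
  "norm_rd d x \<equiv> L2_set x {..<d}"

definition unit_ball_rd :: "nat \<Rightarrow> (nat \<Rightarrow> real) set" where
  "unit_ball_rd d = {x \<in> space (lborel_rd d). norm_rd d x \<le> 1}"

definition convex_rd :: "nat \<Rightarrow> (nat \<Rightarrow> real) set \<Rightarrow> bool" where
  "convex_rd d C \<longleftrightarrow> C \<subseteq> space (lborel_rd d) \<and>
     (\<forall>x\<in>C. \<forall>y\<in>C. \<forall>u\<ge>0. \<forall>v\<ge>0. u + v = 1 \<longrightarrow> (\<lambda>i\<in>{..<d}. u * x i + v * y i) \<in> C)"

definition parallel_body :: "nat \<Rightarrow> (nat \<Rightarrow> real) set \<Rightarrow> real \<Rightarrow> (nat \<Rightarrow> real) set" where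
  "parallel_body d L t = {\<lambda>i\<in>{..<d}. x i + t * y i | x y. x \<in> L \<and> y \<in> unit_ball_rd d}"

text \<open>
  The intrinsic volumes of a convex body are the coefficients in the Steiner formula. They are
  determined by it because a polynomial is determined by its values on \<open>{0..}\<close>; fixing
  the value 0 for indices above \<open>d\<close> makes the whole coefficient sequence unique.
\<close>

definition intrinsic_volume :: "nat \<Rightarrow> nat \<Rightarrow> (nat \<Rightarrow> real) set \<Rightarrow> real" where
  "intrinsic_volume d k L =
     (THE V :: nat \<Rightarrow> real. (\<forall>j>d. V j = 0) \<and>
        (\<forall>t\<ge>0. measure (lborel_rd d) (parallel_body d L t) =
           (\<Sum>j\<le>d. t ^ (d - j) * unit_ball_vol (real (d - j)) * V j))) k"

text \<open>
  The uniform distribution on the unit sphere is the normalized cone measure: the law of the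
  direction of a uniformly distributed point of the unit ball. The origin, where the direction is
  undefined, is a null set.
\<close>

definition uniform_sphere :: "nat \<Rightarrow> (nat \<Rightarrow> real) measure" where
  "uniform_sphere d = distr (uniform_measure (lborel_rd d) (unit_ball_rd d)) (lborel_rd d)
     (\<lambda>x. \<lambda>i\<in>{..<d}. x i / norm_rd d x)"

definition beta_density :: "nat \<Rightarrow> real \<Rightarrow> (nat \<Rightarrow> real) \<Rightarrow> real" where
  "beta_density d \<beta> x =
     (if norm_rd d x < 1
      then Gamma (real d / 2 + \<beta> + 1) / (pi powr (real d / 2) * Gamma (\<beta> + 1)) *
           (1 - (norm_rd d x)\<^sup>2) powr \<beta>
      else 0)"

definition beta_distribution :: "nat \<Rightarrow> real \<Rightarrow> (nat \<Rightarrow> real) measure" where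
  "beta_distribution d \<beta> =
     (if \<beta> = -1 then uniform_sphere d
      else density (lborel_rd d) (\<lambda>x. ennreal (beta_density d \<beta> x)))"

end

theory Submission
  imports Defs "HOL-Real_Asymp.Real_Asymp"
begin

text \<open>
  Let \<open>a\<^sub>1, a\<^sub>2, \<dots>\<close> be independent and uniform in the ball. The volume of
  \<open>L + s([-a\<^sub>1,a\<^sub>1] + \<dots> + [-a\<^sub>m,a\<^sub>m])\<close> expands over subsets of the segments, so its mean is a
  polynomial in \<open>s\<close>; for \<open>s\<close> of order \<open>t / m\<close> the zonotopes converge to the ball of radius \<open>t\<close> by the
  law of large numbers. In the limit this gives the Steiner formula, and expresses \<open>V\<^sub>k(L)\<close> through mixed
  differences of volumes along \<open>d - k\<close> segments. Adding a segment to a body changes its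
  volume by the length of the segment times the volume of a projection. For a rotation invariant random
  body each segment can be rotated onto a coordinate axis, whence
  \<open>E V\<^sub>k(P) / V\<^sub>k(B\<^sup>d) = E vol\<^sub>k(\<pi>\<^sub>k P) / vol\<^sub>k(B\<^sup>k)\<close>, \<open>\<pi>\<^sub>k\<close> being a coordinate projection.

  The mean on the right has a threshold. Let \<open>T(h)\<close> be the mass that the beta distribution
  gives to a half-space at distance \<open>h\<close> from the origin; up to polynomial factors it is
  \<open>(1 - h\<^sup>2)\<^sup>A\<close> with \<open>A = d/2 + \<beta>\<close>. For \<open>1 - h\<^sup>2 = 2s/k\<close> the number \<open>n T(h)\<close> behaves like
  \<open>(s/x)\<^sup>A\<close>. If \<open>s < x\<close>, a point of norm \<open>h\<close> is rarely in the projected polytope; if \<open>s > x\<close>, a net of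
  directions shows that the whole ball of radius \<open>h\<close> is likely contained in it. Since \<open>h\<^sup>k\<close> tends to
  \<open>e\<^sup>-\<^sup>s\<close>, the limit is \<open>e\<^sup>-\<^sup>x\<close>.
\<close>

section \<open>Lebesgue measure on coordinate space\<close>

abbreviation Rd :: "nat \<Rightarrow> (nat \<Rightarrow> real) set" where
  "Rd d \<equiv> {..<d} \<rightarrow>\<^sub>E UNIV"

abbreviation vol :: "nat \<Rightarrow> (nat \<Rightarrow> real) set \<Rightarrow> real" where
  "vol d S \<equiv> measure (lborel_rd d) S"

definition ip :: "nat \<Rightarrow> (nat \<Rightarrow> real) \<Rightarrow> (nat \<Rightarrow> real) \<Rightarrow> real" where
  "ip d x y = (\<Sum>i<d. x i * y i)"

definition hrefl :: "nat \<Rightarrow> (nat \<Rightarrow> real) \<Rightarrow> (nat \<Rightarrow> real) \<Rightarrow> (nat \<Rightarrow> real)" where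
  "hrefl d u x = (\<lambda>i\<in>{..<d}. x i - 2 * ip d x u * u i)"

lemma space_lborel_rd [simp]: "space (lborel_rd d) = Rd d"
  by (simp add: space_PiM)

interpretation lborel_prod: product_sigma_finite "\<lambda>_::nat. lborel :: real measure"
  by (simp add: product_sigma_finite_def sigma_finite_lborel)

interpretation lborel_rd: sigma_finite_measure "lborel_rd d" for d
  by (rule lborel_prod.sigma_finite) simp

lemma measurable_coord_rd [measurable]: "(\<lambda>x. x i) \<in> borel_measurable (lborel_rd d)"
proof (cases "i < d")
  case True
  then show ?thesis
    using measurable_component_singleton[of i "{..<d}" "\<lambda>_. lborel :: real measure"] by simp
next
  case False
  have "(\<lambda>x. x i) \<in> borel_measurable (lborel_rd d) \<longleftrightarrow>
        (\<lambda>x. undefined :: real) \<in> borel_measurable (lborel_rd d)"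
    by (intro measurable_cong) (use False in \<open>auto simp: PiE_def extensional_def\<close>)
  then show ?thesis by simp
qed

lemma measurable_into_rd:
  assumes "\<And>i. i < d \<Longrightarrow> (\<lambda>x. f x i) \<in> borel_measurable N"
  shows "(\<lambda>x. \<lambda>i\<in>{..<d}. f x i) \<in> N \<rightarrow>\<^sub>M lborel_rd d"
  by (intro measurable_restrict) (use assms in auto)

lemma measurable_coord_compose:
  assumes "f \<in> N \<rightarrow>\<^sub>M lborel_rd d"
  shows "(\<lambda>x. f x i) \<in> borel_measurable N"
  using measurable_compose[OF assms measurable_coord_rd] .

lemma measurable_incl_rd: "(\<lambda>x. x) \<in> lborel_rd d \<rightarrow>\<^sub>M borel"
  by (rule measurable_coordinatewise_then_product) simp

lemma closed_sets_rd: "closed C \<Longrightarrow> C \<inter> Rd d \<in> sets (lborel_rd d)"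
  using measurable_sets[OF measurable_incl_rd, of C d] by simp

lemma compact_sets_rd: "compact C \<Longrightarrow> C \<subseteq> Rd d \<Longrightarrow> C \<in> sets (lborel_rd d)"
  using closed_sets_rd[OF compact_imp_closed, of C d] by (simp add: Int_absorb2)

lemma ip_commute: "ip d x y = ip d y x"
  by (simp add: ip_def mult.commute)

lemma ip_restrict [simp]: "ip d (restrict x {..<d}) y = ip d x y" "ip d x (restrict y {..<d}) = ip d x y"
  by (simp_all add: ip_def)

lemma L2_set_restrict [simp]: "L2_set (restrict x A) A = L2_set x A"
  by (auto simp: L2_set_def)

lemma ip_self: "ip d x x = (norm_rd d x)\<^sup>2"
  by (simp add: ip_def L2_set_def sum_nonneg power2_eq_square)

lemma ip_le_norm: "\<bar>ip d x y\<bar> \<le> norm_rd d x * norm_rd d y"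
proof -
  have "\<bar>ip d x y\<bar> \<le> (\<Sum>i<d. \<bar>x i\<bar> * \<bar>y i\<bar>)"
    unfolding ip_def by (rule order_trans[OF sum_abs]) (simp add: abs_mult)
  also have "\<dots> \<le> norm_rd d x * norm_rd d y" by (rule L2_set_mult_ineq)
  finally show ?thesis .
qed

lemma ip_add: "ip d (\<lambda>i. x i + y i) z = ip d x z + ip d y z"
  and ip_diff: "ip d (\<lambda>i. x i - y i) z = ip d x z - ip d y z"
  and ip_scale: "ip d (\<lambda>i. c * x i) z = c * ip d x z"
  by (simp_all add: ip_def algebra_simps sum.distrib sum_subtractf sum_distrib_left)

lemma norm_scale: "norm_rd d (\<lambda>i. c * x i) = \<bar>c\<bar> * norm_rd d x"
proof -
  have "(norm_rd d (\<lambda>i. c * x i))\<^sup>2 = (\<bar>c\<bar> * norm_rd d x)\<^sup>2"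
    unfolding ip_self[symmetric] power_mult_distrib
    by (simp add: ip_def power2_eq_square sum_distrib_left algebra_simps)
  then show ?thesis
    by (rule power2_eq_imp_eq) auto
qed

lemma abs_coord_le_norm:
  assumes "i < d"
  shows "\<bar>x i\<bar> \<le> norm_rd d x"
proof -
  have "norm_rd d (\<lambda>j. \<bar>x j\<bar>) = norm_rd d x" by (simp add: L2_set_def)
  then show ?thesis
    using member_le_L2_set[of "{..<d}" i "\<lambda>j. \<bar>x j\<bar>"] assms by simp
qed

lemma measurable_norm_rd [measurable]: "(\<lambda>x. norm_rd d x) \<in> borel_measurable (lborel_rd m)"
  unfolding L2_set_def by measurable

lemma unit_ball_sets [measurable]: "unit_ball_rd d \<in> sets (lborel_rd d)"
  unfolding unit_ball_rd_def by measurable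

lemma affine_lborel_rd:
  assumes "r \<noteq> 0"
  shows "lborel_rd d = scale_measure (ennreal (\<bar>r\<bar> ^ d))
           (distr (lborel_rd d) (lborel_rd d) (\<lambda>x. \<lambda>i\<in>{..<d}. c i + r * x i))"
    (is "_ = scale_measure _ (distr _ _ ?f)")
proof (rule lborel_prod.PiM_eqI[symmetric])
  have f [measurable]: "?f \<in> lborel_rd d \<rightarrow>\<^sub>M lborel_rd d"
    by (rule measurable_into_rd) measurable
  fix A :: "nat \<Rightarrow> real set" assume A: "\<And>i. i \<in> {..<d} \<Longrightarrow> A i \<in> sets lborel"
  have pre: "?f -` (Pi\<^sub>E {..<d} A) \<inter> space (lborel_rd d) = Pi\<^sub>E {..<d} (\<lambda>i. (\<lambda>t. c i + r * t) -` A i)"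
    by (auto simp: PiE_def Pi_def extensional_def)
  have 1: "emeasure lborel B = ennreal \<bar>r\<bar> * emeasure lborel ((\<lambda>t. c i + r * t) -` B)"
    if "B \<in> sets lborel" for B i
    using that
    by (subst lborel_real_affine[OF \<open>r \<noteq> 0\<close>, of "c i"])
       (simp add: emeasure_density nn_integral_cmult_indicator emeasure_distr nn_integral_cmult)
  have m: "(\<lambda>t. c i + r * t) -` A i \<in> sets lborel" if "i < d" for i
  proof -
    have "(\<lambda>t. c i + r * t) \<in> borel \<rightarrow>\<^sub>M borel" by measurable
    from measurable_sets[OF this, of "A i"] A[of i] that show ?thesis by simp
  qed
  have "emeasure (scale_measure (ennreal (\<bar>r\<bar> ^ d)) (distr (lborel_rd d) (lborel_rd d) ?f)) (Pi\<^sub>E {..<d} A)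
      = ennreal (\<bar>r\<bar> ^ d) * (\<Prod>i<d. emeasure lborel ((\<lambda>t. c i + r * t) -` A i))"
    using A m lborel_prod.emeasure_PiM[of "{..<d}" "\<lambda>i. (\<lambda>t. c i + r * t) -` A i"]
    by (simp add: emeasure_distr pre sets_PiM_I_finite del: space_lborel_rd)
  also have "\<dots> = (\<Prod>i<d. ennreal \<bar>r\<bar> * emeasure lborel ((\<lambda>t. c i + r * t) -` A i))"
    by (simp add: prod.distrib ennreal_power)
  also have "\<dots> = (\<Prod>i<d. emeasure lborel (A i))"
    using A by (intro prod.cong refl 1[symmetric]) auto
  finally show "emeasure (scale_measure (ennreal (\<bar>r\<bar> ^ d)) (distr (lborel_rd d) (lborel_rd d) ?f)) (Pi\<^sub>E {..<d} A)
      = (\<Prod>i<d. emeasure lborel (A i))" .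
qed auto

lemma measurable_affine_rd [measurable]: "(\<lambda>x. \<lambda>i\<in>{..<d}. c i + r * x i) \<in> lborel_rd d \<rightarrow>\<^sub>M lborel_rd d"
  by (rule measurable_into_rd) measurable

lemma nn_integral_affine_rd:
  assumes "r \<noteq> 0" and [measurable]: "g \<in> borel_measurable (lborel_rd d)"
  shows "(\<integral>\<^sup>+x. g x \<partial>lborel_rd d) =
         ennreal (\<bar>r\<bar> ^ d) * (\<integral>\<^sup>+x. g (\<lambda>i\<in>{..<d}. c i + r * x i) \<partial>lborel_rd d)"
  by (subst affine_lborel_rd[OF assms(1), of d c])
     (simp add: nn_integral_scale_measure nn_integral_distr)

lemma nn_integral_shift_rd:
  assumes [measurable]: "g \<in> borel_measurable (lborel_rd d)"
  shows "(\<integral>\<^sup>+x. g (\<lambda>i\<in>{..<d}. c i + x i) \<partial>lborel_rd d) = (\<integral>\<^sup>+x. g x \<partial>lborel_rd d)"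
  using nn_integral_affine_rd[of 1 g d c] by simp

lemma nn_integral_reflect_rd:
  assumes [measurable]: "g \<in> borel_measurable (lborel_rd d)"
  shows "(\<integral>\<^sup>+x. g (\<lambda>i\<in>{..<d}. c i - x i) \<partial>lborel_rd d) = (\<integral>\<^sup>+x. g x \<partial>lborel_rd d)"
  using nn_integral_affine_rd[of "-1" g d c] by simp

lemma emeasure_unit_ball_finite: "emeasure (lborel_rd d) (unit_ball_rd d) < \<infinity>"
proof -
  have "unit_ball_rd d \<subseteq> Pi\<^sub>E {..<d} (\<lambda>_. {-1..1})"
  proof
    fix x assume x: "x \<in> unit_ball_rd d"
    have "\<bar>x i\<bar> \<le> 1" if "i < d" for i
      using abs_coord_le_norm[OF that, of x] x by (simp add: unit_ball_rd_def)
    then have "x i \<in> {-1..1}" if "i < d" for i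
      using that by (simp add: abs_le_iff minus_le_iff)
    then show "x \<in> Pi\<^sub>E {..<d} (\<lambda>_. {-1..1})"
      using x by (simp add: unit_ball_rd_def PiE_iff)
  qed
  then have "emeasure (lborel_rd d) (unit_ball_rd d) \<le> emeasure (lborel_rd d) (Pi\<^sub>E {..<d} (\<lambda>_. {-1..1}))"
    by (rule emeasure_mono) (rule sets_PiM_I_finite; simp)
  also have "\<dots> = (\<Prod>i<d. emeasure lborel {-1..1::real})"
    by (rule lborel_prod.emeasure_PiM) auto
  also have "\<dots> = ennreal (2 ^ d)"
    by (subst ennreal_power[symmetric]) simp_all
  also have "\<dots> < \<infinity>" by simp
  finally show ?thesis .
qed

lemma emeasure_unit_ball_pos: "emeasure (lborel_rd d) (unit_ball_rd d) > 0"
proof -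
  let ?C = "Pi\<^sub>E {..<d} (\<lambda>_. {0..1 / (real d + 1)})"
  have "?C \<subseteq> unit_ball_rd d"
  proof
    fix x assume x: "x \<in> ?C"
    have "norm_rd d x \<le> (\<Sum>i<d. \<bar>x i\<bar>)" by (rule L2_set_le_sum_abs)
    also have "\<dots> \<le> (\<Sum>i<d. 1 / (real d + 1))"
      using x by (intro sum_mono) (auto simp: PiE_def Pi_def)
    also have "\<dots> \<le> 1" by simp
    finally show "x \<in> unit_ball_rd d" using x by (auto simp: unit_ball_rd_def)
  qed
  then have le: "emeasure (lborel_rd d) ?C \<le> emeasure (lborel_rd d) (unit_ball_rd d)"
    by (rule emeasure_mono) simp
  have "emeasure (lborel_rd d) ?C = (\<Prod>i<d. emeasure lborel {0..1 / (real d + 1)})"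
    by (rule lborel_prod.emeasure_PiM) auto
  also have "\<dots> = ennreal ((1 / (real d + 1)) ^ d)"
    by (subst ennreal_power[symmetric]) simp_all
  also have "\<dots> > 0"
    by (subst ennreal_less_zero_iff) simp
  finally show ?thesis using le by (rule order_less_le_trans)
qed

lemma vol_unit_ball_pos: "vol d (unit_ball_rd d) > 0"
  using emeasure_unit_ball_pos[of d] emeasure_unit_ball_finite[of d]
  unfolding measure_def enn2real_positive_iff by (intro conjI) (assumption, simp only: infinity_ennreal_def)

lemma measurable_hrefl [measurable]: "hrefl d u \<in> lborel_rd d \<rightarrow>\<^sub>M lborel_rd d"
proof -
  have "(\<lambda>x. x i - 2 * ip d x u * u i) \<in> borel_measurable (lborel_rd d)" for i
    unfolding ip_def by measurable
  then show ?thesis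
    unfolding hrefl_def[abs_def] by (rule measurable_into_rd)
qed

lemma hrefl_in_Rd [simp]: "hrefl d u x \<in> Rd d"
  by (simp add: hrefl_def)

lemma hrefl_restrict [simp]: "hrefl d u (restrict x {..<d}) = hrefl d u x"
  by (auto simp: hrefl_def)

lemma ip_hrefl:
  assumes "norm_rd d u = 1"
  shows "ip d (hrefl d u x) y = ip d x (hrefl d u y)"
    and "ip d (hrefl d u x) u = - ip d x u"
    and "ip d (hrefl d u x) (hrefl d u y) = ip d x y"
    and "hrefl d u (hrefl d u x) = restrict x {..<d}"
    and "norm_rd d (hrefl d u x) = norm_rd d x"
proof -
  have uu: "ip d u u = 1" using assms by (simp add: ip_self)
  have e: "ip d (hrefl d u x) y = ip d x y - 2 * ip d x u * ip d u y" for x y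
    unfolding hrefl_def ip_restrict ip_diff by (subst ip_scale) simp
  show 1: "ip d (hrefl d u x) y = ip d x (hrefl d u y)" for x y
    unfolding ip_commute[of d x "hrefl d u y"] e by (simp add: ip_commute)
  show 2: "ip d (hrefl d u x) u = - ip d x u" for x by (simp add: e uu)
  show 4: "hrefl d u (hrefl d u x) = restrict x {..<d}" for x
    unfolding hrefl_def[of d u "hrefl d u x"] 2 by (auto simp: hrefl_def restrict_def fun_eq_iff)
  show 3: "ip d (hrefl d u x) (hrefl d u y) = ip d x y" for x y
    unfolding 1 4 by simp
  have "(norm_rd d (hrefl d u x))\<^sup>2 = (norm_rd d x)\<^sup>2"
    unfolding ip_self[symmetric] 3 ..
  then show "norm_rd d (hrefl d u x) = norm_rd d x"
    by (rule power2_eq_imp_eq) auto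
qed

lemma hrefl_add: "hrefl d u (\<lambda>i. x i + y i) = (\<lambda>i\<in>{..<d}. hrefl d u x i + hrefl d u y i)"
  by (auto simp: hrefl_def ip_add algebra_simps)

lemma hrefl_scale: "hrefl d u (\<lambda>i. c * x i) = (\<lambda>i\<in>{..<d}. c * hrefl d u x i)"
  by (auto simp: hrefl_def ip_scale algebra_simps)

text \<open>Both sides of the key identity compute the double integral of
  \<open>1\<^sub>S(x) 1\<^sub>B(R y + x)\<close>: substituting in \<open>y\<close> decouples the two factors, and so does
  substituting in \<open>x\<close> and then in \<open>y\<close>. This is the usual uniqueness argument for Haar measure.\<close>

lemma emeasure_hrefl:
  assumes u: "norm_rd d u = 1" and S [measurable]: "S \<in> sets (lborel_rd d)"
  shows "emeasure (lborel_rd d) (hrefl d u -` S \<inter> Rd d) = emeasure (lborel_rd d) S"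
proof -
  let ?L = "lborel_rd d" and ?B = "unit_ball_rd d" and ?R = "hrefl d u"
  define S' where "S' = (\<lambda>x. \<lambda>i\<in>{..<d}. - x i) -` S \<inter> Rd d"
  have neg [measurable]: "(\<lambda>x. \<lambda>i\<in>{..<d}. - x i) \<in> ?L \<rightarrow>\<^sub>M ?L"
    by (rule measurable_into_rd) measurable
  have S' [measurable]: "S' \<in> sets ?L"
    unfolding S'_def using measurable_sets[OF neg S] by simp
  interpret pair_sigma_finite ?L ?L
    by (rule pair_sigma_finite.intro) (rule lborel_rd.sigma_finite_measure_axioms)+
  have RB: "?R y \<in> ?B \<longleftrightarrow> y \<in> ?B" if "y \<in> Rd d" for y
    using that by (auto simp: unit_ball_rd_def ip_hrefl(5)[OF u] hrefl_in_Rd)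
  have "(\<lambda>p. fst p) \<in> ?L \<Otimes>\<^sub>M ?L \<rightarrow>\<^sub>M ?L" "(\<lambda>p. ?R (snd p)) \<in> ?L \<Otimes>\<^sub>M ?L \<rightarrow>\<^sub>M ?L" by measurable
  from this[THEN measurable_coord_compose]
  have [measurable]: "(\<lambda>p. fst p i) \<in> borel_measurable (?L \<Otimes>\<^sub>M ?L)"
    "(\<lambda>p. ?R (snd p) i) \<in> borel_measurable (?L \<Otimes>\<^sub>M ?L)" for i by auto
  have [measurable]: "(\<lambda>x. ?R x i) \<in> borel_measurable ?L" for i
    by (rule measurable_coord_compose) measurable
  have [measurable]: "(\<lambda>p. \<lambda>i\<in>{..<d}. fst p i + ?R (snd p) i) \<in> ?L \<Otimes>\<^sub>M ?L \<rightarrow>\<^sub>M ?L"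
    by (rule measurable_into_rd) measurable
  have [measurable]: "(\<lambda>p. \<lambda>i\<in>{..<d}. fst p i - ?R (snd p) i) \<in> ?L \<Otimes>\<^sub>M ?L \<rightarrow>\<^sub>M ?L"
    by (rule measurable_into_rd) measurable
  have c1: "?R (\<lambda>i\<in>{..<d}. ?R x i + y i) = (\<lambda>i\<in>{..<d}. x i + ?R y i)" if "x \<in> Rd d" for x y
    by (auto simp: hrefl_add ip_hrefl(4)[OF u])
  have "emeasure ?L S * emeasure ?L ?B = (\<integral>\<^sup>+x. \<integral>\<^sup>+y. indicator S x * indicator ?B (?R y) \<partial>?L \<partial>?L)"
  proof -
    have "(\<integral>\<^sup>+y. indicator S x * indicator ?B (?R y) \<partial>?L) = indicator S x * emeasure ?L ?B" for x
    proof -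
      have "(\<integral>\<^sup>+y. indicator S x * indicator ?B (?R y) \<partial>?L) = (\<integral>\<^sup>+y. indicator S x * indicator ?B y \<partial>?L)"
        by (intro nn_integral_cong) (auto simp: indicator_def RB)
      then show ?thesis by (simp add: nn_integral_cmult)
    qed
    then show ?thesis by (simp add: nn_integral_multc)
  qed
  also have "\<dots> = (\<integral>\<^sup>+x. \<integral>\<^sup>+y. indicator S x * indicator ?B (\<lambda>i\<in>{..<d}. x i + ?R y i) \<partial>?L \<partial>?L)"
    (is "_ = (\<integral>\<^sup>+x. ?g x \<partial>?L)")
  proof (rule nn_integral_cong)
    fix x assume "x \<in> space ?L"
    then have x: "x \<in> Rd d" by simp
    have "(\<integral>\<^sup>+y. indicator S x * indicator ?B (?R y) \<partial>?L)
        = (\<integral>\<^sup>+y. indicator S x * indicator ?B (?R (\<lambda>i\<in>{..<d}. ?R x i + y i)) \<partial>?L)"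
      by (rule nn_integral_shift_rd[symmetric]) measurable
    then show "(\<integral>\<^sup>+y. indicator S x * indicator ?B (?R y) \<partial>?L) = ?g x" unfolding c1[OF x] .
  qed
  also have "\<dots> = (\<integral>\<^sup>+y. \<integral>\<^sup>+x. indicator S x * indicator ?B (\<lambda>i\<in>{..<d}. x i + ?R y i) \<partial>?L \<partial>?L)"
    by (rule Fubini'[symmetric]) (simp add: split_beta')
  also have "\<dots> = (\<integral>\<^sup>+y. \<integral>\<^sup>+x. indicator S (\<lambda>i\<in>{..<d}. x i - ?R y i) * indicator ?B x \<partial>?L \<partial>?L)"
  proof (rule nn_integral_cong)
    fix y assume "y \<in> space ?L"
    have "(\<lambda>x. \<lambda>i\<in>{..<d}. x i - ?R y i) \<in> ?L \<rightarrow>\<^sub>M ?L"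
      by (rule measurable_into_rd) measurable
    then have m: "(\<lambda>x. indicator S (\<lambda>i\<in>{..<d}. x i - ?R y i) * indicator ?B x) \<in> ?L \<rightarrow>\<^sub>M (borel :: ennreal measure)"
      by measurable
    have "(\<integral>\<^sup>+x. indicator S (\<lambda>i\<in>{..<d}. x i - ?R y i) * indicator ?B x \<partial>?L) =
      (\<integral>\<^sup>+x. indicator S (\<lambda>i\<in>{..<d}. (\<lambda>i\<in>{..<d}. ?R y i + x i) i - ?R y i) * indicator ?B (\<lambda>i\<in>{..<d}. ?R y i + x i) \<partial>?L)"
      by (rule nn_integral_shift_rd[OF m, symmetric])
    also have "\<dots> = (\<integral>\<^sup>+x. indicator S x * indicator ?B (\<lambda>i\<in>{..<d}. x i + ?R y i) \<partial>?L)"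
    proof (rule nn_integral_cong)
      fix x assume "x \<in> space ?L"
      then have "(\<lambda>i\<in>{..<d}. (\<lambda>i\<in>{..<d}. ?R y i + x i) i - ?R y i) = x"
        by (auto simp: fun_eq_iff PiE_def extensional_def)
      moreover have "(\<lambda>i\<in>{..<d}. ?R y i + x i) = (\<lambda>i\<in>{..<d}. x i + ?R y i)" by (simp add: add.commute)
      ultimately show "indicator S (\<lambda>i\<in>{..<d}. (\<lambda>i\<in>{..<d}. ?R y i + x i) i - ?R y i) * indicator ?B (\<lambda>i\<in>{..<d}. ?R y i + x i)
        = (indicator S x * indicator ?B (\<lambda>i\<in>{..<d}. x i + ?R y i) :: ennreal)" by simp
    qed
    finally show "(\<integral>\<^sup>+x. indicator S x * indicator ?B (\<lambda>i\<in>{..<d}. x i + ?R y i) \<partial>?L) =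
      (\<integral>\<^sup>+x. indicator S (\<lambda>i\<in>{..<d}. x i - ?R y i) * indicator ?B x \<partial>?L)" by simp
  qed
  also have "\<dots> = (\<integral>\<^sup>+x. \<integral>\<^sup>+y. indicator S (\<lambda>i\<in>{..<d}. x i - ?R y i) * indicator ?B x \<partial>?L \<partial>?L)"
    by (rule Fubini') (simp add: split_beta')
  also have "\<dots> = (\<integral>\<^sup>+x. \<integral>\<^sup>+y. indicator S (\<lambda>i\<in>{..<d}. - ?R y i) * indicator ?B x \<partial>?L \<partial>?L)"
  proof (rule nn_integral_cong)
    fix x assume "x \<in> space ?L"
    then have x: "x \<in> Rd d" by simp
    have "(\<lambda>y. \<lambda>i\<in>{..<d}. x i - ?R y i) \<in> ?L \<rightarrow>\<^sub>M ?L"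
      by (rule measurable_into_rd) measurable
    then have m: "(\<lambda>y. indicator S (\<lambda>i\<in>{..<d}. x i - ?R y i) * indicator ?B x) \<in> ?L \<rightarrow>\<^sub>M (borel :: ennreal measure)"
      by measurable
    have c2: "(\<lambda>i\<in>{..<d}. x i - (\<lambda>i\<in>{..<d}. x i + ?R y i) i) = (\<lambda>i\<in>{..<d}. - ?R y i)" for y
      by auto
    show "(\<integral>\<^sup>+y. indicator S (\<lambda>i\<in>{..<d}. x i - ?R y i) * indicator ?B x \<partial>?L) =
      (\<integral>\<^sup>+y. indicator S (\<lambda>i\<in>{..<d}. - ?R y i) * indicator ?B x \<partial>?L)"
      using nn_integral_shift_rd[OF m, symmetric, of "?R x"]
      unfolding c1[OF x] c2 .
  qed
  also have "\<dots> = (\<integral>\<^sup>+x. \<integral>\<^sup>+y. indicator (?R -` S' \<inter> Rd d) y * indicator ?B x \<partial>?L \<partial>?L)"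
    by (intro nn_integral_cong) (auto simp: indicator_def S'_def hrefl_in_Rd)
  also have "\<dots> = emeasure ?L (?R -` S' \<inter> Rd d) * emeasure ?L ?B"
    using measurable_sets[OF measurable_hrefl[of d u] S'] by (simp add: nn_integral_multc nn_integral_cmult)
  finally have 1: "emeasure ?L S = emeasure ?L (?R -` S' \<inter> Rd d)"
    using emeasure_unit_ball_pos[of d] emeasure_unit_ball_finite[of d]
    by (subst (asm) (1 2) mult.commute) (auto simp: ennreal_mult_cancel_left top.not_eq_extremum)
  have 2: "?R -` S' \<inter> Rd d = (\<lambda>x. \<lambda>i\<in>{..<d}. 0 - x i) -` (?R -` S \<inter> Rd d) \<inter> Rd d"
    by (auto simp: S'_def hrefl_in_Rd hrefl_scale[of d u "-1", simplified])
  have T [measurable]: "?R -` S \<inter> Rd d \<in> sets ?L"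
    using measurable_sets[OF measurable_hrefl[of d u] S] by simp
  have "emeasure ?L (?R -` S' \<inter> Rd d) = (\<integral>\<^sup>+x. indicator (?R -` S \<inter> Rd d) (\<lambda>i\<in>{..<d}. 0 - x i) \<partial>?L)"
  proof -
    let ?V = "(\<lambda>x. \<lambda>i\<in>{..<d}. 0 - x i) -` (?R -` S \<inter> Rd d) \<inter> Rd d"
    have "?V \<in> sets ?L" using measurable_sets[OF neg T] by simp
    then have "emeasure ?L ?V = (\<integral>\<^sup>+x. indicator ?V x \<partial>?L)" by (rule nn_integral_indicator[symmetric])
    also have "\<dots> = (\<integral>\<^sup>+x. indicator (?R -` S \<inter> Rd d) (\<lambda>i\<in>{..<d}. 0 - x i) \<partial>?L)"
      by (intro nn_integral_cong) (simp add: indicator_def)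
    finally show ?thesis unfolding 2 .
  qed
  also have "\<dots> = emeasure ?L (?R -` S \<inter> Rd d)"
    by (subst nn_integral_reflect_rd) simp_all
  finally show ?thesis using 1 by simp
qed

lemma distr_hrefl:
  assumes "norm_rd d u = 1"
  shows "distr (lborel_rd d) (lborel_rd d) (hrefl d u) = lborel_rd d"
proof (rule measure_eqI)
  fix A assume "A \<in> sets (distr (lborel_rd d) (lborel_rd d) (hrefl d u))"
  then have A: "A \<in> sets (lborel_rd d)" by simp
  show "emeasure (distr (lborel_rd d) (lborel_rd d) (hrefl d u)) A = emeasure (lborel_rd d) A"
    using emeasure_hrefl[OF assms A] by (subst emeasure_distr[OF measurable_hrefl A]) (simp only: space_lborel_rd)
qed simp

lemma hrefl_vimage_eq_image:
  assumes u: "norm_rd d u = 1" and "S \<subseteq> Rd d"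
  shows "hrefl d u -` S \<inter> Rd d = hrefl d u ` S"
proof -
  have inv: "hrefl d u (hrefl d u x) = x" if "x \<in> Rd d" for x
    unfolding ip_hrefl(4)[OF u] by (rule PiE_restrict[OF that])
  show ?thesis
  proof (intro equalityI subsetI)
    fix x assume x: "x \<in> hrefl d u -` S \<inter> Rd d"
    show "x \<in> hrefl d u ` S"
      by (rule image_eqI[of _ _ "hrefl d u x"]) (use x inv[of x] in simp_all)
  next
    fix x assume "x \<in> hrefl d u ` S"
    then obtain y where "y \<in> S" "x = hrefl d u y" by blast
    then show "x \<in> hrefl d u -` S \<inter> Rd d"
      using inv[of y] assms(2) by (simp add: subset_iff)
  qed
qed

lemma vol_hrefl:
  assumes "norm_rd d u = 1" "S \<in> sets (lborel_rd d)"
  shows "vol d (hrefl d u ` S) = vol d S"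
proof -
  have "S \<subseteq> Rd d" using sets.sets_into_space[OF assms(2)] by simp
  show ?thesis
    unfolding measure_def hrefl_vimage_eq_image[OF assms(1) \<open>S \<subseteq> Rd d\<close>, symmetric] emeasure_hrefl[OF assms] ..
qed

lemma measurable_scale_rd: "(\<lambda>x. \<lambda>i\<in>{..<d}. r * x i) \<in> lborel_rd d \<rightarrow>\<^sub>M lborel_rd d"
  by (rule measurable_into_rd) measurable

lemma emeasure_scale_rd:
  assumes "r > 0" and S [measurable]: "S \<in> sets (lborel_rd d)"
  shows "emeasure (lborel_rd d) ((\<lambda>x. \<lambda>i\<in>{..<d}. r * x i) ` S) = ennreal (r ^ d) * emeasure (lborel_rd d) S"
proof -
  have sub: "S \<subseteq> Rd d" using sets.sets_into_space[OF S] by simp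
  have eq: "(\<lambda>x. \<lambda>i\<in>{..<d}. r * x i) ` S = (\<lambda>x. \<lambda>i\<in>{..<d}. (1/r) * x i) -` S \<inter> Rd d" (is "?A = ?B")
  proof (intro equalityI subsetI)
    fix x assume "x \<in> ?B"
    then have "(\<lambda>i\<in>{..<d}. (1/r) * x i) \<in> S" "x \<in> Rd d" by auto
    moreover have "x = (\<lambda>i\<in>{..<d}. r * (\<lambda>i\<in>{..<d}. (1/r) * x i) i)"
      using \<open>x \<in> Rd d\<close> \<open>r > 0\<close> by (auto simp: fun_eq_iff PiE_def extensional_def)
    ultimately show "x \<in> ?A" by blast
  next
    fix x assume "x \<in> ?A"
    then obtain y where y: "y \<in> S" "x = (\<lambda>i\<in>{..<d}. r * y i)" by auto
    then have "(\<lambda>i\<in>{..<d}. (1/r) * x i) = y"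
      using sub \<open>r > 0\<close> by (auto simp: fun_eq_iff PiE_def extensional_def subset_iff)
    then show "x \<in> ?B" using y by auto
  qed
  have [measurable]: "?A \<in> sets (lborel_rd d)"
    unfolding eq using measurable_sets[OF measurable_scale_rd S, of "1/r"] by simp
  have "emeasure (lborel_rd d) ?A = (\<integral>\<^sup>+x. indicator ?A x \<partial>lborel_rd d)" by simp
  also have "\<dots> = ennreal (r ^ d) * (\<integral>\<^sup>+x. indicator ?A (\<lambda>i\<in>{..<d}. 0 + r * x i) \<partial>lborel_rd d)"
    using nn_integral_affine_rd[of r "indicator ?A" d "\<lambda>_. 0"] \<open>r > 0\<close> by simp
  also have "(\<integral>\<^sup>+x. indicator ?A (\<lambda>i\<in>{..<d}. 0 + r * x i) \<partial>lborel_rd d) = (\<integral>\<^sup>+x. indicator S x \<partial>lborel_rd d)"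
  proof (rule nn_integral_cong)
    fix x assume x: "x \<in> space (lborel_rd d)"
    have "(\<lambda>i\<in>{..<d}. (1/r) * (\<lambda>i\<in>{..<d}. r * x i) i) = x"
      using x \<open>r > 0\<close> by (auto simp: fun_eq_iff PiE_def extensional_def)
    then have "(\<lambda>i\<in>{..<d}. r * x i) \<in> ?A \<longleftrightarrow> x \<in> S"
      unfolding eq by auto
    then show "indicator ?A (\<lambda>i\<in>{..<d}. 0 + r * x i) = (indicator S x :: ennreal)"
      by (simp add: indicator_def)
  qed
  finally show ?thesis unfolding nn_integral_indicator[OF S] .
qed

section \<open>Convex bodies and Minkowski sums with segments\<close>

definition body :: "nat \<Rightarrow> (nat \<Rightarrow> real) set \<Rightarrow> bool" where
  "body d L \<longleftrightarrow> L \<noteq> {} \<and> compact L \<and> convex_rd d L"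

definition seg :: "nat \<Rightarrow> (nat \<Rightarrow> real) \<Rightarrow> (nat \<Rightarrow> real) set \<Rightarrow> (nat \<Rightarrow> real) set" where
  "seg d a L = (\<lambda>(x, \<mu>). \<lambda>i\<in>{..<d}. x i + \<mu> * a i) ` (L \<times> {-1..1})"

abbreviation segs :: "nat \<Rightarrow> (nat \<Rightarrow> real) list \<Rightarrow> (nat \<Rightarrow> real) set \<Rightarrow> (nat \<Rightarrow> real) set" where
  "segs d \<equiv> foldr (seg d)"

definition proj :: "nat \<Rightarrow> (nat \<Rightarrow> real) set \<Rightarrow> (nat \<Rightarrow> real) set" where
  "proj i L = (\<lambda>x. restrict x {..<i}) ` L"

lemma bodyD:
  assumes "body d L"
  shows "L \<subseteq> Rd d" "L \<noteq> {}" "compact L" "L \<in> sets (lborel_rd d)"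
    "\<And>x y u v. x \<in> L \<Longrightarrow> y \<in> L \<Longrightarrow> u \<ge> 0 \<Longrightarrow> v \<ge> 0 \<Longrightarrow> u + v = 1 \<Longrightarrow> (\<lambda>i\<in>{..<d}. u * x i + v * y i) \<in> L"
  using assms compact_sets_rd[of L d] by (auto simp: body_def convex_rd_def)

lemma continuous_on_coord:
  fixes f :: "'a::topological_space \<Rightarrow> nat \<Rightarrow> real"
  shows "continuous_on S f \<Longrightarrow> continuous_on S (\<lambda>x. f x i)"
  by (rule continuous_on_product_then_coordinatewise)

lemma continuous_on_restrict_coords:
  fixes f :: "'a::topological_space \<Rightarrow> nat \<Rightarrow> real"
  assumes "\<And>i. i < d \<Longrightarrow> continuous_on S (\<lambda>x. f x i)"
  shows "continuous_on S (\<lambda>x. \<lambda>i\<in>{..<d}. f x i)"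
proof (rule continuous_on_coordinatewise_then_product)
  fix i show "continuous_on S (\<lambda>x. restrict (f x) {..<d} i)"
    using assms by (cases "i < d") auto
qed

lemma continuous_on_norm_rd:
  fixes f :: "'a::topological_space \<Rightarrow> nat \<Rightarrow> real"
  assumes "continuous_on S f"
  shows "continuous_on S (\<lambda>x. norm_rd d (f x))"
  unfolding L2_set_def by (intro continuous_intros continuous_on_coord[OF assms])

lemma body_seg:
  assumes "body d L"
  shows "body d (seg d a L)"
  unfolding body_def
proof (intro conjI)
  note L = bodyD[OF assms]
  show "seg d a L \<noteq> {}" using L(2) by (auto simp: seg_def)
  have "continuous_on (L \<times> {-1..1}) (\<lambda>p. \<lambda>i\<in>{..<d}. fst p i + snd p * a i)"
    by (intro continuous_on_restrict_coords continuous_intros continuous_on_coord)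
  then show "compact (seg d a L)"
    unfolding seg_def split_beta using L(3) by (intro compact_continuous_image compact_Times) auto
  show "convex_rd d (seg d a L)"
    unfolding convex_rd_def space_lborel_rd
  proof (intro conjI ballI allI impI)
    show "seg d a L \<subseteq> Rd d" by (simp add: seg_def image_subset_iff split_beta)
    fix x y and u v :: real assume "x \<in> seg d a L" "y \<in> seg d a L" and uv: "0 \<le> u" "0 \<le> v" "u + v = 1"
    then obtain x' y' \<mu> \<nu> where x: "x = (\<lambda>i\<in>{..<d}. x' i + \<mu> * a i)" "x' \<in> L" "\<mu> \<in> {-1..1}"
      and y: "y = (\<lambda>i\<in>{..<d}. y' i + \<nu> * a i)" "y' \<in> L" "\<nu> \<in> {-1..1}" by (auto simp: seg_def)
    have "u * \<mu> + v * \<nu> \<in> {-1..1}"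
      using convexD[OF convex_real_interval(5)[of "-1" 1] x(3) y(3) uv] by simp
    moreover have "(\<lambda>i\<in>{..<d}. u * x' i + v * y' i) \<in> L"
      using L(5) x(2) y(2) uv by blast
    moreover have "(\<lambda>i\<in>{..<d}. u * x i + v * y i) =
        (\<lambda>i\<in>{..<d}. (\<lambda>i\<in>{..<d}. u * x' i + v * y' i) i + (u * \<mu> + v * \<nu>) * a i)"
      unfolding x(1) y(1) by (auto simp: algebra_simps)
    ultimately show "(\<lambda>i\<in>{..<d}. u * x i + v * y i) \<in> seg d a L"
      unfolding seg_def by (intro image_eqI[where x = "(\<lambda>i\<in>{..<d}. u * x' i + v * y' i, u * \<mu> + v * \<nu>)"]) auto
  qed
qed

lemma body_segs: "body d L \<Longrightarrow> body d (segs d as L)"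
  by (induction as) (auto intro: body_seg)

lemma body_linear_image:
  assumes "body d L"
    and cont: "\<And>i. i < m \<Longrightarrow> continuous_on L (\<lambda>x. f x i)"
    and lin: "\<And>x y u v. x \<in> L \<Longrightarrow> y \<in> L \<Longrightarrow>
      restrict (f (\<lambda>i\<in>{..<d}. u * x i + v * y i)) {..<m} = (\<lambda>i\<in>{..<m}. u * f x i + v * f y i)"
  shows "body m ((\<lambda>x. restrict (f x) {..<m}) ` L)"
  unfolding body_def
proof (intro conjI)
  note L = bodyD[OF assms(1)]
  show "(\<lambda>x. restrict (f x) {..<m}) ` L \<noteq> {}" using L(2) by simp
  show "compact ((\<lambda>x. restrict (f x) {..<m}) ` L)"
    by (intro compact_continuous_image continuous_on_restrict_coords cont L(3))
  show "convex_rd m ((\<lambda>x. restrict (f x) {..<m}) ` L)"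
    unfolding convex_rd_def space_lborel_rd
  proof (intro conjI ballI allI impI)
    show "(\<lambda>x. restrict (f x) {..<m}) ` L \<subseteq> Rd m" by (simp add: image_subset_iff)
    fix x y and u v :: real
    assume "x \<in> (\<lambda>x. restrict (f x) {..<m}) ` L" "y \<in> (\<lambda>x. restrict (f x) {..<m}) ` L"
      and uv: "0 \<le> u" "0 \<le> v" "u + v = 1"
    then obtain x' y' where x: "x = restrict (f x') {..<m}" "x' \<in> L" and y: "y = restrict (f y') {..<m}" "y' \<in> L"
      by auto
    have "(\<lambda>i\<in>{..<m}. u * x i + v * y i) = restrict (f (\<lambda>i\<in>{..<d}. u * x' i + v * y' i)) {..<m}"
      unfolding lin[OF x(2) y(2)] x(1) y(1) by auto
    then show "(\<lambda>i\<in>{..<m}. u * x i + v * y i) \<in> (\<lambda>x. restrict (f x) {..<m}) ` L"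
      using L(5)[OF x(2) y(2) uv] by blast
  qed
qed

lemma body_hrefl:
  assumes "body d L"
  shows "body d (hrefl d u ` L)"
proof -
  have "body d ((\<lambda>x. restrict (hrefl d u x) {..<d}) ` L)"
  proof (rule body_linear_image[OF assms])
    have *: "continuous_on L (\<lambda>x. x i)" for i
      by (rule continuous_on_coord) (rule continuous_on_id)
    show "continuous_on L (\<lambda>x. hrefl d u x i)" if "i < d" for i
      using that by (simp add: hrefl_def ip_def) (intro continuous_intros *)
  next
    fix x y and r s :: real
    show "restrict (hrefl d u (\<lambda>i\<in>{..<d}. r * x i + s * y i)) {..<d}
        = (\<lambda>i\<in>{..<d}. r * hrefl d u x i + s * hrefl d u y i)"
      by (auto simp: hrefl_add hrefl_scale)
  qed
  moreover have "restrict (hrefl d u x) {..<d} = hrefl d u x" for x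
    by (simp add: hrefl_def)
  ultimately show ?thesis by simp
qed

lemma body_proj:
  assumes "body (Suc i) L"
  shows "body i (proj i L)"
  unfolding proj_def
proof (rule body_linear_image[OF assms])
  show "continuous_on L (\<lambda>x. x j)" for j
    by (rule continuous_on_coord) (rule continuous_on_id)
qed auto

lemma seg_commute: "seg d a (seg d b L) = seg d b (seg d a L)"
proof -
  have "seg d a (seg d b L) \<subseteq> seg d b (seg d a L)" for a b
  proof
    fix z assume "z \<in> seg d a (seg d b L)"
    then obtain x \<mu> \<nu> where x: "x \<in> L" "\<mu> \<in> {-1..1}" "\<nu> \<in> {-1..1}"
      and z: "z = (\<lambda>i\<in>{..<d}. (\<lambda>i\<in>{..<d}. x i + \<nu> * b i) i + \<mu> * a i)"
      by (auto simp: seg_def)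
    have "z = (\<lambda>i\<in>{..<d}. (\<lambda>i\<in>{..<d}. x i + \<mu> * a i) i + \<nu> * b i)"
      unfolding z by auto
    moreover have "(\<lambda>i\<in>{..<d}. x i + \<mu> * a i) \<in> seg d a L"
      unfolding seg_def using x by (intro image_eqI[where x = "(x, \<mu>)"]) auto
    ultimately show "z \<in> seg d b (seg d a L)"
      unfolding seg_def[of d b] using x
      by (intro image_eqI[where x = "(\<lambda>i\<in>{..<d}. x i + \<mu> * a i, \<nu>)"]) auto
  qed
  then show ?thesis by blast
qed

lemma segs_seg: "segs d as (seg d a L) = seg d a (segs d as L)"
  by (induction as) (simp_all add: seg_commute[of d a])

lemma times_image_fst: "(g ` A) \<times> B = (\<lambda>p. (g (fst p), snd p)) ` (A \<times> B)"
  by (auto simp: image_iff)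

lemma hrefl_seg: "hrefl d u ` seg d a L = seg d (hrefl d u a) (hrefl d u ` L)"
proof -
  have "hrefl d u (\<lambda>i\<in>{..<d}. x i + \<mu> * a i) = (\<lambda>i\<in>{..<d}. hrefl d u x i + \<mu> * hrefl d u a i)" for x \<mu>
    by (auto simp: hrefl_add hrefl_scale)
  then show ?thesis
    unfolding seg_def times_image_fst image_image split_beta by simp
qed

lemma hrefl_segs: "hrefl d u ` segs d as L = segs d (map (hrefl d u) as) (hrefl d u ` L)"
  by (induction as) (simp_all add: hrefl_seg)

lemma proj_seg: "proj i (seg (Suc i) a L) = seg i a (proj i L)"
proof -
  have "restrict (\<lambda>j\<in>{..<Suc i}. x j + \<mu> * a j) {..<i} = (\<lambda>j\<in>{..<i}. restrict x {..<i} j + \<mu> * a j)" for x \<mu>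
    by auto
  then show ?thesis
    unfolding seg_def proj_def times_image_fst image_image split_beta by simp
qed

lemma proj_segs: "proj i (segs (Suc i) as L) = segs i as (proj i L)"
  by (induction as) (simp_all add: proj_seg)

lemma seg_restrict: "seg d (restrict a {..<d}) L = seg d a L"
  unfolding seg_def by (auto intro!: image_cong)

lemma segs_restrict: "segs d (map (\<lambda>a. restrict a {..<d}) as) L = segs d as L"
  by (induction as) (simp_all add: seg_restrict del: restrict_apply)

lemma body_norm_bound:
  assumes "body d L"
  obtains r where "r > 0" "\<And>x. x \<in> L \<Longrightarrow> norm_rd d x \<le> r"
proof -
  have "compact ((\<lambda>x. norm_rd d x) ` L)"
    by (intro compact_continuous_image continuous_on_norm_rd continuous_on_id bodyD(3)[OF assms])
  from compact_imp_bounded[OF this] obtain r where "\<forall>y\<in>(\<lambda>x. norm_rd d x) ` L. norm y \<le> r"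
    unfolding bounded_iff by blast
  then have "\<And>x. x \<in> L \<Longrightarrow> \<bar>norm_rd d x\<bar> \<le> r" by simp
  then have "norm_rd d x \<le> max r 1" if "x \<in> L" for x
    using that abs_ge_self[of "norm_rd d x"] by (meson le_max_iff_disj order_trans)
  then show ?thesis by (intro that[of "max r 1"]) simp_all
qed

lemma scaled_ball_eq:
  assumes "r > 0"
  shows "(\<lambda>x. \<lambda>i\<in>{..<d}. r * x i) ` unit_ball_rd d = {x \<in> Rd d. norm_rd d x \<le> r}"
proof (intro equalityI subsetI)
  fix x assume "x \<in> (\<lambda>x. \<lambda>i\<in>{..<d}. r * x i) ` unit_ball_rd d"
  then obtain y where y: "x = (\<lambda>i\<in>{..<d}. r * y i)" "norm_rd d y \<le> 1"
    by (elim imageE) (simp add: unit_ball_rd_def)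
  have "norm_rd d x = r * norm_rd d y" unfolding y(1) L2_set_restrict norm_scale using assms by simp
  also have "\<dots> \<le> r * 1" by (rule mult_left_mono) (use y(2) assms in simp_all)
  finally show "x \<in> {x \<in> Rd d. norm_rd d x \<le> r}" by (simp add: y(1))
next
  fix x assume x: "x \<in> {x \<in> Rd d. norm_rd d x \<le> r}"
  have "norm_rd d (\<lambda>i\<in>{..<d}. 1 / r * x i) = 1 / r * norm_rd d x"
    unfolding L2_set_restrict norm_scale using assms by simp
  also have "\<dots> \<le> 1" using x assms by simp
  finally have "(\<lambda>i\<in>{..<d}. 1 / r * x i) \<in> unit_ball_rd d"
    by (simp add: unit_ball_rd_def)
  moreover have "x = (\<lambda>i\<in>{..<d}. r * (\<lambda>i\<in>{..<d}. 1 / r * x i) i)"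
    using x assms by (auto simp: fun_eq_iff PiE_def extensional_def)
  ultimately show "x \<in> (\<lambda>x. \<lambda>i\<in>{..<d}. r * x i) ` unit_ball_rd d" by blast
qed

lemma emeasure_ball_rd:
  assumes "r > 0"
  shows "emeasure (lborel_rd d) {x \<in> Rd d. norm_rd d x \<le> r} = ennreal (r ^ d) * emeasure (lborel_rd d) (unit_ball_rd d)"
  using emeasure_scale_rd[OF assms unit_ball_sets, of d] unfolding scaled_ball_eq[OF assms] .

lemma vol_ball_rd:
  assumes "r > 0"
  shows "vol d {x \<in> Rd d. norm_rd d x \<le> r} = r ^ d * vol d (unit_ball_rd d)"
  unfolding measure_def emeasure_ball_rd[OF assms] enn2real_mult using assms by simp

lemma ball_rd_sets [measurable]: "{x \<in> Rd d. norm_rd d x \<le> r} \<in> sets (lborel_rd d)"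
proof -
  have "{x \<in> space (lborel_rd d). norm_rd d x \<le> r} \<in> sets (lborel_rd d)" by measurable
  then show ?thesis by simp
qed

lemma emeasure_bounded_finite:
  assumes "S \<subseteq> {x \<in> Rd d. norm_rd d x \<le> r}"
  shows "emeasure (lborel_rd d) S < \<infinity>"
proof -
  let ?r = "max r 1"
  have "S \<subseteq> {x \<in> Rd d. norm_rd d x \<le> ?r}" using assms by auto
  then have "emeasure (lborel_rd d) S \<le> emeasure (lborel_rd d) {x \<in> Rd d. norm_rd d x \<le> ?r}"
    by (rule emeasure_mono) (rule ball_rd_sets)
  also have "\<dots> < \<infinity>"
    by (subst emeasure_ball_rd) (use emeasure_unit_ball_finite[of d] in \<open>simp_all add: ennreal_mult_less_top\<close>)
  finally show ?thesis .
qed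

lemma emeasure_body_finite:
  assumes "body d L"
  shows "emeasure (lborel_rd d) L < \<infinity>"
proof -
  obtain r where "\<And>x. x \<in> L \<Longrightarrow> norm_rd d x \<le> r" using body_norm_bound[OF assms] by blast
  then show ?thesis
    using bodyD(1)[OF assms] by (intro emeasure_bounded_finite[of L d r]) blast
qed

lemma proj_subset: "proj i L \<subseteq> Rd i"
  by (simp add: proj_def image_subset_iff)

lemma emeasure_slices:
  assumes S [measurable]: "S \<in> sets (lborel_rd (Suc i))"
  shows "emeasure (lborel_rd (Suc i)) S = (\<integral>\<^sup>+x. emeasure lborel {y. x(i := y) \<in> S} \<partial>lborel_rd i)"
    and "x \<in> Rd i \<Longrightarrow> {y. x(i := y) \<in> S} \<in> sets lborel"
proof -
  have m: "{y. x(i := y) \<in> S} \<in> sets lborel" if "x \<in> Rd i" for x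
  proof -
    have "(\<lambda>y. x(i := y)) \<in> borel \<rightarrow>\<^sub>M lborel_rd (Suc i)"
      by (rule measurable_fun_upd[where J = "{..<i}"]) (use that in \<open>auto simp: lessThan_Suc intro!: measurable_const\<close>)
    from measurable_sets[OF this S] show ?thesis by (simp add: vimage_def)
  qed
  then show "x \<in> Rd i \<Longrightarrow> {y. x(i := y) \<in> S} \<in> sets lborel" .
  have "emeasure (lborel_rd (Suc i)) S = (\<integral>\<^sup>+x. indicator S x \<partial>lborel_rd (Suc i))" by simp
  also have "\<dots> = (\<integral>\<^sup>+x. (\<integral>\<^sup>+y. indicator S (x(i := y)) \<partial>lborel) \<partial>lborel_rd i)"
    unfolding lessThan_Suc
    by (rule lborel_prod.product_nn_integral_insert) (use S in \<open>auto simp: lessThan_Suc\<close>)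
  also have "\<dots> = (\<integral>\<^sup>+x. emeasure lborel {y. x(i := y) \<in> S} \<partial>lborel_rd i)"
  proof (rule nn_integral_cong)
    fix x assume "x \<in> space (lborel_rd i)"
    then have "emeasure lborel {y. x(i := y) \<in> S} = (\<integral>\<^sup>+y. indicator {y. x(i := y) \<in> S} y \<partial>lborel)"
      using m by (intro nn_integral_indicator[symmetric]) simp
    then show "(\<integral>\<^sup>+y. indicator S (x(i := y)) \<partial>lborel) = emeasure lborel {y. x(i := y) \<in> S}"
      by (simp add: indicator_def)
  qed
  finally show "emeasure (lborel_rd (Suc i)) S = (\<integral>\<^sup>+x. emeasure lborel {y. x(i := y) \<in> S} \<partial>lborel_rd i)" .
qed

lemma update_restrict:
  assumes "z \<in> Rd (Suc i)"
  shows "(restrict z {..<i})(i := z i) = z"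
  using assms by (auto simp: fun_eq_iff PiE_def extensional_def)

lemma slice_body:
  assumes "body (Suc i) L" and x: "x \<in> proj i L"
  obtains p q where "p \<le> q" "{y. x(i := y) \<in> L} = {p..q}"
proof -
  note L = bodyD[OF assms(1)]
  have xR: "x \<in> Rd i" using x proj_subset by blast
  have eq: "{y. x(i := y) \<in> L} = (\<lambda>z. z i) ` (L \<inter> (\<Inter>j\<in>{..<i}. {z. z j = x j}))" (is "?T = ?I")
  proof (intro equalityI subsetI)
    fix y assume "y \<in> ?T"
    then show "y \<in> ?I" by (intro image_eqI[of _ _ "x(i := y)"]) auto
  next
    fix y assume "y \<in> ?I"
    then obtain z where z: "z \<in> L" "\<And>j. j < i \<Longrightarrow> z j = x j" "y = z i" by auto
    have "restrict z {..<i} = x" using z(2) xR by (auto simp: fun_eq_iff PiE_def extensional_def)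
    then have "x(i := y) = z" using update_restrict[of z i] z L(1) by auto
    then show "y \<in> ?T" using z by simp
  qed
  have c: "continuous_on S (\<lambda>z. z j)" for S :: "(nat \<Rightarrow> real) set" and j
    by (rule continuous_on_coord) (rule continuous_on_id)
  have "closed (\<Inter>j\<in>{..<i}. {z :: nat \<Rightarrow> real. z j = x j})"
    by (intro closed_INT ballI closed_Collect_eq c continuous_on_const)
  then have "compact ?T"
    unfolding eq by (intro compact_continuous_image c compact_Int_closed L(3))
  moreover have "convex ?T"
  proof (rule convexI)
    fix y z and u v :: real assume *: "y \<in> ?T" "z \<in> ?T" "0 \<le> u" "0 \<le> v" "u + v = 1"
    have "(\<lambda>j\<in>{..<Suc i}. u * (x(i := y)) j + v * (x(i := z)) j) \<in> L"
      using L(5)[of "x(i := y)" "x(i := z)" u v] * by (simp only: mem_Collect_eq)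
    moreover have "(\<lambda>j\<in>{..<Suc i}. u * (x(i := y)) j + v * (x(i := z)) j) = x(i := u * y + v * z)"
      using xR *(5) by (auto simp: fun_eq_iff PiE_def extensional_def less_Suc_eq distrib_right[symmetric])
    ultimately show "u *\<^sub>R y + v *\<^sub>R z \<in> ?T" by simp
  qed
  ultimately obtain p q where pq: "?T = {p..q}"
    using connected_compact_interval_1[of ?T] convex_connected by auto
  moreover have "?T \<noteq> {}"
  proof -
    obtain z where "z \<in> L" "x = restrict z {..<i}" using x by (auto simp: proj_def)
    then show ?thesis using update_restrict[of z i] L(1) by (auto intro!: exI[of _ "z i"])
  qed
  ultimately show ?thesis using that[of p q] by auto
qed

lemma slice_empty:
  assumes "L \<subseteq> Rd (Suc i)" "x \<in> Rd i" "x \<notin> proj i L"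
  shows "{y. x(i := y) \<in> L} = {}"
proof -
  have "restrict (x(i := y)) {..<i} = x" for y
    using assms(2) by (auto simp: fun_eq_iff PiE_def extensional_def)
  then show ?thesis using assms(3) unfolding proj_def by (metis (mono_tags, lifting) Collect_empty_eq imageI)
qed

lemma slice_seg:
  assumes "body (Suc i) L" and x: "x \<in> proj i L" and e: "\<And>j. j < i \<Longrightarrow> e j = 0"
    and pq: "p \<le> q" "{y. x(i := y) \<in> L} = {p..q}"
  shows "{y. x(i := y) \<in> seg (Suc i) e L} = {p - \<bar>e i\<bar>..q + \<bar>e i\<bar>}"
proof (intro equalityI subsetI)
  have xR: "x \<in> Rd i" using x proj_subset by blast
  fix y assume "y \<in> {y. x(i := y) \<in> seg (Suc i) e L}"
  then obtain z \<mu> where z: "z \<in> L" "\<bar>\<mu>\<bar> \<le> 1" "x(i := y) = (\<lambda>j\<in>{..<Suc i}. z j + \<mu> * e j)"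
    by (auto simp: seg_def abs_le_iff)
  have "restrict z {..<i} = x"
  proof
    fix j show "restrict z {..<i} j = x j"
      using fun_cong[OF z(3), of j] e[of j] xR by (cases "j < i") (auto simp: PiE_def extensional_def)
  qed
  then have "x(i := z i) = z" using update_restrict[of z i] bodyD(1)[OF assms(1)] z(1) by auto
  then have "z i \<in> {p..q}" using z(1) pq(2) by auto
  moreover have "y = z i + \<mu> * e i" using fun_cong[OF z(3), of i] by simp
  moreover have "\<bar>\<mu> * e i\<bar> \<le> \<bar>e i\<bar>" using z(2) mult_right_mono[OF z(2), of "\<bar>e i\<bar>"] by (simp add: abs_mult)
  ultimately show "y \<in> {p - \<bar>e i\<bar>..q + \<bar>e i\<bar>}" by auto
next
  have xR: "x \<in> Rd i" using x proj_subset by blast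
  fix y assume y: "y \<in> {p - \<bar>e i\<bar>..q + \<bar>e i\<bar>}"
  define w where "w = max p (min q y)"
  have w: "w \<in> {p..q}" "\<bar>y - w\<bar> \<le> \<bar>e i\<bar>" using y pq(1) by (auto simp: w_def)
  define \<mu> where "\<mu> = (y - w) / e i"
  have \<mu>: "\<bar>\<mu>\<bar> \<le> 1" "\<mu> * e i = y - w"
    using w(2) by (auto simp: \<mu>_def divide_le_eq_1 abs_divide)
  have "x(i := w) \<in> L" using pq(2) w(1) by blast
  moreover have "x(i := y) = (\<lambda>j\<in>{..<Suc i}. (x(i := w)) j + \<mu> * e j)"
    using e xR \<mu>(2) by (auto simp: fun_eq_iff PiE_def extensional_def less_Suc_eq)
  ultimately show "y \<in> {y. x(i := y) \<in> seg (Suc i) e L}"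
    unfolding seg_def using \<mu>(1) by (auto intro!: image_eqI[where x = "(x(i := w), \<mu>)"] simp: abs_le_iff)
qed

lemma vol_seg_axis:
  assumes L: "body (Suc i) L" and e: "\<And>j. j < i \<Longrightarrow> e j = 0"
  shows "vol (Suc i) (seg (Suc i) e L) = vol (Suc i) L + 2 * \<bar>e i\<bar> * vol i (proj i L)"
proof -
  let ?S = "seg (Suc i) e L"
  have S: "body (Suc i) ?S" by (rule body_seg[OF L])
  have P: "body i (proj i L)" by (rule body_proj[OF L])
  note [measurable] = bodyD(4)[OF L] bodyD(4)[OF S] bodyD(4)[OF P]
  have "proj i ?S = seg i e (proj i L)" by (rule proj_seg)
  also have "\<dots> = proj i L"
  proof -
    have "(\<lambda>j\<in>{..<i}. x j + \<mu> * e j) = x" if "x \<in> proj i L" for x \<mu>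
      using that bodyD(1)[OF P] e by (auto simp: fun_eq_iff PiE_def extensional_def subset_iff)
    then have "(\<lambda>p. \<lambda>j\<in>{..<i}. fst p j + snd p * e j) ` (proj i L \<times> {-1..1}) = fst ` (proj i L \<times> {-1..1 :: real})"
      by (intro image_cong) auto
    then show ?thesis unfolding seg_def split_beta by simp
  qed
  finally have pS: "proj i ?S = proj i L" .
  have slice: "emeasure lborel {y. x(i := y) \<in> ?S} = emeasure lborel {y. x(i := y) \<in> L} +
      ennreal (2 * \<bar>e i\<bar>) * indicator (proj i L) x" if x: "x \<in> Rd i" for x
  proof (cases "x \<in> proj i L")
    case True
    from slice_body[OF L True] obtain p q where pq: "p \<le> q" "{y. x(i := y) \<in> L} = {p..q}" .
    have "{y. x(i := y) \<in> ?S} = {p - \<bar>e i\<bar>..q + \<bar>e i\<bar>}"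
      by (rule slice_seg[OF L True e pq])
    then show ?thesis
      unfolding pq(2) using pq(1) True
      by (simp add: ennreal_plus[symmetric] del: ennreal_plus)
  next
    case False
    then show ?thesis
      using slice_empty[OF bodyD(1)[OF L] x] slice_empty[OF bodyD(1)[OF S] x] pS by simp
  qed
  have [measurable]: "(\<lambda>x. emeasure lborel {y. x(i := y) \<in> L}) \<in> borel_measurable (lborel_rd i)"
  proof -
    have "(\<lambda>p. (fst p)(i := snd p)) \<in> lborel_rd i \<Otimes>\<^sub>M lborel \<rightarrow>\<^sub>M lborel_rd (Suc i)"
      using measurable_add_dim[of i "{..<i}" "\<lambda>_. lborel :: real measure"] by (simp add: lessThan_Suc split_beta')
    then have "{p \<in> space (lborel_rd i \<Otimes>\<^sub>M lborel). (fst p)(i := snd p) \<in> L} \<in> sets (lborel_rd i \<Otimes>\<^sub>M lborel)"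
      by measurable
    from lborel.measurable_emeasure_Pair[OF this]
    show ?thesis
      by (rule subst[OF measurable_cong, rotated, where P = "\<lambda>x. x"])
         (auto intro!: arg_cong[where f = "emeasure lborel"] simp: space_pair_measure)
  qed
  have "emeasure (lborel_rd (Suc i)) ?S =
      (\<integral>\<^sup>+x. emeasure lborel {y. x(i := y) \<in> L} + ennreal (2 * \<bar>e i\<bar>) * indicator (proj i L) x \<partial>lborel_rd i)"
    unfolding emeasure_slices(1)[OF bodyD(4)[OF S]] by (intro nn_integral_cong slice) simp
  also have "\<dots> = emeasure (lborel_rd (Suc i)) L + ennreal (2 * \<bar>e i\<bar>) * emeasure (lborel_rd i) (proj i L)"
    unfolding emeasure_slices(1)[OF bodyD(4)[OF L]]
    by (subst nn_integral_add) (simp_all add: nn_integral_cmult)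
  finally show ?thesis
    using emeasure_body_finite[OF L] emeasure_body_finite[OF P]
    unfolding measure_def by (simp add: enn2real_plus enn2real_mult ennreal_mult_less_top)
qed

lemma ex_hrefl_to_axis:
  obtains u where "norm_rd (Suc i) u = 1" "\<And>j. j < i \<Longrightarrow> hrefl (Suc i) u a j = 0"
    "\<bar>hrefl (Suc i) u a i\<bar> = norm_rd (Suc i) a"
proof -
  let ?d = "Suc i"
  define r where "r = norm_rd ?d a"
  define e where "e = (\<lambda>j. if j = i then 1 else 0 :: real)"
  define w where "w = (\<lambda>j. a j - r * e j)"
  have ip_e: "ip ?d x e = x i" for x
    by (simp add: ip_def e_def if_distrib cong: if_cong)
  have ee: "norm_rd ?d e = 1"
  proof -
    have "(norm_rd ?d e)\<^sup>2 = 1" unfolding ip_self[symmetric] ip_e by (simp add: e_def)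
    then show ?thesis by (intro power2_eq_imp_eq[of "norm_rd ?d e" 1]) simp_all
  qed
  show ?thesis
  proof (cases "norm_rd ?d w = 0")
    case True
    then have w0: "w j = 0" if "j < ?d" for j using abs_coord_le_norm[OF that, of w] by simp
    have a: "a j = r * e j" if "j < ?d" for j using w0[OF that] by (simp add: w_def)
    have "ip ?d a e = r" unfolding ip_e using a[of i] by (simp add: e_def)
    then have "hrefl ?d e a j = - r * e j" if "j < ?d" for j
      using that a[OF that] by (simp add: hrefl_def)
    then show ?thesis using ee by (intro that[of e]) (auto simp: e_def r_def)
  next
    case False
    define n where "n = norm_rd ?d w"
    define u where "u = (\<lambda>j. 1 / n * w j)"
    have n: "n > 0" using False by (simp add: n_def order_less_le)
    have u: "norm_rd ?d u = 1"
      unfolding u_def norm_scale using n by (simp add: n_def)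
    have aw: "ip ?d a w = r\<^sup>2 - r * a i"
      unfolding ip_commute[of ?d a] w_def ip_diff ip_self
      by (subst ip_scale) (simp add: r_def ip_self ip_commute[of ?d e] ip_e)
    have ww: "n\<^sup>2 = ip ?d a w - r * w i"
    proof -
      have "n\<^sup>2 = ip ?d w w" by (simp add: n_def ip_self)
      also have "\<dots> = ip ?d a w - ip ?d (\<lambda>j. r * e j) w" by (subst w_def) (rule ip_diff)
      also have "ip ?d (\<lambda>j. r * e j) w = r * w i" by (subst ip_scale) (simp add: ip_commute[of ?d e] ip_e)
      finally show ?thesis .
    qed
    have 2: "2 * ip ?d a w = n\<^sup>2"
      unfolding ww aw by (simp add: w_def e_def power2_eq_square algebra_simps)
    have "ip ?d a u = ip ?d a w / n"
      unfolding u_def ip_commute[of ?d a] by (subst ip_scale) simp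
    then have "hrefl ?d u a j = r * e j" if "j < ?d" for j
    proof -
      have "hrefl ?d u a j = a j - (2 * ip ?d a w) / n\<^sup>2 * w j"
        using that \<open>ip ?d a u = ip ?d a w / n\<close> by (simp add: hrefl_def u_def power2_eq_square)
      also have "\<dots> = a j - w j" unfolding 2 using n by simp
      finally show ?thesis by (simp add: w_def)
    qed
    then show ?thesis using u by (intro that[of u]) (auto simp: e_def r_def)
  qed
qed

fun mixed_diff :: "('a list \<Rightarrow> real) \<Rightarrow> 'a list \<Rightarrow> real" where
  "mixed_diff f [] = f []"
| "mixed_diff f (a # as) = mixed_diff (\<lambda>bs. f (a # bs)) as - mixed_diff f as"

lemma mixed_diff_diff: "mixed_diff (\<lambda>bs. f bs - g bs) as = mixed_diff f as - mixed_diff g as"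
  by (induction as arbitrary: f g) simp_all

lemma mixed_diff_cmult: "mixed_diff (\<lambda>bs. c * f bs) as = c * mixed_diff f as"
  by (induction as arbitrary: f) (simp_all add: right_diff_distrib)

lemma mixed_diff_map: "mixed_diff f (map h as) = mixed_diff (\<lambda>bs. f (map h bs)) as"
  by (induction as arbitrary: f) simp_all

lemma mixed_diff_Cons: "mixed_diff f (a # as) = mixed_diff (\<lambda>bs. f (a # bs) - f bs) as"
  by (simp add: mixed_diff_diff)

lemma sum_mixed_diff_subseqs: "f as = (\<Sum>bs\<leftarrow>List.subseqs as. mixed_diff f bs)"
proof (induction as arbitrary: f)
  case (Cons a as)
  have "(\<Sum>bs\<leftarrow>List.subseqs (a # as). mixed_diff f bs) =
      (\<Sum>bs\<leftarrow>List.subseqs as. mixed_diff (\<lambda>cs. f (a # cs)) bs - mixed_diff f bs) + (\<Sum>bs\<leftarrow>List.subseqs as. mixed_diff f bs)"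
    by (simp add: Let_def comp_def)
  also have "\<dots> = (\<Sum>bs\<leftarrow>List.subseqs as. mixed_diff (\<lambda>cs. f (a # cs)) bs)"
    by (simp add: sum_list_subtractf)
  finally show ?case using Cons[of "\<lambda>cs. f (a # cs)"] by simp
qed simp

definition zvol :: "nat \<Rightarrow> (nat \<Rightarrow> real) set \<Rightarrow> (nat \<Rightarrow> real) list \<Rightarrow> real" where
  "zvol d L as = vol d (segs d as L)"

lemma zvol_hrefl:
  assumes "body d L" "norm_rd d u = 1"
  shows "zvol d (hrefl d u ` L) (map (hrefl d u) as) = zvol d L as"
  unfolding zvol_def hrefl_segs[symmetric]
  by (rule vol_hrefl[OF assms(2)]) (rule bodyD(4)[OF body_segs[OF assms(1)]])

lemma zvol_axis:
  assumes "body (Suc i) L" "\<And>j. j < i \<Longrightarrow> e j = 0"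
  shows "zvol (Suc i) L (e # as) - zvol (Suc i) L as = 2 * \<bar>e i\<bar> * zvol i (proj i L) as"
  unfolding zvol_def foldr.simps comp_apply
  by (subst vol_seg_axis[OF body_segs[OF assms(1)] assms(2)]) (simp_all add: proj_segs)

lemma mixed_diff_zvol_step:
  assumes L: "body (Suc i) L"
  obtains L' u where "body i L'"
    "\<And>s as. mixed_diff (zvol (Suc i) L) ((\<lambda>j. s * a j) # as) =
       2 * \<bar>s\<bar> * norm_rd (Suc i) a * mixed_diff (zvol i L') (map (hrefl (Suc i) u) as)"
proof -
  obtain u where u: "norm_rd (Suc i) u = 1" "\<And>j. j < i \<Longrightarrow> hrefl (Suc i) u a j = 0"
    "\<bar>hrefl (Suc i) u a i\<bar> = norm_rd (Suc i) a" using ex_hrefl_to_axis[of i a] by blast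
  let ?R = "hrefl (Suc i) u"
  have RL: "body (Suc i) (?R ` L)" by (rule body_hrefl[OF L])
  show ?thesis
  proof (rule that[OF body_proj[OF RL]])
    fix s as
    let ?sa = "\<lambda>j. s * a j"
    have R: "?R ?sa = (\<lambda>j\<in>{..<Suc i}. s * ?R a j)" by (rule hrefl_scale)
    have 0: "?R ?sa j = 0" if "j < i" for j using that u(2) by (simp add: R)
    have 1: "\<bar>?R ?sa i\<bar> = \<bar>s\<bar> * norm_rd (Suc i) a" using u(3) by (simp add: R abs_mult)
    have "mixed_diff (zvol (Suc i) L) (?sa # as) = mixed_diff (\<lambda>bs. zvol (Suc i) (?R ` L) (map ?R (?sa # bs)) - zvol (Suc i) (?R ` L) (map ?R bs)) as"
      unfolding mixed_diff_Cons zvol_hrefl[OF L u(1)] ..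
    also have "\<dots> = mixed_diff (\<lambda>bs. 2 * \<bar>?R ?sa i\<bar> * zvol i (proj i (?R ` L)) (map ?R bs)) as"
      unfolding list.map by (subst zvol_axis[OF RL 0]) auto
    also have "\<dots> = 2 * \<bar>s\<bar> * norm_rd (Suc i) a * mixed_diff (zvol i (proj i (?R ` L))) (map ?R as)"
      unfolding mixed_diff_cmult mixed_diff_map 1 by simp
    finally show "mixed_diff (zvol (Suc i) L) (?sa # as) =
       2 * \<bar>s\<bar> * norm_rd (Suc i) a * mixed_diff (zvol i (proj i (?R ` L))) (map ?R as)" .
  qed
qed

lemma zvol_0: 
  assumes "body 0 L"
  shows "zvol 0 L as = zvol 0 L []"
proof -
  have "segs 0 as L = segs 0 [] L"
    using bodyD(1,2)[OF body_segs[OF assms, of as]] bodyD(1,2)[OF assms] by auto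
  then show ?thesis by (simp add: zvol_def)
qed

lemma mixed_diff_zvol_eq_0: "body d L \<Longrightarrow> d < length as \<Longrightarrow> mixed_diff (zvol d L) as = 0"
proof (induction d arbitrary: L as)
  case 0
  then obtain a bs where as: "as = a # bs" by (cases as) auto
  have "zvol 0 L = (\<lambda>_. zvol 0 L [])" using zvol_0[OF 0(1)] by blast
  then have "mixed_diff (zvol 0 L) (a # bs) = mixed_diff (\<lambda>bs. zvol 0 L [] - zvol 0 L []) bs"
    unfolding mixed_diff_Cons by metis
  also have "\<dots> = 0" unfolding mixed_diff_diff by simp
  finally show ?case by (simp add: as)
next
  case (Suc i)
  then obtain a bs where as: "as = a # bs" by (cases as) auto
  obtain L' u where "body i L'" and
    *: "\<And>s as. mixed_diff (zvol (Suc i) L) ((\<lambda>j. s * a j) # as) =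
       2 * \<bar>s\<bar> * norm_rd (Suc i) a * mixed_diff (zvol i L') (map (hrefl (Suc i) u) as)"
    using mixed_diff_zvol_step[OF Suc(2)] by blast
  then show ?case using *[of 1 bs] Suc.IH[of L' "map (hrefl (Suc i) u) bs"] Suc.prems(2) by (simp add: as)
qed

lemma mixed_diff_zvol_scale:
  assumes "body d L" "s \<ge> 0"
  shows "mixed_diff (zvol d L) (map (\<lambda>a j. s * a j) as) = s ^ length as * mixed_diff (zvol d L) as"
  using assms(1)
proof (induction as arbitrary: L)
  case Nil
  then show ?case by simp
next
  case (Cons a as)
  have c: "zvol d L (a # bs) = zvol d (seg d a L) bs" for bs
    by (simp add: zvol_def segs_seg)
  have hom: "mixed_diff (zvol d L) ((\<lambda>j. s * a j) # bs) = s * mixed_diff (zvol d L) (a # bs)" for bs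
  proof (cases d)
    case 0
    with mixed_diff_zvol_eq_0[OF Cons.prems] show ?thesis by (simp del: mixed_diff.simps)
  next
    case (Suc i)
    from Cons.prems Suc have L: "body (Suc i) L" by simp
    obtain L' u where "body i L'" and
      *: "\<And>s as. mixed_diff (zvol (Suc i) L) ((\<lambda>j. s * a j) # as) =
         2 * \<bar>s\<bar> * norm_rd (Suc i) a * mixed_diff (zvol i L') (map (hrefl (Suc i) u) as)"
      using mixed_diff_zvol_step[OF L, of a] by blast
    have "mixed_diff (zvol (Suc i) L) ((\<lambda>j. s * a j) # bs) = s * mixed_diff (zvol (Suc i) L) ((\<lambda>j. 1 * a j) # bs)"
      unfolding * using assms(2) by simp
    then show ?thesis unfolding Suc mult_1 .
  qed
  have "mixed_diff (zvol d L) (map (\<lambda>a j. s * a j) (a # as)) = s * mixed_diff (zvol d L) (a # map (\<lambda>a j. s * a j) as)"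
    by (simp add: hom del: mixed_diff.simps)
  also have "\<dots> = s * (mixed_diff (zvol d (seg d a L)) (map (\<lambda>a j. s * a j) as) - mixed_diff (zvol d L) (map (\<lambda>a j. s * a j) as))"
    by (simp add: c)
  also have "\<dots> = s ^ length (a # as) * mixed_diff (zvol d L) (a # as)"
    unfolding Cons.IH[OF body_seg[OF Cons.prems]] Cons.IH[OF Cons.prems] by (simp add: c algebra_simps)
  finally show ?case .
qed

text \<open>A tower models the volumes of \<open>L + [-a\<^sub>1,a\<^sub>1] + \<dots> + [-a\<^sub>m,a\<^sub>m]\<close> and of all its coordinate projections,
  for a deterministic or (after taking expectations) random body \<open>L\<close> with rotation invariant law.\<close>

definition tower :: "nat \<Rightarrow> (nat \<Rightarrow> (nat \<Rightarrow> real) list \<Rightarrow> real) \<Rightarrow> bool" where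
  "tower d J \<longleftrightarrow>
     (\<forall>i<d. \<forall>e bs. (\<forall>j<i. e j = 0) \<longrightarrow> J (Suc i) (e # bs) - J (Suc i) bs = 2 * \<bar>e i\<bar> * J i bs) \<and>
     (\<forall>i bs. J i (map (\<lambda>a. restrict a {..<i}) bs) = J i bs) \<and>
     (\<forall>u bs. norm_rd d u = 1 \<longrightarrow> J d (map (hrefl d u) bs) = J d bs)"

lemma tower_down:
  assumes "tower (Suc i) J"
  shows "tower i J"
proof -
  let ?d = "Suc i"
  have axis: "\<And>i e bs. i < ?d \<Longrightarrow> (\<forall>j<i. e j = 0) \<Longrightarrow> J (Suc i) (e # bs) - J (Suc i) bs = 2 * \<bar>e i\<bar> * J i bs"
    and restr: "\<And>i bs. J i (map (\<lambda>a. restrict a {..<i}) bs) = J i bs"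
    and inv: "\<And>u bs. norm_rd ?d u = 1 \<Longrightarrow> J ?d (map (hrefl ?d u) bs) = J ?d bs"
    using assms unfolding tower_def by blast+
  have "J i (map (hrefl i u) bs) = J i bs" if u: "norm_rd i u = 1" for u bs
  proof -
    define u' where "u' = u(i := 0)"
    define e where "e = (\<lambda>j. if j = i then 1 else 0 :: real)"
    let ?R = "hrefl ?d u'"
    have ip': "ip ?d x u' = ip i x u" for x
      by (auto simp: ip_def u'_def intro!: sum.cong)
    have "(norm_rd ?d u')\<^sup>2 = (norm_rd i u)\<^sup>2"
      unfolding ip_self[symmetric] ip' by (auto simp: ip_def u'_def intro!: sum.cong)
    then have u': "norm_rd ?d u' = 1" using u by (intro power2_eq_imp_eq[of "norm_rd ?d u'" 1]) simp_all
    have Re: "?R e j = e j" if "j < ?d" for j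
      using that unfolding hrefl_def ip' by (simp add: ip_def e_def)
    have r: "restrict (?R a) {..<i} = hrefl i u a" for a
      unfolding hrefl_def ip' by (auto simp: u'_def)
    have "2 * J i bs = J ?d (e # bs) - J ?d bs"
      using axis[of i e bs] by (simp add: e_def)
    also have "\<dots> = J ?d (?R e # map ?R bs) - J ?d (map ?R bs)"
      using inv[OF u', of "e # bs"] inv[OF u', of bs] by simp
    also have "\<dots> = 2 * J i (map ?R bs)"
      using axis[of i "?R e" "map ?R bs"] Re by (simp add: e_def)
    also have "J i (map ?R bs) = J i (map (hrefl i u) bs)"
      unfolding restr[of i "map ?R bs", symmetric] by (simp add: r comp_def)
    finally show ?thesis by simp
  qed
  then show ?thesis
    unfolding tower_def using axis restr by simp
qed

lemma tower_mixed_diff: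
  assumes "length as \<le> d"
  shows "\<exists>\<gamma>. \<forall>J. tower d J \<longrightarrow> mixed_diff (J d) as = \<gamma> * J (d - length as) []"
  using assms
proof (induction as arbitrary: d rule: length_induct)
  case (1 as)
  show ?case
  proof (cases as)
    case Nil
    then show ?thesis by (intro exI[of _ 1]) simp
  next
    case (Cons a bs)
    then obtain i where d: "d = Suc i" using 1(2) by (cases d) auto
    obtain u where u: "norm_rd (Suc i) u = 1" "\<And>j. j < i \<Longrightarrow> hrefl (Suc i) u a j = 0"
      using ex_hrefl_to_axis[of i a] by blast
    let ?R = "hrefl (Suc i) u"
    obtain \<gamma> where \<gamma>: "\<And>J. tower i J \<Longrightarrow> mixed_diff (J i) (map ?R bs) = \<gamma> * J (i - length bs) []"
      using 1(1)[rule_format, of "map ?R bs" i] Cons 1(2) d by auto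
    have "mixed_diff (J d) as = 2 * \<bar>?R a i\<bar> * \<gamma> * J (d - length as) []" if J: "tower d J" for J
    proof -
      have axis: "\<And>e cs. (\<forall>j<i. e j = 0) \<Longrightarrow> J d (e # cs) - J d cs = 2 * \<bar>e i\<bar> * J i cs"
        and inv: "\<And>cs. J d (map ?R cs) = J d cs"
        using J u(1) unfolding tower_def d by blast+
      have "mixed_diff (J d) as = mixed_diff (\<lambda>cs. J d (?R a # map ?R cs) - J d (map ?R cs)) bs"
        unfolding Cons mixed_diff_Cons inv inv[of "_ # _", unfolded list.map] ..
      also have "\<dots> = mixed_diff (\<lambda>cs. 2 * \<bar>?R a i\<bar> * J i (map ?R cs)) bs"
        using u(2) by (subst axis) auto
      also have "\<dots> = 2 * \<bar>?R a i\<bar> * mixed_diff (J i) (map ?R bs)"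
        unfolding mixed_diff_cmult mixed_diff_map ..
      finally show ?thesis
        using \<gamma>[OF tower_down[OF J[unfolded d]]] by (simp add: Cons d)
    qed
    then show ?thesis by blast
  qed
qed

section \<open>Separation, nets and zonotopes\<close>

lemma segI: "x \<in> L \<Longrightarrow> \<mu> \<in> {-1..1} \<Longrightarrow> (\<lambda>i\<in>{..<d}. x i + \<mu> * a i) \<in> seg d a L"
  unfolding seg_def by (rule image_eqI[where x = "(x, \<mu>)"]) simp_all

lemma segE:
  assumes "z \<in> seg d a L"
  obtains x \<mu> where "x \<in> L" "\<mu> \<in> {-1..1}" "z = (\<lambda>i\<in>{..<d}. x i + \<mu> * a i)"
  using assms unfolding seg_def by auto

lemma norm_diff_sq:
  "(norm_rd d (\<lambda>i. x i - y i))\<^sup>2 = (norm_rd d x)\<^sup>2 - 2 * ip d x y + (norm_rd d y)\<^sup>2"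
  unfolding ip_self[symmetric]
  by (simp add: ip_def algebra_simps sum.distrib sum_subtractf sum_distrib_left)

lemma body_separation:
  assumes C: "body d C" and y: "y \<in> Rd d" "y \<notin> C"
  obtains u where "norm_rd d u = 1" "\<And>x. x \<in> C \<Longrightarrow> ip d x u < ip d y u"
proof -
  have "continuous_on C (\<lambda>x. norm_rd d (\<lambda>i. y i - x i))"
    unfolding L2_set_def by (intro continuous_intros continuous_on_coord continuous_on_id)
  with bodyD(2,3)[OF C] obtain p where p: "p \<in> C"
    "\<And>x. x \<in> C \<Longrightarrow> norm_rd d (\<lambda>i. y i - p i) \<le> norm_rd d (\<lambda>i. y i - x i)"
    using continuous_attains_inf[of C "\<lambda>x. norm_rd d (\<lambda>i. y i - x i)"] by blast
  define w where "w = (\<lambda>i. y i - p i)"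
  have "norm_rd d w \<noteq> 0"
  proof
    assume 0: "norm_rd d w = 0"
    have "y i = p i" if "i < d" for i
      using abs_coord_le_norm[OF that, of w] 0 by (simp add: w_def)
    moreover have "p \<in> Rd d" using p(1) bodyD(1)[OF C] by blast
    ultimately have "y = p" using y(1) by (intro PiE_ext) auto
    then show False using y(2) p(1) by simp
  qed
  then have w: "norm_rd d w > 0" by (simp add: order_less_le)
  have le: "ip d (\<lambda>i. x i - p i) w \<le> 0" if x: "x \<in> C" for x
  proof (rule ccontr)
    define z where "z = (\<lambda>i. x i - p i)"
    define D where "D = ip d z w"
    define N where "N = (norm_rd d z)\<^sup>2"
    assume "\<not> ?thesis"
    then have D: "D > 0" by (simp add: D_def z_def)
    have N: "N \<ge> 0" by (simp add: N_def)
    define t where "t = min 1 (D / (N + 1))"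
    have "t \<le> D / (N + 1)" by (simp add: t_def)
    then have "t * (N + 1) \<le> D" using N by (simp add: pos_le_divide_eq)
    moreover have "0 < t" "t \<le> 1" using D N by (simp_all add: t_def)
    ultimately have t: "0 < t" "t \<le> 1" "t * (N + 1) \<le> D" by blast+
    have "(\<lambda>i\<in>{..<d}. t * x i + (1 - t) * p i) \<in> C"
      using t by (intro bodyD(5)[OF C x p(1)]) auto
    from p(2)[OF this] have "norm_rd d w \<le> norm_rd d (\<lambda>i. y i - (\<lambda>i\<in>{..<d}. t * x i + (1 - t) * p i) i)"
      by (simp add: w_def)
    also have "\<dots> = norm_rd d (\<lambda>i. w i - t * z i)"
      by (intro L2_set_cong) (auto simp: w_def z_def algebra_simps)
    finally have "(norm_rd d w)\<^sup>2 \<le> (norm_rd d (\<lambda>i. w i - t * z i))\<^sup>2"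
      by (intro power_mono) auto
    also have "\<dots> = (norm_rd d w)\<^sup>2 - 2 * t * D + t\<^sup>2 * N"
      unfolding norm_diff_sq norm_scale power_mult_distrib ip_commute[of d w] ip_scale D_def N_def by simp
    finally have "2 * t * D \<le> t * (t * N)" by (simp add: power2_eq_square)
    then have "2 * D \<le> t * N" using t(1) by (simp add: mult.assoc mult.left_commute)
    moreover have "t * N \<le> D" using t by (simp add: algebra_simps)
    ultimately show False using D by simp
  qed
  define u where "u = (\<lambda>i. 1 / norm_rd d w * w i)"
  have sep: "ip d x u < ip d y u" if x: "x \<in> C" for x
  proof -
    have "ip d x w - ip d p w \<le> 0" using le[OF x] by (simp add: ip_diff)
    moreover have "ip d y w - ip d p w = (norm_rd d w)\<^sup>2"
      unfolding ip_diff[symmetric] w_def[symmetric] ip_self ..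
    moreover have "(norm_rd d w)\<^sup>2 > 0" using w by simp
    ultimately have "ip d x w < ip d y w" by linarith
    then show ?thesis
      unfolding u_def ip_commute[of d _ "\<lambda>i. 1 / norm_rd d w * w i"] ip_scale
      using w by (simp add: ip_commute divide_strict_right_mono)
  qed
  have "norm_rd d u = 1" unfolding u_def norm_scale using w by simp
  then show ?thesis using sep that by blast
qed

lemma ball_subset_body:
  assumes C: "body d C" and r: "\<And>u. norm_rd d u = 1 \<Longrightarrow> \<exists>x\<in>C. r \<le> ip d x u"
  shows "{x \<in> Rd d. norm_rd d x \<le> r} \<subseteq> C"
proof (rule ccontr)
  assume "\<not> ?thesis"
  then obtain y where y: "y \<in> Rd d" "norm_rd d y \<le> r" "y \<notin> C" by blast
  obtain u where u: "norm_rd d u = 1" "\<And>x. x \<in> C \<Longrightarrow> ip d x u < ip d y u"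
    using body_separation[OF C y(1,3)] by blast
  obtain x where "x \<in> C" "r \<le> ip d x u" using r[OF u(1)] by blast
  with u(2)[of x] have "r < ip d y u" by linarith
  also have "\<dots> \<le> norm_rd d y * norm_rd d u" using ip_le_norm[of d y u] by linarith
  finally show False using y(2) u(1) by simp
qed

lemma norm_triangle: "norm_rd d (\<lambda>i. x i + y i) \<le> norm_rd d x + norm_rd d y"
  by (rule L2_set_triangle_ineq)

text \<open>Two unit vectors with the same cell \<open>\<lfloor>N u\<^sub>i\<rfloor>\<close>, \<open>i < d\<close>, are close; the net picks one vector per cell.\<close>

lemma sphere_net:
  assumes N: "N \<ge> 1"
  obtains T where "finite T" "card T \<le> (2 * N + 1) ^ d" "\<And>v. v \<in> T \<Longrightarrow> norm_rd d v = 1"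
    "\<And>u. norm_rd d u = 1 \<Longrightarrow> \<exists>v\<in>T. norm_rd d (\<lambda>i. u i - v i) \<le> real d / real N"
proof -
  define S where "S = {u. norm_rd d u = 1}"
  define c where "c u = (\<lambda>i\<in>{..<d}. \<lfloor>real N * u i\<rfloor>)" for u :: "nat \<Rightarrow> real"
  define Q where "Q = Pi\<^sub>E {..<d} (\<lambda>_. {- int N..int N})"
  have Q: "finite Q" "card Q = (2 * N + 1) ^ d"
    unfolding Q_def by (auto intro!: finite_PiE simp: card_PiE nat_add_distrib nat_mult_distrib)
  have cQ: "c ` S \<subseteq> Q"
  proof
    fix q assume "q \<in> c ` S"
    then obtain u where u: "q = c u" "norm_rd d u = 1" by (auto simp: S_def)
    have "\<lfloor>real N * u i\<rfloor> \<in> {- int N..int N}" if "i < d" for i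
    proof -
      have a: "\<bar>u i\<bar> \<le> 1" using abs_coord_le_norm[OF that, of u] u(2) by simp
      have "real N * u i \<le> real N * 1" by (rule mult_left_mono) (use a in auto)
      moreover have "real N * (-1) \<le> real N * u i" by (rule mult_left_mono) (use a in auto)
      ultimately show ?thesis by (simp add: le_floor_iff floor_le_iff)
    qed
    then show "q \<in> Q" by (simp add: u(1) c_def Q_def)
  qed
  define g where "g q = (SOME u. u \<in> S \<and> c u = q)" for q
  have g: "g q \<in> S \<and> c (g q) = q" if q: "q \<in> c ` S" for q
  proof -
    obtain u where "u \<in> S \<and> c u = q" using q by blast
    then show ?thesis unfolding g_def by (rule someI[of "\<lambda>u. u \<in> S \<and> c u = q"])
  qed
  let ?T = "g ` c ` S"
  have f: "finite (c ` S)" using finite_subset[OF cQ Q(1)] .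
  show ?thesis
  proof (rule that[of ?T])
    show "finite ?T" using f by simp
    have "card ?T \<le> card (c ` S)" by (rule card_image_le[OF f])
    also have "\<dots> \<le> card Q" by (rule card_mono[OF Q(1) cQ])
    finally show "card ?T \<le> (2 * N + 1) ^ d" using Q(2) by simp
    show "norm_rd d v = 1" if "v \<in> ?T" for v using that g by (auto simp: S_def)
    fix u :: "nat \<Rightarrow> real" assume "norm_rd d u = 1"
    then have cu: "c u \<in> c ` S" by (simp add: S_def)
    define v where "v = g (c u)"
    have cv: "c v = c u" using g[OF cu] by (simp add: v_def)
    have close: "\<bar>u i - v i\<bar> \<le> 1 / real N" if "i < d" for i
    proof -
      have "\<lfloor>real N * u i\<rfloor> = \<lfloor>real N * v i\<rfloor>" using fun_cong[OF cv, of i] that by (simp add: c_def)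
      then have "\<bar>real N * u i - real N * v i\<bar> \<le> 1" by linarith
      then have "real N * \<bar>u i - v i\<bar> \<le> 1" by (simp add: right_diff_distrib[symmetric] abs_mult)
      then show ?thesis using N by (simp add: field_simps)
    qed
    have "norm_rd d (\<lambda>i. u i - v i) \<le> (\<Sum>i<d. \<bar>u i - v i\<bar>)" by (rule L2_set_le_sum_abs)
    also have "\<dots> \<le> (\<Sum>i<d. 1 / real N)" by (intro sum_mono close) simp
    finally have "norm_rd d (\<lambda>i. u i - v i) \<le> real d / real N" by simp
    moreover have "v \<in> ?T" unfolding v_def using cu by (rule imageI)
    ultimately show "\<exists>v\<in>?T. norm_rd d (\<lambda>i. u i - v i) \<le> real d / real N" by blast
  qed
qed

definition msum :: "nat \<Rightarrow> (nat \<Rightarrow> real) set \<Rightarrow> (nat \<Rightarrow> real) set \<Rightarrow> (nat \<Rightarrow> real) set" where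
  "msum d A B = {\<lambda>i\<in>{..<d}. x i + y i | x y. x \<in> A \<and> y \<in> B}"

abbreviation origin :: "nat \<Rightarrow> nat \<Rightarrow> real" where
  "origin d \<equiv> (\<lambda>i\<in>{..<d}. 0)"

lemma body_origin: "body d {origin d}"
proof -
  have "(\<lambda>i\<in>{..<d}. u * origin d i + v * origin d i) = origin d" for u v by auto
  then show ?thesis
    unfolding body_def convex_rd_def space_lborel_rd by simp
qed

lemma segs_eq_msum: "L \<subseteq> Rd d \<Longrightarrow> segs d as L = msum d L (segs d as {origin d})"
proof (induction as)
  case Nil
  have "(\<lambda>i\<in>{..<d}. x i + origin d i) = x" if "x \<in> L" for x
    using that Nil by (auto simp: fun_eq_iff PiE_def extensional_def subset_iff)
  then have "msum d L {origin d} = {x | x. x \<in> L}"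
    unfolding msum_def singleton_iff by metis
  then show ?case unfolding foldr.simps id_apply by simp
next
  case (Cons a as)
  have eq: "(\<lambda>i\<in>{..<d}. (\<lambda>i\<in>{..<d}. x i + y i) i + \<mu> * a i) = (\<lambda>i\<in>{..<d}. x i + (\<lambda>i\<in>{..<d}. y i + \<mu> * a i) i)"
    for x y :: "nat \<Rightarrow> real" and \<mu> by auto
  show ?case
    unfolding foldr.simps comp_apply Cons.IH[OF Cons.prems]
  proof (intro equalityI subsetI)
    fix z assume "z \<in> seg d a (msum d L (segs d as {origin d}))"
    then obtain x y \<mu> where *: "x \<in> L" "y \<in> segs d as {origin d}" "\<mu> \<in> {-1..1}"
      "z = (\<lambda>i\<in>{..<d}. (\<lambda>i\<in>{..<d}. x i + y i) i + \<mu> * a i)"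
      by (elim segE) (auto simp: msum_def)
    have "(\<lambda>i\<in>{..<d}. y i + \<mu> * a i) \<in> seg d a (segs d as {origin d})"
      by (rule segI[OF *(2,3)])
    then show "z \<in> msum d L (seg d a (segs d as {origin d}))"
      unfolding *(4) eq msum_def using *(1) by blast
  next
    fix z assume "z \<in> msum d L (seg d a (segs d as {origin d}))"
    then obtain x w where xw: "x \<in> L" "w \<in> seg d a (segs d as {origin d})" "z = (\<lambda>i\<in>{..<d}. x i + w i)"
      unfolding msum_def by blast
    then obtain y \<mu> where *: "y \<in> segs d as {origin d}" "\<mu> \<in> {-1..1}" "w = (\<lambda>i\<in>{..<d}. y i + \<mu> * a i)"
      by (elim segE)
    have "(\<lambda>i\<in>{..<d}. x i + y i) \<in> msum d L (segs d as {origin d})"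
      unfolding msum_def using xw(1) *(1) by blast
    then show "z \<in> seg d a (msum d L (segs d as {origin d}))"
      unfolding xw(3) *(3) eq[symmetric] by (rule segI[OF _ *(2)])
  qed
qed

lemma ip_add_scale: "ip d (\<lambda>i. x i + c * y i) u = ip d x u + c * ip d y u"
  by (simp add: ip_def algebra_simps sum.distrib sum_distrib_left)

lemma zonotope_support_le:
  "z \<in> segs d as {origin d} \<Longrightarrow> ip d z u \<le> (\<Sum>a\<leftarrow>as. \<bar>ip d a u\<bar>)"
proof (induction as arbitrary: z)
  case Nil
  then show ?case by (simp add: ip_def)
next
  case (Cons a as)
  then have "z \<in> seg d a (segs d as {origin d})" by (simp only: foldr.simps comp_apply)
  then obtain y \<mu> where y: "y \<in> segs d as {origin d}" "\<mu> \<in> {-1..1}" "z = (\<lambda>i\<in>{..<d}. y i + \<mu> * a i)"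
    by (elim segE)
  have "\<mu> * ip d a u \<le> \<bar>\<mu>\<bar> * \<bar>ip d a u\<bar>" by (metis abs_ge_self abs_mult)
  also have "\<dots> \<le> \<bar>ip d a u\<bar>" using y(2) by (intro mult_left_le_one_le) auto
  finally show ?case unfolding y(3) ip_restrict ip_add_scale using Cons.IH[OF y(1)] by simp
qed

lemma zonotope_support_attained:
  "\<exists>z\<in>segs d as {origin d}. ip d z u = (\<Sum>a\<leftarrow>as. \<bar>ip d a u\<bar>)"
proof (induction as)
  case Nil
  then show ?case by (simp add: ip_def)
next
  case (Cons a as)
  then obtain y where y: "y \<in> segs d as {origin d}" "ip d y u = (\<Sum>a\<leftarrow>as. \<bar>ip d a u\<bar>)" by blast
  let ?\<mu> = "sgn (ip d a u)"
  have "(\<lambda>i\<in>{..<d}. y i + ?\<mu> * a i) \<in> segs d (a # as) {origin d}"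
    unfolding foldr.simps comp_apply by (rule segI[OF y(1)]) (simp add: sgn_if)
  moreover have "ip d (\<lambda>i\<in>{..<d}. y i + ?\<mu> * a i) u = (\<Sum>a\<leftarrow>a # as. \<bar>ip d a u\<bar>)"
    unfolding ip_restrict ip_add_scale y(2) by (simp add: abs_sgn mult.commute)
  ultimately show ?case by blast
qed

lemma norm_le_of_support:
  assumes "\<And>u. norm_rd d u = 1 \<Longrightarrow> ip d z u \<le> r" "r \<ge> 0"
  shows "norm_rd d z \<le> r"
proof (cases "norm_rd d z = 0")
  case False
  then have pos: "norm_rd d z > 0" by (simp add: order_less_le)
  let ?u = "\<lambda>i. 1 / norm_rd d z * z i"
  have "norm_rd d ?u = 1" unfolding norm_scale using pos by simp
  from assms(1)[OF this] have "ip d ?u z \<le> r" by (simp add: ip_commute)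
  then have "(norm_rd d z)\<^sup>2 / norm_rd d z \<le> r" unfolding ip_scale ip_self by simp
  then show ?thesis using pos by (simp add: power2_eq_square)
qed (use assms(2) in simp)

lemma ball_subset_zonotope:
  assumes "\<And>u. norm_rd d u = 1 \<Longrightarrow> r \<le> (\<Sum>a\<leftarrow>as. \<bar>ip d a u\<bar>)"
  shows "{x \<in> Rd d. norm_rd d x \<le> r} \<subseteq> segs d as {origin d}"
proof (rule ball_subset_body[OF body_segs[OF body_origin]])
  fix u :: "nat \<Rightarrow> real" assume u: "norm_rd d u = 1"
  obtain z where "z \<in> segs d as {origin d}" "ip d z u = (\<Sum>a\<leftarrow>as. \<bar>ip d a u\<bar>)"
    using zonotope_support_attained by blast
  with assms[OF u] show "\<exists>x\<in>segs d as {origin d}. r \<le> ip d x u"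
    by (intro bexI[of _ z]) simp_all
qed

lemma zonotope_subset_ball:
  assumes "\<And>u. norm_rd d u = 1 \<Longrightarrow> (\<Sum>a\<leftarrow>as. \<bar>ip d a u\<bar>) \<le> R" and "R \<ge> 0"
  shows "segs d as {origin d} \<subseteq> {x \<in> Rd d. norm_rd d x \<le> R}"
proof
  fix z assume z: "z \<in> segs d as {origin d}"
  have "norm_rd d z \<le> R"
    by (rule norm_le_of_support[OF _ assms(2)]) (rule order_trans[OF zonotope_support_le[OF z] assms(1)])
  then show "z \<in> {x \<in> Rd d. norm_rd d x \<le> R}"
    using bodyD(1)[OF body_segs[OF body_origin]] z by blast
qed

lemma compact_cube_rd:
  fixes d :: nat
  shows "compact (Pi\<^sub>E {..<d} (\<lambda>_. {a..b :: real}))"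
proof -
  have eq: "Pi\<^sub>E {..<d} (\<lambda>_. {a..b}) = Pi\<^sub>E UNIV (\<lambda>i. if i < d then {a..b} else {undefined :: real})"
    by (auto simp: PiE_def Pi_def extensional_def split: if_splits)
  have "compactin (product_topology (\<lambda>i::nat. euclidean :: real topology) UNIV)
     (Pi\<^sub>E UNIV (\<lambda>i::nat. if i < d then {a..b} else {undefined}))"
    unfolding compactin_PiE by simp
  then show ?thesis unfolding eq euclidean_product_topology by simp
qed

lemma continuous_on_coord_id: "continuous_on S (\<lambda>x :: nat \<Rightarrow> real. x i)"
  by (rule continuous_on_coord) (rule continuous_on_id)

lemma body_ball:
  assumes "r \<ge> 0"
  shows "body d {x \<in> Rd d. norm_rd d x \<le> r}"
  unfolding body_def
proof (intro conjI)
  have "norm_rd d (origin d) = 0" by (simp add: L2_set_def)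
  then show "{x \<in> Rd d. norm_rd d x \<le> r} \<noteq> {}"
    using assms by (intro ex_in_conv[THEN iffD1] exI[of _ "origin d"]) simp
  have sub: "x \<in> Pi\<^sub>E {..<d} (\<lambda>_. {-r..r})" if x: "x \<in> Rd d" "norm_rd d x \<le> r" for x
  proof -
    have "x i \<in> {-r..r}" if "i < d" for i
      using abs_coord_le_norm[OF that, of x] x(2) by (simp add: abs_le_iff minus_le_iff)
    then show ?thesis using x(1) by (simp add: PiE_iff)
  qed
  have "{x \<in> Rd d. norm_rd d x \<le> r} = Pi\<^sub>E {..<d} (\<lambda>_. {-r..r}) \<inter> {x. norm_rd d x \<le> r}"
    using sub PiE_mono[of "{..<d}" "\<lambda>_. {-r..r}" "\<lambda>_. UNIV"] by blast
  moreover have "closed {x. norm_rd d x \<le> r}"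
    by (intro closed_Collect_le continuous_on_norm_rd continuous_on_id continuous_on_const)
  ultimately show "compact {x \<in> Rd d. norm_rd d x \<le> r}"
    using compact_Int_closed[OF compact_cube_rd] by metis
  show "convex_rd d {x \<in> Rd d. norm_rd d x \<le> r}"
    unfolding convex_rd_def space_lborel_rd
  proof (intro conjI ballI allI impI)
    fix x y and u v :: real
    assume x: "x \<in> {x \<in> Rd d. norm_rd d x \<le> r}" and y: "y \<in> {x \<in> Rd d. norm_rd d x \<le> r}"
      and uv: "0 \<le> u" "0 \<le> v" "u + v = 1"
    have "norm_rd d (\<lambda>i. u * x i + v * y i) \<le> u * norm_rd d x + v * norm_rd d y"
      using norm_triangle[where d = d and x = "\<lambda>i. u * x i" and y = "\<lambda>i. v * y i"] uv unfolding norm_scale by simp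
    also have "\<dots> \<le> u * r + v * r"
      using x y uv by (intro add_mono mult_left_mono) auto
    also have "\<dots> = r" using uv(3) by (simp add: distrib_right[symmetric])
    finally show "(\<lambda>i\<in>{..<d}. u * x i + v * y i) \<in> {x \<in> Rd d. norm_rd d x \<le> r}" by simp
  qed blast
qed

lemma unit_ball_eq: "unit_ball_rd d = {x \<in> Rd d. norm_rd d x \<le> 1}"
  by (simp add: unit_ball_rd_def)

lemma body_unit_ball: "body d (unit_ball_rd d)"
  unfolding unit_ball_eq by (rule body_ball) simp

lemma parallel_body_eq_msum:
  assumes "t > 0"
  shows "parallel_body d L t = msum d L {z \<in> Rd d. norm_rd d z \<le> t}"
proof -
  have "msum d L {z \<in> Rd d. norm_rd d z \<le> t} = {\<lambda>i\<in>{..<d}. x i + (\<lambda>i\<in>{..<d}. t * y i) i | x y. x \<in> L \<and> y \<in> unit_ball_rd d}"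
    unfolding scaled_ball_eq[OF assms, symmetric] msum_def by blast
  moreover have "(\<lambda>i\<in>{..<d}. x i + (\<lambda>i\<in>{..<d}. t * y i) i) = (\<lambda>i\<in>{..<d}. x i + t * y i)" for x y :: "nat \<Rightarrow> real" by auto
  ultimately show ?thesis by (simp add: parallel_body_def)
qed

lemma parallel_body_0:
  assumes "L \<subseteq> Rd d"
  shows "parallel_body d L 0 = L"
proof -
  have "(\<lambda>i\<in>{..<d}. x i + 0 * y i) = x" if "x \<in> L" for x y :: "nat \<Rightarrow> real"
    using that assms by (auto simp: fun_eq_iff PiE_def extensional_def subset_iff)
  note eq = this
  obtain y where y: "y \<in> unit_ball_rd d" using bodyD(2)[OF body_unit_ball] by blast
  show ?thesis
  proof (intro equalityI subsetI)
    fix z assume "z \<in> parallel_body d L 0"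
    then obtain x y where "z = (\<lambda>i\<in>{..<d}. x i + 0 * y i)" "x \<in> L" unfolding parallel_body_def by blast
    then show "z \<in> L" using eq by simp
  next
    fix z assume "z \<in> L"
    then show "z \<in> parallel_body d L 0"
      unfolding parallel_body_def using y eq[of z y] by (intro CollectI exI[of _ z] exI[of _ y]) simp
  qed
qed

lemma compact_parallel_body:
  assumes "body d L"
  shows "compact (parallel_body d L t)"
proof -
  have eq: "parallel_body d L t = (\<lambda>p. \<lambda>i\<in>{..<d}. fst p i + t * snd p i) ` (L \<times> unit_ball_rd d)"
    unfolding parallel_body_def image_def 
  proof (intro equalityI subsetI)
    fix z assume "z \<in> {\<lambda>i\<in>{..<d}. x i + t * y i | x y. x \<in> L \<and> y \<in> unit_ball_rd d}"
    then obtain x y where "z = (\<lambda>i\<in>{..<d}. x i + t * y i)" "x \<in> L" "y \<in> unit_ball_rd d" by blast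
    then show "z \<in> {z. \<exists>p\<in>L \<times> unit_ball_rd d. z = (\<lambda>i\<in>{..<d}. fst p i + t * snd p i)}"
      by (intro CollectI bexI[of _ "(x, y)"]) simp_all
  next
    fix z assume "z \<in> {z. \<exists>p\<in>L \<times> unit_ball_rd d. z = (\<lambda>i\<in>{..<d}. fst p i + t * snd p i)}"
    then obtain p where "p \<in> L \<times> unit_ball_rd d" "z = (\<lambda>i\<in>{..<d}. fst p i + t * snd p i)" by blast
    then show "z \<in> {\<lambda>i\<in>{..<d}. x i + t * y i | x y. x \<in> L \<and> y \<in> unit_ball_rd d}"
      by (intro CollectI exI[of _ "fst p"] exI[of _ "snd p"]) (simp add: mem_Times_iff)
  qed
  have "continuous_on (L \<times> unit_ball_rd d) (\<lambda>p. \<lambda>i\<in>{..<d}. fst p i + t * snd p i)"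
    by (intro continuous_on_restrict_coords continuous_intros continuous_on_coord)
  then show ?thesis
    unfolding eq by (rule compact_continuous_image[OF _ compact_Times[OF bodyD(3)[OF assms] bodyD(3)[OF body_unit_ball]]])
qed

lemma parallel_body_sets:
  assumes "body d L"
  shows "parallel_body d L t \<in> sets (lborel_rd d)"
proof (rule compact_sets_rd[OF compact_parallel_body[OF assms]])
  show "parallel_body d L t \<subseteq> Rd d"
  proof
    fix z assume "z \<in> parallel_body d L t"
    then obtain x y :: "nat \<Rightarrow> real" where "z = (\<lambda>i\<in>{..<d}. x i + t * y i)"
      unfolding parallel_body_def by blast
    then show "z \<in> Rd d" by simp
  qed
qed

lemma parallel_body_finite:
  assumes "body d L" "t \<ge> 0"
  shows "emeasure (lborel_rd d) (parallel_body d L t) < \<infinity>"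
proof -
  obtain r where r: "\<And>x. x \<in> L \<Longrightarrow> norm_rd d x \<le> r" using body_norm_bound[OF assms(1)] by blast
  have "parallel_body d L t \<subseteq> {x \<in> Rd d. norm_rd d x \<le> r + t}"
  proof
    fix z assume "z \<in> parallel_body d L t"
    then obtain x y where z: "z = (\<lambda>i\<in>{..<d}. x i + t * y i)" "x \<in> L" "norm_rd d y \<le> 1"
      unfolding parallel_body_def unit_ball_eq by blast
    have "norm_rd d z \<le> norm_rd d x + norm_rd d (\<lambda>i. t * y i)"
      unfolding z(1) L2_set_restrict by (rule norm_triangle)
    also have "\<dots> \<le> r + t * 1"
      unfolding norm_scale using z(3) assms(2) r[OF z(2)] by (intro add_mono mult_mono) auto
    finally show "z \<in> {x \<in> Rd d. norm_rd d x \<le> r + t}" by (simp add: z(1))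
  qed
  then show ?thesis by (rule emeasure_bounded_finite)
qed

lemma msum_mono: "B \<subseteq> B' \<Longrightarrow> msum d L B \<subseteq> msum d L B'"
  unfolding msum_def by blast

lemma parallel_body_le_zvol:
  assumes L: "body d L" and "r > 0"
    and "\<And>u. norm_rd d u = 1 \<Longrightarrow> r \<le> (\<Sum>a\<leftarrow>as. \<bar>ip d a u\<bar>)"
  shows "vol d (parallel_body d L r) \<le> zvol d L as"
  unfolding zvol_def
proof (rule measure_mono_fmeasurable)
  have S: "body d (segs d as L)" by (rule body_segs[OF L])
  show "parallel_body d L r \<subseteq> segs d as L"
    unfolding parallel_body_eq_msum[OF assms(2)] segs_eq_msum[OF bodyD(1)[OF L], of as]
    by (rule msum_mono[OF ball_subset_zonotope[OF assms(3)]])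
  show "segs d as L \<in> fmeasurable (lborel_rd d)"
    by (rule fmeasurableI[OF bodyD(4)[OF S]]) (use emeasure_body_finite[OF S] in simp)
qed (rule parallel_body_sets[OF L])

lemma zvol_le_parallel_body:
  assumes L: "body d L" and "R > 0"
    and "\<And>u. norm_rd d u = 1 \<Longrightarrow> (\<Sum>a\<leftarrow>as. \<bar>ip d a u\<bar>) \<le> R"
  shows "zvol d L as \<le> vol d (parallel_body d L R)"
  unfolding zvol_def
proof (rule measure_mono_fmeasurable)
  have "R \<ge> 0" using assms(2) by simp
  show "segs d as L \<subseteq> parallel_body d L R"
    unfolding parallel_body_eq_msum[OF assms(2)] segs_eq_msum[OF bodyD(1)[OF L], of as]
    by (rule msum_mono[OF zonotope_subset_ball[OF assms(3) \<open>R \<ge> 0\<close>]])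
  show "parallel_body d L R \<in> fmeasurable (lborel_rd d)"
    by (rule fmeasurableI[OF parallel_body_sets[OF L]]) (use parallel_body_finite[OF L, of R] assms(2) in simp)
qed (rule bodyD(4)[OF body_segs[OF L]])

lemma zvol_bound:
  assumes "L \<subseteq> {x \<in> Rd d. norm_rd d x \<le> r}" "r > 0" and "\<And>a. a \<in> set as \<Longrightarrow> norm_rd d a \<le> K"
    and "body d L"
  shows "\<bar>zvol d L as\<bar> \<le> vol d {x \<in> Rd d. norm_rd d x \<le> r + K * length as}"
proof -
  have "segs d as L \<subseteq> {x \<in> Rd d. norm_rd d x \<le> r + K * length as}"
    using assms(3)
  proof (induction as)
    case Nil
    then show ?case using assms(1) by simp
  next
    case (Cons a as)
    show ?case
    proof
      fix z assume "z \<in> segs d (a # as) L"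
      then obtain x \<mu> where z: "x \<in> segs d as L" "\<mu> \<in> {-1..1}" "z = (\<lambda>i\<in>{..<d}. x i + \<mu> * a i)"
        unfolding foldr.simps comp_apply by (elim segE)
      have "norm_rd d z \<le> norm_rd d x + \<bar>\<mu>\<bar> * norm_rd d a"
        unfolding z(3) L2_set_restrict norm_scale[symmetric] by (rule norm_triangle)
      also have "\<dots> \<le> (r + K * length as) + 1 * K"
        using Cons z(1,2) by (intro add_mono mult_mono) auto
      finally show "z \<in> {x \<in> Rd d. norm_rd d x \<le> r + K * length (a # as)}" by (simp add: z(3) algebra_simps)
    qed
  qed
  moreover have "emeasure (lborel_rd d) {x \<in> Rd d. norm_rd d x \<le> r + K * length as} < \<infinity>"
    by (rule emeasure_bounded_finite[OF subset_refl])
  ultimately have "zvol d L as \<le> vol d {x \<in> Rd d. norm_rd d x \<le> r + K * length as}"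
    unfolding zvol_def
    by (intro measure_mono_fmeasurable fmeasurableI ball_rd_sets bodyD(4)[OF body_segs[OF assms(4)]]) simp_all
  then show ?thesis by (simp add: zvol_def)
qed

section \<open>Measurability and random zonotopes\<close>

lemma closed_compact_section:
  fixes S :: "('a::topological_space \<times> 'b::topological_space) set"
  assumes K: "compact K" and S: "closed S"
  shows "closed {y. \<exists>k\<in>K. (k, y) \<in> S}"
proof -
  let ?W = "prod.swap -` (- S)"
  have W: "open ?W"
    by (intro open_vimage) (use S in \<open>auto intro: continuous_on_swap\<close>)
  have "open (- {y. \<exists>k\<in>K. (k, y) \<in> S})"
  proof (subst open_subopen, intro ballI)
    fix y assume y: "y \<in> - {y. \<exists>k\<in>K. (k, y) \<in> S}"
    then have "{y} \<times> K \<subseteq> ?W" by auto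
    from Elementary_Topology.tube_lemma[OF K W this] obtain X where X: "y \<in> X" "open X" "X \<times> K \<subseteq> ?W" by blast
    then show "\<exists>T. open T \<and> y \<in> T \<and> T \<subseteq> - {y. \<exists>k\<in>K. (k, y) \<in> S}"
      by (intro exI[of _ X]) auto
  qed
  then show ?thesis by (simp add: closed_def)
qed

lemma closed_Rd: "closed (Rd d)"
proof -
  have "Rd d = (\<Inter>i\<in>{d..}. {z. z i = undefined})"
    by (auto simp: PiE_def extensional_def)
  moreover have "closed (\<Inter>i\<in>{d..}. {z :: nat \<Rightarrow> real. z i = undefined})"
    by (intro closed_INT ballI closed_Collect_eq continuous_on_coord_id continuous_on_const)
  ultimately show ?thesis by simp
qed

lemma seg_subset_Rd: "seg d a L \<subseteq> Rd d"
  by (simp add: seg_def image_subset_iff split_beta)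

lemma closed_graph_seg:
  fixes L :: "'b::topological_space \<Rightarrow> (nat \<Rightarrow> real) set"
  assumes G: "closed {(z, w). z \<in> L w}" and L: "\<And>w. L w \<subseteq> Rd d" and a: "continuous_on UNIV a"
  shows "closed {(z, w). z \<in> seg d (a w) (L w)}"
proof -
  define g where "g = (\<lambda>q :: real \<times> (nat \<Rightarrow> real) \<times> 'b.
    (\<lambda>i\<in>{..<d}. fst (snd q) i - fst q * a (snd (snd q)) i, snd (snd q)))"
  have a': "continuous_on S (\<lambda>q. a (snd (snd q)))" for S :: "(real \<times> (nat \<Rightarrow> real) \<times> 'b) set"
    by (rule continuous_on_compose2[OF a]) (auto intro!: continuous_intros)
  have z': "continuous_on S (\<lambda>q. fst (snd q) i)" for S :: "(real \<times> (nat \<Rightarrow> real) \<times> 'b) set" and i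
    by (rule continuous_on_coord) (intro continuous_intros)
  have "continuous_on UNIV g"
    unfolding g_def
    by (intro continuous_on_Pair continuous_on_restrict_coords continuous_on_diff continuous_on_mult z'
        continuous_on_coord[OF a'] continuous_on_fst continuous_on_snd continuous_on_id)
  then have "closed (g -` {(z, w). z \<in> L w})"
    by (rule closed_vimage[OF G])
  moreover have "closed ((\<lambda>q :: real \<times> (nat \<Rightarrow> real) \<times> 'b. fst (snd q)) -` Rd d)"
    by (rule closed_vimage[OF closed_Rd]) (intro continuous_intros)
  ultimately have "closed (g -` {(z, w). z \<in> L w} \<inter> (\<lambda>q. fst (snd q)) -` Rd d)"
    by (rule closed_Int)
  from closed_compact_section[OF compact_Icc[of "-1" 1] this]
  have "closed {p. \<exists>\<mu>\<in>{-1..1}. (\<mu>, p) \<in> g -` {(z, w). z \<in> L w} \<inter> (\<lambda>q. fst (snd q)) -` Rd d}" .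
  also have "{p. \<exists>\<mu>\<in>{-1..1}. (\<mu>, p) \<in> g -` {(z, w). z \<in> L w} \<inter> (\<lambda>q. fst (snd q)) -` Rd d} =
      {(z, w). z \<in> seg d (a w) (L w)}"
  proof (intro equalityI subsetI)
    fix p assume "p \<in> {p. \<exists>\<mu>\<in>{-1..1}. (\<mu>, p) \<in> g -` {(z, w). z \<in> L w} \<inter> (\<lambda>q. fst (snd q)) -` Rd d}"
    then obtain \<mu> z w where p: "p = (z, w)" "\<mu> \<in> {-1..1}" "z \<in> Rd d"
      "(\<lambda>i\<in>{..<d}. z i - \<mu> * a w i) \<in> L w"
      by (cases p) (auto simp: g_def)
    from segI[OF p(4,2), where d = d and a = "a w"]
    have "(\<lambda>i\<in>{..<d}. (\<lambda>i\<in>{..<d}. z i - \<mu> * a w i) i + \<mu> * a w i) \<in> seg d (a w) (L w)" .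
    also have "(\<lambda>i\<in>{..<d}. (\<lambda>i\<in>{..<d}. z i - \<mu> * a w i) i + \<mu> * a w i) = z"
      using p(3) by (auto simp: fun_eq_iff PiE_def extensional_def)
    finally show "p \<in> {(z, w). z \<in> seg d (a w) (L w)}" by (simp add: p(1))
  next
    fix p assume "p \<in> {(z, w). z \<in> seg d (a w) (L w)}"
    then obtain z w where p: "p = (z, w)" "z \<in> seg d (a w) (L w)" by (cases p) auto
    then obtain y \<mu> where y: "y \<in> L w" "\<mu> \<in> {-1..1}" "z = (\<lambda>i\<in>{..<d}. y i + \<mu> * a w i)" by (elim segE)
    have "(\<lambda>i\<in>{..<d}. z i - \<mu> * a w i) = y"
      using y(1) L[of w] by (auto simp: y(3) fun_eq_iff PiE_def extensional_def subset_iff)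
    then have "(\<mu>, p) \<in> g -` {(z, w). z \<in> L w} \<inter> (\<lambda>q. fst (snd q)) -` Rd d"
      using y(1) seg_subset_Rd[of d "a w" "L w"] p(2) by (simp add: g_def p(1) subset_iff)
    then show "p \<in> {p. \<exists>\<mu>\<in>{-1..1}. (\<mu>, p) \<in> g -` {(z, w). z \<in> L w} \<inter> (\<lambda>q. fst (snd q)) -` Rd d}"
      using y(2) by blast
  qed
  finally show ?thesis .
qed

lemma closed_graph_segs:
  fixes L :: "'b::topological_space \<Rightarrow> (nat \<Rightarrow> real) set"
  assumes G: "closed {(z, w). z \<in> L w}" and L: "\<And>w. L w \<subseteq> Rd d"
    and A: "\<And>j. j \<in> set js \<Longrightarrow> continuous_on UNIV (\<lambda>w. A w j)"
  shows "closed {(z, w). z \<in> segs d (map (A w) js) (L w)} \<and> (\<forall>w. segs d (map (A w) js) (L w) \<subseteq> Rd d)"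
  using A
proof (induction js)
  case Nil
  then show ?case using G L by simp
next
  case (Cons j js)
  then have IH: "closed {(z, w). z \<in> segs d (map (A w) js) (L w)}" "\<And>w. segs d (map (A w) js) (L w) \<subseteq> Rd d"
    by auto
  show ?case
    unfolding list.map foldr.simps comp_apply
    using closed_graph_seg[OF IH, of "\<lambda>w. A w j"] Cons.prems seg_subset_Rd by simp
qed

lemma measurable_vol_graph:
  fixes L :: "'b::second_countable_topology \<Rightarrow> (nat \<Rightarrow> real) set"
  assumes G: "closed {(z, w). z \<in> L w}" and L: "\<And>w. L w \<subseteq> Rd d" and W [measurable]: "W \<in> N \<rightarrow>\<^sub>M borel"
  shows "(\<lambda>p. vol d (L (W p))) \<in> borel_measurable N"
    and "{q \<in> space (N \<Otimes>\<^sub>M lborel_rd d). snd q \<in> L (W (fst q))} \<in> sets (N \<Otimes>\<^sub>M lborel_rd d)"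
proof -
  let ?g = "\<lambda>q. (snd q, W (fst q))"
  let ?H = "{q \<in> space (N \<Otimes>\<^sub>M lborel_rd d). snd q \<in> L (W (fst q))}"
  have [measurable]: "(\<lambda>q. snd q) \<in> N \<Otimes>\<^sub>M lborel_rd d \<rightarrow>\<^sub>M borel"
    by (rule measurable_compose[OF measurable_snd measurable_incl_rd])
  have "?g \<in> N \<Otimes>\<^sub>M lborel_rd d \<rightarrow>\<^sub>M borel \<Otimes>\<^sub>M borel" by measurable
  from measurable_sets[OF this[unfolded borel_prod] borel_closed[OF G]]
  have "?g -` {(z, w). z \<in> L w} \<inter> space (N \<Otimes>\<^sub>M lborel_rd d) \<in> sets (N \<Otimes>\<^sub>M lborel_rd d)" .
  also have "?g -` {(z, w). z \<in> L w} \<inter> space (N \<Otimes>\<^sub>M lborel_rd d) = ?H" by auto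
  finally show H: "?H \<in> sets (N \<Otimes>\<^sub>M lborel_rd d)" .
  have eq: "emeasure (lborel_rd d) (L (W p)) = emeasure (lborel_rd d) (Pair p -` ?H)" if "p \<in> space N" for p
  proof -
    have "Pair p -` ?H = L (W p)" using that L[of "W p"] by (auto simp: space_pair_measure)
    then show ?thesis by simp
  qed
  have "(\<lambda>p. emeasure (lborel_rd d) (L (W p))) \<in> borel_measurable N"
    using lborel_rd.measurable_emeasure_Pair[OF H] by (subst measurable_cong[OF eq]) auto
  then show "(\<lambda>p. vol d (L (W p))) \<in> borel_measurable N"
    unfolding measure_def by measurable
qed

lemma measurable_family:
  assumes "\<And>j i. j \<in> I \<Longrightarrow> (\<lambda>p. A p j i) \<in> borel_measurable N"
  shows "(\<lambda>p j. if j \<in> I then A p j else (\<lambda>_. 0 :: real)) \<in> N \<rightarrow>\<^sub>M (borel :: (nat \<Rightarrow> nat \<Rightarrow> real) measure)"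
proof (rule measurable_coordinatewise_then_product)
  fix j show "(\<lambda>p. if j \<in> I then A p j else (\<lambda>_. 0 :: real)) \<in> N \<rightarrow>\<^sub>M borel"
    by (rule measurable_coordinatewise_then_product) (use assms in \<open>cases "j \<in> I"; simp\<close>)
qed

lemma continuous_on_family: "continuous_on S (\<lambda>w :: nat \<Rightarrow> nat \<Rightarrow> real. w j)"
  by (rule continuous_on_product_then_coordinatewise) (rule continuous_on_id)

lemma measurable_zvol:
  fixes js :: "nat list"
  assumes L: "body d L" and A: "\<And>j i. j \<in> set js \<Longrightarrow> (\<lambda>p. A p j i) \<in> borel_measurable N"
  shows "(\<lambda>p. zvol d L (map (A p) js)) \<in> borel_measurable N"
proof -
  let ?A = "\<lambda>p j. if j \<in> set js then A p j else (\<lambda>_. 0 :: real)"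
  have "{(z, w :: nat \<Rightarrow> nat \<Rightarrow> real). z \<in> L} = L \<times> UNIV" by auto
  then have "closed {(z, w :: nat \<Rightarrow> nat \<Rightarrow> real). z \<in> L}"
    using compact_imp_closed[OF bodyD(3)[OF L]] by (simp add: closed_Times)
  from closed_graph_segs[OF this, where A = "\<lambda>w. w" and js = js, OF bodyD(1)[OF L] continuous_on_family]
  have "(\<lambda>p. vol d (segs d (map (?A p) js) L)) \<in> borel_measurable N"
    using measurable_vol_graph(1)[of "\<lambda>w. segs d (map w js) L" d "?A" N] measurable_family[of "set js" A N, OF A]
    by blast
  moreover have "map (?A p) js = map (A p) js" for p by simp
  ultimately show ?thesis unfolding zvol_def by simp
qed

definition weights :: "nat \<Rightarrow> (nat \<Rightarrow> real) set" where
  "weights n = {l \<in> Pi\<^sub>E {..<n} (\<lambda>_. {0..1}). (\<Sum>j<n. l j) = 1}"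

definition pts_hull :: "nat \<Rightarrow> nat \<Rightarrow> (nat \<Rightarrow> nat \<Rightarrow> real) \<Rightarrow> (nat \<Rightarrow> real) set" where
  "pts_hull d n x = (\<lambda>l. \<lambda>i\<in>{..<d}. \<Sum>j<n. l j * x j i) ` weights n"

lemma compact_weights: "compact (weights n)"
proof -
  have "closed {l :: nat \<Rightarrow> real. (\<Sum>j<n. l j) = 1}"
    by (intro closed_Collect_eq continuous_intros continuous_on_coord_id)
  moreover have "weights n = (Pi\<^sub>E {..<n} (\<lambda>_. {0..1})) \<inter> {l. (\<Sum>j<n. l j) = 1}" by (auto simp: weights_def)
  ultimately show ?thesis using compact_Int_closed[OF compact_cube_rd] by simp
qed

lemma weights_convex:
  assumes "l \<in> weights n" "m \<in> weights n" "0 \<le> u" "0 \<le> v" "u + v = (1::real)"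
  shows "(\<lambda>j\<in>{..<n}. u * l j + v * m j) \<in> weights n"
proof -
  have "u * l j + v * m j \<in> {0..1}" if "j < n" for j
  proof -
    have "l j \<in> {0..1}" "m j \<in> {0..1}" using assms(1,2) that by (auto simp: weights_def PiE_iff)
    then show ?thesis
      using convexD[OF convex_real_interval(5)[of 0 1], of "l j" "m j" u v] assms(3-5) by simp
  qed
  moreover have "(\<Sum>j<n. u * l j + v * m j) = 1"
    using assms by (simp add: sum.distrib sum_distrib_left[symmetric] weights_def)
  ultimately show ?thesis by (simp add: weights_def)
qed

lemma weights_vertex: "j < n \<Longrightarrow> (\<lambda>i\<in>{..<n}. if i = j then 1 else 0) \<in> weights n"
  by (simp add: weights_def)

lemma body_pts_hull:
  assumes "n > 0"
  shows "body d (pts_hull d n x)"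
  unfolding body_def
proof (intro conjI)
  show "pts_hull d n x \<noteq> {}" using weights_vertex[OF assms] unfolding pts_hull_def by blast
  have "continuous_on (weights n) (\<lambda>l. \<lambda>i\<in>{..<d}. \<Sum>j<n. l j * x j i)"
    by (intro continuous_on_restrict_coords continuous_intros continuous_on_coord_id)
  then show "compact (pts_hull d n x)"
    unfolding pts_hull_def by (rule compact_continuous_image[OF _ compact_weights])
  show "convex_rd d (pts_hull d n x)"
    unfolding convex_rd_def space_lborel_rd
  proof (intro conjI ballI allI impI)
    show "pts_hull d n x \<subseteq> Rd d" by (simp add: pts_hull_def image_subset_iff)
    fix y z and u v :: real assume "y \<in> pts_hull d n x" "z \<in> pts_hull d n x" and uv: "0 \<le> u" "0 \<le> v" "u + v = 1"
    then obtain l m where l: "l \<in> weights n" "y = (\<lambda>i\<in>{..<d}. \<Sum>j<n. l j * x j i)"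
      and m: "m \<in> weights n" "z = (\<lambda>i\<in>{..<d}. \<Sum>j<n. m j * x j i)" unfolding pts_hull_def by blast
    have "(\<lambda>i\<in>{..<d}. u * y i + v * z i) = (\<lambda>i\<in>{..<d}. \<Sum>j<n. (\<lambda>j\<in>{..<n}. u * l j + v * m j) j * x j i)"
      unfolding l(2) m(2) by (auto simp: sum_distrib_left sum.distrib[symmetric] algebra_simps)
    then show "(\<lambda>i\<in>{..<d}. u * y i + v * z i) \<in> pts_hull d n x"
      unfolding pts_hull_def using weights_convex[OF l(1) m(1) uv] by blast
  qed
qed

lemma pts_hull_subset: "pts_hull d n x \<subseteq> Rd d"
  by (simp add: pts_hull_def image_subset_iff)

lemma pts_hull_vertex:
  assumes "j < n"
  shows "restrict (x j) {..<d} \<in> pts_hull d n x"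
proof -
  have "restrict (x j) {..<d} = (\<lambda>i\<in>{..<d}. \<Sum>m<n. (\<lambda>i\<in>{..<n}. if i = j then 1 else 0) m * x m i)"
  proof
    fix i
    have "(\<Sum>m<n. (\<lambda>i\<in>{..<n}. if i = j then 1 else 0) m * x m i) = (\<Sum>m<n. if m = j then x m i else 0)"
      by (intro sum.cong) auto
    also have "\<dots> = x j i" using assms by simp
    finally show "restrict (x j) {..<d} i = (\<lambda>i\<in>{..<d}. \<Sum>m<n. (\<lambda>i\<in>{..<n}. if i = j then 1 else 0) m * x m i) i"
      by (cases "i < d") auto
  qed
  then show ?thesis
    unfolding pts_hull_def
    by (intro image_eqI[where x = "\<lambda>i\<in>{..<n}. if i = j then 1 else 0"] weights_vertex assms)
qed

lemma closed_graph_pts_hull: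
  "closed {(z, w :: (nat \<Rightarrow> nat \<Rightarrow> real) \<times> (nat \<Rightarrow> nat \<Rightarrow> real)). z \<in> pts_hull d n (fst w)}"
proof -
  let ?C = "{q :: (nat \<Rightarrow> real) \<times> (nat \<Rightarrow> real) \<times> (nat \<Rightarrow> nat \<Rightarrow> real) \<times> (nat \<Rightarrow> nat \<Rightarrow> real).
     fst (snd q) = (\<lambda>i\<in>{..<d}. \<Sum>j<n. fst q j * fst (snd (snd q)) j i)}"
  have 1: "continuous_on UNIV (\<lambda>q :: (nat \<Rightarrow> real) \<times> (nat \<Rightarrow> real) \<times> (nat \<Rightarrow> nat \<Rightarrow> real) \<times> (nat \<Rightarrow> nat \<Rightarrow> real). fst q j)" for j
    by (rule continuous_on_coord) (intro continuous_intros)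
  have 2: "continuous_on UNIV (\<lambda>q :: (nat \<Rightarrow> real) \<times> (nat \<Rightarrow> real) \<times> (nat \<Rightarrow> nat \<Rightarrow> real) \<times> (nat \<Rightarrow> nat \<Rightarrow> real). fst (snd (snd q)) j i)" for j i
    by (rule continuous_on_coord, rule continuous_on_product_then_coordinatewise) (intro continuous_intros)
  have "closed ?C"
    by (rule closed_Collect_eq)
       (intro continuous_intros, intro continuous_on_restrict_coords continuous_on_sum continuous_on_mult 1 2)
  from closed_compact_section[OF compact_weights this]
  have "closed {p. \<exists>l\<in>weights n. (l, p) \<in> ?C}" .
  moreover have "{p. \<exists>l\<in>weights n. (l, p) \<in> ?C} = {(z, w). z \<in> pts_hull d n (fst w)}"
    unfolding pts_hull_def by auto
  ultimately show ?thesis by simp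
qed

lemma pts_hull_cong: "(\<And>j i. j < n \<Longrightarrow> i < d \<Longrightarrow> x j i = y j i) \<Longrightarrow> pts_hull d n x = pts_hull d n y"
  unfolding pts_hull_def by (intro image_cong refl restrict_ext sum.cong) auto

lemma measurable_zvol_pts_hull:
  fixes js :: "nat list"
  assumes X: "\<And>j i. j < n \<Longrightarrow> (\<lambda>p. X p j i) \<in> borel_measurable N"
    and A: "\<And>j i. j \<in> set js \<Longrightarrow> (\<lambda>p. A p j i) \<in> borel_measurable N"
  shows "(\<lambda>p. zvol d (pts_hull d n (X p)) (map (A p) js)) \<in> borel_measurable N"
    and "{q \<in> space (N \<Otimes>\<^sub>M lborel_rd d). snd q \<in> pts_hull d n (X (fst q))} \<in> sets (N \<Otimes>\<^sub>M lborel_rd d)"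
proof -
  let ?A = "\<lambda>p j. if j \<in> set js then A p j else (\<lambda>_. 0 :: real)"
  let ?X = "\<lambda>p j. if j \<in> {..<n} then X p j else (\<lambda>_. 0 :: real)"
  have c: "continuous_on UNIV (\<lambda>w :: (nat \<Rightarrow> nat \<Rightarrow> real) \<times> (nat \<Rightarrow> nat \<Rightarrow> real). snd w j)" for j
    by (rule continuous_on_compose2[OF continuous_on_family]) (auto intro: continuous_intros)
  note g = closed_graph_segs[OF closed_graph_pts_hull, where js = js and A = "\<lambda>w. snd w", OF pts_hull_subset c]
  have "(\<lambda>p. (?X p, ?A p)) \<in> N \<rightarrow>\<^sub>M borel \<Otimes>\<^sub>M borel"
    by (intro measurable_Pair measurable_family) (use X A in auto)
  note W = this[unfolded borel_prod]
  have eA: "map (?A p) js = map (A p) js" for p by simp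
  have eX: "pts_hull d n (?X p) = pts_hull d n (X p)" for p
    by (rule pts_hull_cong) simp
  have "(\<lambda>p. vol d (segs d (map (snd (?X p, ?A p)) js) (pts_hull d n (fst (?X p, ?A p))))) \<in> borel_measurable N"
    using g by (intro measurable_vol_graph(1)[where L = "\<lambda>w. segs d (map (snd w) js) (pts_hull d n (fst w))", OF _ _ W]) auto
  then show "(\<lambda>p. zvol d (pts_hull d n (X p)) (map (A p) js)) \<in> borel_measurable N"
    unfolding zvol_def fst_conv snd_conv eA eX .
  show "{q \<in> space (N \<Otimes>\<^sub>M lborel_rd d). snd q \<in> pts_hull d n (X (fst q))} \<in> sets (N \<Otimes>\<^sub>M lborel_rd d)"
    using measurable_vol_graph(2)[of "\<lambda>w. pts_hull d n (fst w)", OF closed_graph_pts_hull pts_hull_subset W]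
    unfolding fst_conv eX .
qed

lemma mixed_diff_integral:
  assumes "\<And>is. set is \<subseteq> I \<Longrightarrow> integrable M (\<lambda>w. F w is)" and "set js \<subseteq> I"
  shows "integrable M (\<lambda>w. mixed_diff (F w) js) \<and> (\<integral>w. mixed_diff (F w) js \<partial>M) = mixed_diff (\<lambda>is. \<integral>w. F w is \<partial>M) js"
  using assms
proof (induction js arbitrary: F)
  case (Cons j js)
  from Cons.IH[of F] Cons.prems
  have 1: "integrable M (\<lambda>w. mixed_diff (F w) js)" "(\<integral>w. mixed_diff (F w) js \<partial>M) = mixed_diff (\<lambda>is. \<integral>w. F w is \<partial>M) js" by auto
  from Cons.IH[of "\<lambda>w is. F w (j # is)"] Cons.prems
  have 2: "integrable M (\<lambda>w. mixed_diff (\<lambda>is. F w (j # is)) js)"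
    "(\<integral>w. mixed_diff (\<lambda>is. F w (j # is)) js \<partial>M) = mixed_diff (\<lambda>is. \<integral>w. F w (j # is) \<partial>M) js" by auto
  show ?case using 1 2 by simp
qed simp

lemma mixed_diff_measurable:
  assumes "\<And>is. set is \<subseteq> I \<Longrightarrow> (\<lambda>w. F w is) \<in> borel_measurable M" and "set js \<subseteq> I"
  shows "(\<lambda>w. mixed_diff (F w) js) \<in> borel_measurable M"
  using assms
proof (induction js arbitrary: F)
  case (Cons j js)
  from Cons.IH[of F] Cons.prems have "(\<lambda>w. mixed_diff (F w) js) \<in> borel_measurable M" by auto
  moreover from Cons.IH[of "\<lambda>w is. F w (j # is)"] Cons.prems
  have "(\<lambda>w. mixed_diff (\<lambda>is. F w (j # is)) js) \<in> borel_measurable M" by auto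
  ultimately show ?case by simp
qed simp

definition unif_ball :: "nat \<Rightarrow> (nat \<Rightarrow> real) measure" where
  "unif_ball d = uniform_measure (lborel_rd d) (unit_ball_rd d)"

abbreviation unif_balls :: "nat \<Rightarrow> nat \<Rightarrow> (nat \<Rightarrow> nat \<Rightarrow> real) measure" where
  "unif_balls d m \<equiv> \<Pi>\<^sub>M j\<in>{..<m}. unif_ball d"

lemma sets_unif_ball [measurable_cong, simp]: "sets (unif_ball d) = sets (lborel_rd d)"
  by (simp add: unif_ball_def)

lemma space_unif_ball [simp]: "space (unif_ball d) = Rd d"
  by (simp add: unif_ball_def)

lemma prob_space_unif_ball: "prob_space (unif_ball d)"
  unfolding unif_ball_def using emeasure_unit_ball_pos[of d] emeasure_unit_ball_finite[of d]
  by (intro prob_space_uniform_measure) auto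

interpretation unif_ball: prob_space "unif_ball d" for d
  by (rule prob_space_unif_ball)

interpretation unif_balls: prob_space "unif_balls d m" for d m
  by (rule prob_space_PiM) (rule prob_space_unif_ball)

lemma AE_unif_ball: "AE a in unif_ball d. norm_rd d a \<le> 1"
  unfolding unif_ball_def
  by (subst AE_uniform_measure) (use emeasure_unit_ball_pos[of d] emeasure_unit_ball_finite[of d] in \<open>auto simp: unit_ball_rd_def\<close>)

lemma AE_unif_balls: "AE a in unif_balls d m. \<forall>j<m. norm_rd d (a j) \<le> 1"
proof -
  have "AE a in unif_balls d m. norm_rd d (a j) \<le> 1" if "j < m" for j
    by (rule AE_PiM_component[OF prob_space_unif_ball]) (use that AE_unif_ball in auto)
  then have "AE a in unif_balls d m. \<forall>j\<in>{..<m}. norm_rd d (a j) \<le> 1"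
    by (intro AE_finite_allI) auto
  then show ?thesis by eventually_elim simp
qed

lemma measurable_PiM_coord:
  assumes "j \<in> I" "\<And>j. j \<in> I \<Longrightarrow> sets (M j) = sets (lborel_rd d)"
  shows "(\<lambda>a. a j i) \<in> borel_measurable (PiM I M)"
proof -
  have "(\<lambda>a. a j) \<in> PiM I M \<rightarrow>\<^sub>M M j" using assms(1) by (rule measurable_component_singleton)
  then have "(\<lambda>a. a j) \<in> PiM I M \<rightarrow>\<^sub>M lborel_rd d"
    using assms(2)[OF assms(1)] by (simp cong: measurable_cong_sets)
  then show ?thesis by (rule measurable_coord_compose)
qed

lemma integrable_zvol:
  assumes L: "body d L" and js: "set js \<subseteq> {..<m}"
  shows "integrable (unif_balls d m) (\<lambda>a. zvol d L (map a js))"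
proof -
  obtain r where r: "r > 0" "\<And>x. x \<in> L \<Longrightarrow> norm_rd d x \<le> r" using body_norm_bound[OF L] by blast
  have sub: "L \<subseteq> {x \<in> Rd d. norm_rd d x \<le> r}" using r(2) bodyD(1)[OF L] by blast
  show ?thesis
  proof (rule unif_balls.integrable_const_bound)
    show "AE a in unif_balls d m. norm (zvol d L (map a js)) \<le> vol d {x \<in> Rd d. norm_rd d x \<le> r + length js}"
      using AE_unif_balls[of m d]
    proof eventually_elim
      case (elim a)
      then have "\<And>b. b \<in> set (map a js) \<Longrightarrow> norm_rd d b \<le> 1" using js by auto
      from zvol_bound[of L d r "map a js" 1, OF sub r(1) this L] show ?case by simp
    qed
    show "(\<lambda>a. zvol d L (map a js)) \<in> borel_measurable (unif_balls d m)"
      by (rule measurable_zvol[OF L]) (rule measurable_PiM_coord[of _ _ _ d], use js in auto)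
  qed
qed

definition zmean :: "nat \<Rightarrow> nat \<Rightarrow> (nat \<Rightarrow> real) set \<Rightarrow> real" where
  "zmean d j L = (\<integral>a. mixed_diff (zvol d L) (map a [0..<j]) \<partial>unif_balls d j)"

lemma integral_mixed_diff_zvol:
  assumes L: "body d L" and js: "set js \<subseteq> {..<m}"
  shows "integrable (unif_balls d m) (\<lambda>a. mixed_diff (zvol d L) (map a js))"
  using mixed_diff_integral[of "{..<m}" "unif_balls d m" "\<lambda>a is. zvol d L (map a is)" js] integrable_zvol[OF L] js
  unfolding mixed_diff_map by blast

lemma integral_mixed_diff_zvol_distinct:
  assumes L: "body d L" and js: "set js \<subseteq> {..<m}" "distinct js"
  shows "(\<integral>a. mixed_diff (zvol d L) (map a js) \<partial>unif_balls d m) = zmean d (length js) L"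
proof -
  let ?l = "length js"
  let ?t = "\<lambda>a. \<lambda>n\<in>{..<?l}. a (js ! n)"
  have nth: "js ! n < m" if "n < ?l" for n using js(1) nth_mem[OF that] by auto
  have "distr (unif_balls d m) (unif_balls d ?l) ?t = unif_balls d ?l"
    by (rule distr_PiM_reindex[of "{..<m}" "\<lambda>_. unif_ball d" "(!) js" "{..<?l}", OF prob_space_unif_ball])
       (use js nth in \<open>auto simp: inj_on_def nth_eq_iff_index_eq\<close>)
  then have "zmean d ?l L = (\<integral>a. mixed_diff (zvol d L) (map a [0..<?l]) \<partial>distr (unif_balls d m) (unif_balls d ?l) ?t)"
    by (simp add: zmean_def)
  also have "\<dots> = (\<integral>a. mixed_diff (zvol d L) (map (?t a) [0..<?l]) \<partial>unif_balls d m)"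
  proof (rule integral_distr)
    show "?t \<in> unif_balls d m \<rightarrow>\<^sub>M unif_balls d ?l"
      by (intro measurable_restrict measurable_component_singleton) (use nth in auto)
    show "(\<lambda>a. mixed_diff (zvol d L) (map a [0..<?l])) \<in> borel_measurable (unif_balls d ?l)"
      by (intro borel_measurable_integrable integral_mixed_diff_zvol[OF L]) auto
  qed
  also have "\<dots> = (\<integral>a. mixed_diff (zvol d L) (map a js) \<partial>unif_balls d m)"
  proof -
    have e: "map (?t a) [0..<?l] = map a js" for a by (intro nth_equalityI) auto
    show ?thesis unfolding e ..
  qed
  finally show ?thesis ..
qed

lemma sum_list_subseqs_length:
  "(\<Sum>ys\<leftarrow>List.subseqs xs. h (length ys)) = (\<Sum>j\<le>length xs. real (length xs choose j) * h j)"
proof (induction xs arbitrary: h)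
  case (Cons x xs)
  let ?n = "length xs"
  have "(\<Sum>ys\<leftarrow>List.subseqs (x # xs). h (length ys)) =
      (\<Sum>j\<le>?n. real (?n choose j) * h (Suc j)) + (\<Sum>j\<le>?n. real (?n choose j) * h j)"
    using Cons.IH[of "\<lambda>j. h (Suc j)"] Cons.IH[of h] by (simp add: Let_def comp_def)
  also have "(\<Sum>j\<le>?n. real (?n choose j) * h j) = (\<Sum>j\<le>Suc ?n. real (?n choose j) * h j)" by simp
  also have "\<dots> = h 0 + (\<Sum>j\<le>?n. real (?n choose Suc j) * h (Suc j))"
    by (subst sum.atMost_Suc_shift) simp
  also have "(\<Sum>j\<le>?n. real (?n choose j) * h (Suc j)) + (h 0 + (\<Sum>j\<le>?n. real (?n choose Suc j) * h (Suc j)))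
     = h 0 + (\<Sum>j\<le>?n. real (Suc ?n choose Suc j) * h (Suc j))"
    by (simp add: sum.distrib[symmetric] distrib_right)
  also have "\<dots> = (\<Sum>j\<le>Suc ?n. real (Suc ?n choose j) * h j)"
    by (subst sum.atMost_Suc_shift) simp
  finally show ?case by simp
qed simp

lemma integral_sum_list:
  fixes f :: "'b \<Rightarrow> 'a \<Rightarrow> real"
  assumes "\<And>x. x \<in> set xs \<Longrightarrow> integrable M (f x)"
  shows "(\<integral>w. (\<Sum>x\<leftarrow>xs. f x w) \<partial>M) = (\<Sum>x\<leftarrow>xs. \<integral>w. f x w \<partial>M) \<and> integrable M (\<lambda>w. \<Sum>x\<leftarrow>xs. f x w)"
  using assms by (induction xs) auto

lemma expected_zonotope_volume:
  assumes L: "body d L" and s: "s \<ge> 0"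
  shows "(\<integral>a. zvol d L (map (\<lambda>j i. s * a j i) [0..<m]) \<partial>unif_balls d m) =
     (\<Sum>j\<le>d. real (m choose j) * (s ^ j * zmean d j L))"
proof -
  have sub: "set js \<subseteq> {..<m}" "distinct js" if "js \<in> set (List.subseqs [0..<m])" for js
  proof -
    have "set js \<in> set ` set (List.subseqs [0..<m])" using that by blast
    then show "set js \<subseteq> {..<m}" unfolding subseqs_powset by auto
    show "distinct js" using subseqs_distinctD[OF that] by simp
  qed
  have pt: "zvol d L (map (\<lambda>j i. s * a j i) [0..<m]) =
      (\<Sum>js\<leftarrow>List.subseqs [0..<m]. s ^ length js * mixed_diff (zvol d L) (map a js))" for a
  proof -
    have "mixed_diff (\<lambda>js. zvol d L (map (\<lambda>j i. s * a j i) js)) js = s ^ length js * mixed_diff (zvol d L) (map a js)" for js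
      using mixed_diff_zvol_scale[OF L s, of "map a js"] by (simp add: comp_def mixed_diff_map[of _ "\<lambda>j i. s * a j i", symmetric])
    then show ?thesis
      by (subst sum_mixed_diff_subseqs[of "\<lambda>js. zvol d L (map (\<lambda>j i. s * a j i) js)"])
         (intro arg_cong[where f = sum_list] map_cong refl)
  qed
  have "(\<integral>a. zvol d L (map (\<lambda>j i. s * a j i) [0..<m]) \<partial>unif_balls d m) =
      (\<Sum>js\<leftarrow>List.subseqs [0..<m]. \<integral>a. s ^ length js * mixed_diff (zvol d L) (map a js) \<partial>unif_balls d m)"
    unfolding pt
    by (rule integral_sum_list[THEN conjunct1]) (use integral_mixed_diff_zvol[OF L sub(1)] in simp)
  also have "\<dots> = (\<Sum>js\<leftarrow>List.subseqs [0..<m]. s ^ length js * zmean d (length js) L)"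
    by (intro arg_cong[where f = sum_list] map_cong refl) (simp add: integral_mixed_diff_zvol_distinct[OF L sub])
  also have "\<dots> = (\<Sum>j\<le>m. real (m choose j) * (s ^ j * zmean d j L))"
    using sum_list_subseqs_length[of "\<lambda>j. s ^ j * zmean d j L" "[0..<m]"] by simp
  also have "\<dots> = (\<Sum>j\<le>max m d. real (m choose j) * (s ^ j * zmean d j L))"
    by (rule sum.mono_neutral_left) auto
  also have "\<dots> = (\<Sum>j\<le>d. real (m choose j) * (s ^ j * zmean d j L))"
  proof (rule sum.mono_neutral_right)
    have "zmean d j L = 0" if "j > d" for j
      unfolding zmean_def using mixed_diff_zvol_eq_0[OF L, of "map a [0..<j]" for a] that by simp
    then show "\<forall>j\<in>{..max m d} - {..d}. real (m choose j) * (s ^ j * zmean d j L) = 0" by simp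
  qed auto
  finally show ?thesis .
qed

section \<open>The Steiner formula\<close>

lemma distr_density_hrefl:
  assumes u: "norm_rd d u = 1" and f [measurable]: "f \<in> borel_measurable (lborel_rd d)"
    and inv: "\<And>x. x \<in> Rd d \<Longrightarrow> f (hrefl d u x) = f x"
  shows "distr (density (lborel_rd d) f) (lborel_rd d) (hrefl d u) = density (lborel_rd d) f"
proof (rule measure_eqI)
  fix A assume "A \<in> sets (distr (density (lborel_rd d) f) (lborel_rd d) (hrefl d u))"
  then have A [measurable]: "A \<in> sets (lborel_rd d)" by simp
  have "hrefl d u -` A \<inter> Rd d \<in> sets (lborel_rd d)"
    using measurable_sets[OF measurable_hrefl A] by simp
  then have "emeasure (distr (density (lborel_rd d) f) (lborel_rd d) (hrefl d u)) A =
      (\<integral>\<^sup>+x. f x * indicator (hrefl d u -` A \<inter> Rd d) x \<partial>lborel_rd d)"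
    by (simp add: emeasure_distr emeasure_density)
  also have "\<dots> = (\<integral>\<^sup>+x. f (hrefl d u x) * indicator A (hrefl d u x) \<partial>lborel_rd d)"
    by (intro nn_integral_cong) (simp add: inv indicator_def)
  also have "\<dots> = (\<integral>\<^sup>+x. f x * indicator A x \<partial>distr (lborel_rd d) (lborel_rd d) (hrefl d u))"
    by (subst nn_integral_distr) simp_all
  also have "\<dots> = emeasure (density (lborel_rd d) f) A"
    unfolding distr_hrefl[OF u] by (simp add: emeasure_density)
  finally show "emeasure (distr (density (lborel_rd d) f) (lborel_rd d) (hrefl d u)) A =
    emeasure (density (lborel_rd d) f) A" .
qed simp

lemma hrefl_mem_ball:
  assumes "norm_rd d u = 1" "x \<in> Rd d"
  shows "hrefl d u x \<in> unit_ball_rd d \<longleftrightarrow> x \<in> unit_ball_rd d"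
  using assms(2) by (simp add: unit_ball_rd_def ip_hrefl(5)[OF assms(1)])

lemma distr_hrefl_unif_ball:
  assumes u: "norm_rd d u = 1"
  shows "distr (unif_ball d) (lborel_rd d) (hrefl d u) = unif_ball d"
  unfolding unif_ball_def uniform_measure_def
  by (rule distr_density_hrefl[OF u]) (simp_all add: indicator_def hrefl_mem_ball[OF u])

text \<open>By rotation invariance the last coordinate may replace the inner product of \<open>a\<close> with any unit
  vector \<open>u\<close>, so this is the mean support function of the random segment \<open>[-a, a]\<close> at \<open>u\<close>.\<close>

definition mean_supp :: "nat \<Rightarrow> real" where
  "mean_supp d = (\<integral>a. \<bar>a (d - 1)\<bar> \<partial>unif_ball d)"

lemma measurable_ip [measurable]: "(\<lambda>a. ip d a u) \<in> borel_measurable (lborel_rd m)"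
  unfolding ip_def by measurable

lemma ip_hrefl_axis:
  assumes w: "norm_rd (Suc i) w = 1" and 0: "\<And>j. j < i \<Longrightarrow> hrefl (Suc i) w u j = 0"
  shows "ip (Suc i) (hrefl (Suc i) w a) u = a i * hrefl (Suc i) w u i"
  unfolding ip_hrefl(1)[OF w] by (simp add: ip_def 0)

lemma integral_abs_ip:
  assumes u: "norm_rd d u = 1" and d: "d \<ge> 1"
  shows "(\<integral>a. \<bar>ip d a u\<bar> \<partial>unif_ball d) = mean_supp d"
proof -
  obtain i where i: "d = Suc i" using d by (cases d) auto
  obtain w where w: "norm_rd d w = 1" "\<And>j. j < i \<Longrightarrow> hrefl d w u j = 0" "\<bar>hrefl d w u i\<bar> = 1"
    using ex_hrefl_to_axis[of i u] u unfolding i by metis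
  have "(\<integral>a. \<bar>ip d a u\<bar> \<partial>unif_ball d) = (\<integral>a. \<bar>ip d a u\<bar> \<partial>distr (unif_ball d) (lborel_rd d) (hrefl d w))"
    unfolding distr_hrefl_unif_ball[OF w(1)] ..
  also have "\<dots> = (\<integral>a. \<bar>ip d (hrefl d w a) u\<bar> \<partial>unif_ball d)"
    by (rule integral_distr) measurable
  also have "\<dots> = (\<integral>a. \<bar>a i\<bar> \<partial>unif_ball d)"
    using ip_hrefl_axis[where i = i and w = w and u = u] w unfolding i by (simp add: abs_mult)
  finally show ?thesis by (simp add: mean_supp_def i)
qed

lemma null_hyperplane: "emeasure (lborel_rd (Suc i)) {x \<in> Rd (Suc i). x i = 0} = 0"
proof -
  have "{x \<in> space (lborel_rd (Suc i)). x i = 0} \<in> sets (lborel_rd (Suc i))" by measurable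
  then have S: "{x \<in> Rd (Suc i). x i = 0} \<in> sets (lborel_rd (Suc i))" by simp
  have "emeasure lborel {y. x(i := y) \<in> {x \<in> Rd (Suc i). x i = 0}} = 0" if "x \<in> Rd i" for x
  proof -
    have "{y. x(i := y) \<in> {x \<in> Rd (Suc i). x i = 0}} = {0}"
      using that by (auto simp: PiE_iff extensional_def)
    then show ?thesis by simp
  qed
  then show ?thesis
    unfolding emeasure_slices(1)[OF S] by (subst nn_integral_cong[where v = "\<lambda>_. 0"]) simp_all
qed

lemma integrable_coord_unif_ball: "i < d \<Longrightarrow> integrable (unif_ball d) (\<lambda>a. \<bar>a i\<bar>)"
proof (rule unif_ball.integrable_const_bound[where B = 1])
  assume i: "i < d"
  show "AE a in unif_ball d. norm \<bar>a i\<bar> \<le> 1"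
    using AE_unif_ball[of d]
  proof eventually_elim
    case (elim a)
    then show ?case using abs_coord_le_norm[OF i, of a] by simp
  qed
qed measurable

lemma mean_supp_pos:
  assumes "d \<ge> 1"
  shows "mean_supp d > 0"
proof -
  obtain i where i: "d = Suc i" using assms by (cases d) auto
  let ?B = "unit_ball_rd d"
  have "mean_supp d \<noteq> 0"
  proof
    assume "mean_supp d = 0"
    then have "(\<integral>a. \<bar>a i\<bar> \<partial>unif_ball d) = 0" by (simp add: mean_supp_def i)
    then have "AE a in unif_ball d. \<bar>a i\<bar> = 0"
      by (subst (asm) integral_nonneg_eq_0_iff_AE) (use integrable_coord_unif_ball[of i d] i in auto)
    then have "AE a in lborel_rd d. a \<in> ?B \<longrightarrow> a i = 0"
      unfolding unif_ball_def
      by (subst (asm) AE_uniform_measure)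
         (use emeasure_unit_ball_pos[of d] emeasure_unit_ball_finite[of d] in auto)
    moreover have "AE a in lborel_rd d. a i \<noteq> 0"
    proof (rule AE_I)
      show "{a \<in> space (lborel_rd d). \<not> a i \<noteq> 0} \<subseteq> {x \<in> Rd d. x i = 0}" by auto
      show "emeasure (lborel_rd d) {x \<in> Rd d. x i = 0} = 0" unfolding i by (rule null_hyperplane)
      have "{x \<in> space (lborel_rd d). x i = 0} \<in> sets (lborel_rd d)" by measurable
      then show "{x \<in> Rd d. x i = 0} \<in> sets (lborel_rd d)" by simp
    qed
    ultimately have "AE a in lborel_rd d. a \<notin> ?B" by eventually_elim auto
    then have "emeasure (lborel_rd d) ?B = 0"
      by (subst (asm) AE_iff_measurable[OF unit_ball_sets]) (auto simp: unit_ball_rd_def)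
    then show False using emeasure_unit_ball_pos[of d] by simp
  qed
  moreover have "mean_supp d \<ge> 0" unfolding mean_supp_def by (rule Bochner_Integration.integral_nonneg) simp
  ultimately show ?thesis by simp
qed

lemma indep_vars_PiM_coords:
  assumes "\<And>i. i \<in> I \<Longrightarrow> prob_space (M i)" "I \<noteq> {}"
  shows "prob_space.indep_vars (PiM I M) M (\<lambda>i x. x i) I"
proof -
  interpret P: prob_space "PiM I M" by (rule prob_space_PiM[OF assms(1)])
  have "distr (PiM I M) (PiM I M) (\<lambda>x. \<lambda>i\<in>I. x i) = distr (PiM I M) (PiM I M) (\<lambda>x. x)"
    by (intro distr_cong) (auto simp: space_PiM)
  also have "\<dots> = PiM I M" by (rule distr_id2) simp
  also have "PiM I M = (\<Pi>\<^sub>M i\<in>I. distr (PiM I M) (M i) (\<lambda>x. x i))"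
    by (rule PiM_cong[OF refl]) (rule distr_PiM_component[symmetric, OF assms(1)])
  finally show ?thesis
    using assms(2) by (subst P.indep_vars_iff_distr_eq_PiM') simp_all
qed

lemma hoeffding_unif_balls:
  assumes v: "norm_rd d v = 1" and d: "d \<ge> 1" and m: "m \<ge> 1" and \<epsilon>: "\<epsilon> \<ge> 0"
  shows "unif_balls.prob m d {a \<in> space (unif_balls d m). \<bar>(\<Sum>j<m. \<bar>ip d (a j) v\<bar>) / m - mean_supp d\<bar> \<ge> \<epsilon>}
     \<le> 2 * exp (- 2 * m * \<epsilon>\<^sup>2)"
proof -
  let ?X = "\<lambda>j a. \<bar>ip d (a j) v\<bar>"
  have "0 \<in> {..<m}" using m by simp
  then have ne: "{..<m} \<noteq> {}" by blast
  have f [measurable]: "(\<lambda>x. \<bar>ip d x v\<bar>) \<in> borel_measurable (unif_ball d)" by measurable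
  have comp: "distr (unif_balls d m) (unif_ball d) (\<lambda>a. a j) = unif_ball d" if "j < m" for j
    by (rule distr_PiM_component[OF prob_space_unif_ball]) (use that in simp)
  have meas [measurable]: "(\<lambda>a. a j) \<in> unif_balls d m \<rightarrow>\<^sub>M unif_ball d" if "j < m" for j
    using that by simp
  have X: "?X j \<in> borel_measurable (unif_balls d m)" if "j < m" for j
    using measurable_compose[OF meas[OF that] f] .
  have dX: "distr (unif_balls d m) borel (?X j) = distr (unif_ball d) borel (\<lambda>x. \<bar>ip d x v\<bar>)" if "j < m" for j
    using distr_distr[OF f meas[OF that]] comp[OF that] by (simp add: comp_def)
  interpret iid_interval_bounded_random_variables "unif_balls d m" "{..<m}" ?X "?X 0" 0 1
  proof unfold_locales
    have "unif_balls.indep_vars m d (\<lambda>_. unif_ball d) (\<lambda>j a. a j) {..<m}"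
      by (intro indep_vars_PiM_coords prob_space_unif_ball ne)
    then have "unif_balls.indep_vars m d (\<lambda>_. borel) (\<lambda>j. (\<lambda>x. \<bar>ip d x v\<bar>) \<circ> (\<lambda>a. a j)) {..<m}"
      by (rule unif_balls.indep_vars_compose) simp
    then show "unif_balls.indep_vars m d (\<lambda>_. borel) ?X {..<m}" by (simp add: comp_def)
    show "AE a in unif_balls d m. ?X 0 a \<in> {0..1}"
      using AE_unif_balls[of m d]
    proof eventually_elim
      case (elim a)
      then have "norm_rd d (a 0) \<le> 1" using m by auto
      then show ?case using ip_le_norm[of d "a 0" v] v by simp
    qed
  qed (use m X dX in auto)
  have m0: "0 < m" using m by simp
  have "(\<integral>a. ?X 0 a \<partial>unif_balls d m) = (\<integral>x. \<bar>ip d x v\<bar> \<partial>distr (unif_balls d m) (unif_ball d) (\<lambda>a. a 0))"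
    unfolding integral_distr[OF meas[OF m0] f] ..
  also have "\<dots> = mean_supp d" using comp[of 0] m integral_abs_ip[OF v d] by simp
  finally have e: "(\<integral>a. ?X 0 a \<partial>unif_balls d m) = mean_supp d" .
  interpret Hoeffding_ineq_iid "unif_balls d m" "{..<m}" ?X "?X 0" 0 1 "\<integral>a. ?X 0 a \<partial>unif_balls d m"
    by unfold_locales simp
  show ?thesis
    using Hoeffding_ineq_abs_ge'[OF \<epsilon> zero_less_one ne] unfolding e by simp
qed

lemma uniform_lln:
  assumes d: "d \<ge> 1" and \<eta>: "\<eta> > 0"
  obtains G where "\<And>m. G m \<in> sets (unif_balls d m)"
    "(\<lambda>m. unif_balls.prob m d (G m)) \<longlonglongrightarrow> 1"
    "\<And>m a u. a \<in> G m \<Longrightarrow> m \<ge> 1 \<Longrightarrow> norm_rd d u = 1 \<Longrightarrow> \<bar>(\<Sum>j<m. \<bar>ip d (a j) u\<bar>) / m - mean_supp d\<bar> \<le> \<eta>"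
proof -
  define N where "N = nat \<lceil>2 * real d / \<eta>\<rceil> + 1"
  have N: "N \<ge> 1" by (simp add: N_def)
  have "2 * real d / \<eta> \<le> real N" unfolding N_def by linarith
  then have dN: "real d / real N \<le> \<eta> / 2" using \<eta> N by (simp add: field_simps)
  obtain T where T: "finite T" "\<And>v. v \<in> T \<Longrightarrow> norm_rd d v = 1"
    "\<And>u. norm_rd d u = 1 \<Longrightarrow> \<exists>v\<in>T. norm_rd d (\<lambda>i. u i - v i) \<le> real d / real N"
    using sphere_net[OF N, of d] by metis
  define h where "h m a u = (\<Sum>j<m. \<bar>ip d (a j) u\<bar>) / real m" for m a u
  define Bad where "Bad m v = {a \<in> space (unif_balls d m). \<bar>h m a v - mean_supp d\<bar> \<ge> \<eta> / 2}" for m v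
  define Ba where "Ba m = {a \<in> space (unif_balls d m). \<forall>j\<in>{..<m}. norm_rd d (a j) \<le> 1}" for m
  define G where "G m = Ba m - (\<Union>v\<in>T. Bad m v)" for m
  have c: "(\<lambda>a. a j i) \<in> borel_measurable (unif_balls d m)" if "j < m" for i j m
    by (rule measurable_PiM_coord[of _ _ _ d]) (use that in auto)
  have BadS: "Bad m v \<in> sets (unif_balls d m)" for m v
  proof -
    have "(\<lambda>a. h m a v) \<in> borel_measurable (unif_balls d m)"
      unfolding h_def ip_def using c by (intro borel_measurable_divide borel_measurable_sum borel_measurable_abs borel_measurable_times) auto
    then show ?thesis unfolding Bad_def by measurable
  qed
  have BaS: "Ba m \<in> sets (unif_balls d m)" for m
  proof -
    have "(\<lambda>a. norm_rd d (a j)) \<in> borel_measurable (unif_balls d m)" if "j < m" for j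
      unfolding L2_set_def using c[OF that] by measurable
    then show ?thesis unfolding Ba_def by (intro sets.sets_Collect_finite_All) auto
  qed
  have G: "G m \<in> sets (unif_balls d m)" for m
    unfolding G_def using BadS BaS T(1) by auto
  have Ba1: "unif_balls.prob m d (Ba m) = 1" for m
  proof (subst unif_balls.prob_eq_1[OF BaS])
    show "AE a in unif_balls d m. a \<in> Ba m"
      using AE_unif_balls[of m d] AE_space by eventually_elim (simp add: Ba_def)
  qed
  have lower: "1 - card T * (2 * exp (- 2 * real m * (\<eta> / 2)\<^sup>2)) \<le> unif_balls.prob m d (G m)" if m: "m \<ge> 1" for m
  proof -
    have "unif_balls.prob m d (\<Union>v\<in>T. Bad m v) \<le> (\<Sum>v\<in>T. unif_balls.prob m d (Bad m v))"
      by (rule unif_balls.finite_measure_subadditive_finite) (use T(1) BadS in auto)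
    also have "\<dots> \<le> (\<Sum>v\<in>T. 2 * exp (- 2 * real m * (\<eta> / 2)\<^sup>2))"
      unfolding Bad_def h_def by (intro sum_mono hoeffding_unif_balls T(2) d m) (use \<eta> in auto)
    finally have 1: "unif_balls.prob m d (\<Union>v\<in>T. Bad m v) \<le> card T * (2 * exp (- 2 * real m * (\<eta> / 2)\<^sup>2))" by simp
    have "unif_balls.prob m d (Ba m) - unif_balls.prob m d (\<Union>v\<in>T. Bad m v) \<le> unif_balls.prob m d (G m)"
    proof -
      have "unif_balls.prob m d (Ba m) \<le> unif_balls.prob m d (G m \<union> (\<Union>v\<in>T. Bad m v))"
      proof (rule unif_balls.finite_measure_mono)
        show "Ba m \<subseteq> G m \<union> (\<Union>v\<in>T. Bad m v)" by (auto simp: G_def)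
      qed (intro sets.Un G sets.finite_UN T(1) BadS)
      also have "\<dots> \<le> unif_balls.prob m d (G m) + unif_balls.prob m d (\<Union>v\<in>T. Bad m v)"
        by (intro measure_Un_le G sets.finite_UN T(1) BadS)
      finally show ?thesis by simp
    qed
    then show ?thesis using 1 Ba1[of m] by simp
  qed
  have lim: "(\<lambda>m. 1 - card T * (2 * exp (- 2 * real m * (\<eta> / 2)\<^sup>2))) \<longlonglongrightarrow> 1"
  proof -
    have "(\<lambda>m. exp (- (2 * (\<eta> / 2)\<^sup>2)) ^ m) \<longlonglongrightarrow> 0"
      by (rule LIMSEQ_power_zero) (use \<eta> in simp)
    then have "(\<lambda>m. exp (- 2 * real m * (\<eta> / 2)\<^sup>2)) \<longlonglongrightarrow> 0"
      by (simp add: exp_of_nat_mult[symmetric] mult_ac)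
    from tendsto_diff[OF tendsto_const tendsto_mult[OF tendsto_const tendsto_mult[OF tendsto_const this]], of 1 "real (card T)" 2]
    show ?thesis by simp
  qed
  have "(\<lambda>m. unif_balls.prob m d (G m)) \<longlonglongrightarrow> 1"
  proof (rule real_tendsto_sandwich[OF _ _ lim tendsto_const])
    show "\<forall>\<^sub>F m in sequentially. 1 - card T * (2 * exp (- 2 * real m * (\<eta> / 2)\<^sup>2)) \<le> unif_balls.prob m d (G m)"
      using eventually_ge_at_top[of 1] by eventually_elim (rule lower)
  qed simp
  moreover have "\<bar>h m a u - mean_supp d\<bar> \<le> \<eta>" if a: "a \<in> G m" and m: "m \<ge> 1" and u: "norm_rd d u = 1" for m a u
  proof -
    obtain v where v: "v \<in> T" "norm_rd d (\<lambda>i. u i - v i) \<le> \<eta> / 2"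
      using T(3)[OF u] order_trans[OF _ dN] by blast
    have "\<bar>h m a u - h m a v\<bar> = \<bar>\<Sum>j<m. \<bar>ip d (a j) u\<bar> - \<bar>ip d (a j) v\<bar>\<bar> / m"
      unfolding h_def by (simp add: sum_subtractf diff_divide_distrib[symmetric])
    also have "\<dots> \<le> (\<Sum>j<m. \<eta> / 2) / m"
    proof (intro divide_right_mono order_trans[OF sum_abs] sum_mono)
      fix j assume j: "j \<in> {..<m}"
      have "\<bar>\<bar>ip d (a j) u\<bar> - \<bar>ip d (a j) v\<bar>\<bar> \<le> \<bar>ip d (a j) u - ip d (a j) v\<bar>" by simp
      also have "\<dots> = \<bar>ip d (\<lambda>i. u i - v i) (a j)\<bar>" unfolding ip_diff by (simp add: ip_commute)
      also have "\<dots> \<le> norm_rd d (\<lambda>i. u i - v i) * norm_rd d (a j)" by (rule ip_le_norm)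
      also have "\<dots> \<le> \<eta> / 2 * 1"
        using a j v(2) \<eta> by (intro mult_mono) (auto simp: G_def Ba_def)
      finally show "\<bar>\<bar>ip d (a j) u\<bar> - \<bar>ip d (a j) v\<bar>\<bar> \<le> \<eta> / 2" by simp
    qed simp
    also have "\<dots> = \<eta> / 2" using m by simp
    finally have "\<bar>h m a u - h m a v\<bar> \<le> \<eta> / 2" .
    moreover have "\<bar>h m a v - mean_supp d\<bar> < \<eta> / 2"
      using a v(1) by (auto simp: G_def Bad_def Ba_def not_le)
    ultimately show ?thesis by linarith
  qed
  ultimately show ?thesis using that[of G] G unfolding h_def by blast
qed

lemma binomial_ratio_limit: "(\<lambda>m. real (m choose j) / real m ^ j) \<longlonglongrightarrow> 1 / fact j"
proof (induction j)
  case 0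
  then show ?case by simp
next
  case (Suc j)
  have "(\<lambda>m. real (m choose j) / real m ^ j * ((1 - real j * (1 / real m)) / real (Suc j))) \<longlonglongrightarrow> 1 / fact j * ((1 - real j * 0) / real (Suc j))"
    by (intro tendsto_intros Suc lim_1_over_n) simp
  moreover have "eventually (\<lambda>m. real (m choose j) / real m ^ j * ((1 - real j * (1 / real m)) / real (Suc j)) = real (m choose Suc j) / real m ^ Suc j) sequentially"
    using eventually_gt_at_top[of j]
  proof eventually_elim
    case (elim m)
    then have "Suc j * (m choose Suc j) = (m - j) * (m choose j)"
      by (simp only: binomial_absorption binomial_absorb_comp)
    then have "real (Suc j) * real (m choose Suc j) = real (m - j) * real (m choose j)"
      by (metis of_nat_mult)
    then have "real (m choose Suc j) = real (m - j) * real (m choose j) / real (Suc j)"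
      by (simp add: field_simps)
    moreover have "1 - real j * (1 / real m) = real (m - j) / real m"
      using elim by (simp add: of_nat_diff diff_divide_distrib)
    ultimately show ?case by (simp only:) (simp add: mult_ac)
  qed
  ultimately have "(\<lambda>m. real (m choose Suc j) / real m ^ Suc j) \<longlonglongrightarrow> 1 / fact j * ((1 - real j * 0) / real (Suc j))"
    by (rule Lim_transform_eventually)
  then show ?case by (simp add: field_simps)
qed

lemma steiner_sandwich:
  assumes L: "body d L" and d: "d \<ge> 1" and t: "t > 0" and \<eta>: "0 < \<eta>" "\<eta> < 1"
  defines "S \<equiv> \<Sum>j\<le>d. t ^ j * (zmean d j L / (mean_supp d ^ j * fact j))"
  shows "vol d (parallel_body d L (t * (1 - \<eta>))) \<le> S" and "S \<le> vol d (parallel_body d L (t * (1 + \<eta>)))"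
proof -
  let ?c = "mean_supp d"
  have c: "?c > 0" by (rule mean_supp_pos[OF d])
  define s where "s m = t / (?c * real m)" for m :: nat
  define f where "f m a = zvol d L (map (\<lambda>j i. s m * a j i) [0..<m])" for m a
  define E where "E m = (\<integral>a. f m a \<partial>unif_balls d m)" for m
  have s: "s m \<ge> 0" for m using t c by (simp add: s_def)
  have E: "E \<longlonglongrightarrow> S"
  proof -
    have Em: "E m = (\<Sum>j\<le>d. (real (m choose j) / real m ^ j) * ((t / ?c) ^ j * zmean d j L))" for m
      unfolding E_def f_def expected_zonotope_volume[OF L s]
      by (intro sum.cong refl) (simp add: s_def power_divide power_mult_distrib)
    have "(\<lambda>m. \<Sum>j\<le>d. (real (m choose j) / real m ^ j) * ((t / ?c) ^ j * zmean d j L)) \<longlonglongrightarrow>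
       (\<Sum>j\<le>d. 1 / fact j * ((t / ?c) ^ j * zmean d j L))"
      by (intro tendsto_intros binomial_ratio_limit)
    moreover have "(\<Sum>j\<le>d. 1 / fact j * ((t / ?c) ^ j * zmean d j L)) = S"
      unfolding S_def by (intro sum.cong refl) (simp add: power_divide)
    ultimately show ?thesis unfolding Em[abs_def, symmetric] by simp
  qed
  have "\<eta> * ?c > 0" using \<eta> c by simp
  then obtain G where G: "\<And>m. G m \<in> sets (unif_balls d m)"
    "(\<lambda>m. unif_balls.prob m d (G m)) \<longlonglongrightarrow> 1"
    "\<And>m a u. a \<in> G m \<Longrightarrow> m \<ge> 1 \<Longrightarrow> norm_rd d u = 1 \<Longrightarrow> \<bar>(\<Sum>j<m. \<bar>ip d (a j) u\<bar>) / m - ?c\<bar> \<le> \<eta> * ?c"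
    using uniform_lln[OF d] by blast
  let ?W = "\<lambda>t. vol d (parallel_body d L t)"
  have supp: "(\<Sum>b\<leftarrow>map (\<lambda>j i. s m * a j i) [0..<m]. \<bar>ip d b u\<bar>) = t / ?c * ((\<Sum>j<m. \<bar>ip d (a j) u\<bar>) / m)" for m a u
  proof -
    have "(\<Sum>b\<leftarrow>map (\<lambda>j i. s m * a j i) [0..<m]. \<bar>ip d b u\<bar>) = (\<Sum>j<m. \<bar>ip d (\<lambda>i. s m * a j i) u\<bar>)"
      by (simp add: comp_def interv_sum_list_conv_sum_set_nat atLeast0LessThan)
    also have "\<dots> = (\<Sum>j<m. s m * \<bar>ip d (a j) u\<bar>)"
      unfolding ip_scale abs_mult using s by simp
    also have "\<dots> = t / ?c * ((\<Sum>j<m. \<bar>ip d (a j) u\<bar>) / m)"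
      unfolding sum_distrib_left[symmetric] by (simp add: s_def)
    finally show ?thesis .
  qed
  have f_le: "AE a in unif_balls d m. f m a \<le> ?W (t / ?c)" for m
    using AE_unif_balls[of m d]
  proof eventually_elim
    case (elim a)
    show ?case
      unfolding f_def
    proof (rule zvol_le_parallel_body[OF L])
      fix u :: "nat \<Rightarrow> real" assume u: "norm_rd d u = 1"
      have "(\<Sum>j<m. \<bar>ip d (a j) u\<bar>) \<le> (\<Sum>j<m. 1)"
      proof (rule sum_mono)
        fix j assume "j \<in> {..<m}"
        then have "norm_rd d (a j) \<le> 1" using elim by simp
        then show "\<bar>ip d (a j) u\<bar> \<le> 1" using ip_le_norm[of d "a j" u] unfolding u by simp
      qed
      then have "(\<Sum>j<m. \<bar>ip d (a j) u\<bar>) / m \<le> 1" by (cases "m = 0") (simp_all add: divide_le_eq_1)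
      then have "t / ?c * ((\<Sum>j<m. \<bar>ip d (a j) u\<bar>) / m) \<le> t / ?c * 1"
        by (rule mult_left_mono) (use t c in simp)
      then show "(\<Sum>b\<leftarrow>map (\<lambda>j i. s m * a j i) [0..<m]. \<bar>ip d b u\<bar>) \<le> t / ?c"
        unfolding supp by simp
    qed (use t c in simp)
  qed
  have f_int: "integrable (unif_balls d m) (f m)" for m
  proof -
    show ?thesis
    proof (rule unif_balls.integrable_const_bound)
      show "f m \<in> borel_measurable (unif_balls d m)"
        unfolding f_def
        by (rule measurable_zvol[OF L], intro borel_measurable_times borel_measurable_const measurable_PiM_coord[of _ _ _ d]) auto
      show "AE a in unif_balls d m. norm (f m a) \<le> ?W (t / ?c)"
        using f_le[of m] by eventually_elim (simp add: f_def zvol_def)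
    qed
  qed
  have good: "?W (t * (1 - \<eta>)) \<le> f m a" "f m a \<le> ?W (t * (1 + \<eta>))" if a: "a \<in> G m" and m: "m \<ge> 1" for m a
  proof -
    have bnd: "t * (1 - \<eta>) \<le> (\<Sum>b\<leftarrow>map (\<lambda>j i. s m * a j i) [0..<m]. \<bar>ip d b u\<bar>)"
      "(\<Sum>b\<leftarrow>map (\<lambda>j i. s m * a j i) [0..<m]. \<bar>ip d b u\<bar>) \<le> t * (1 + \<eta>)" if u: "norm_rd d u = 1" for u
    proof -
      let ?h = "(\<Sum>j<m. \<bar>ip d (a j) u\<bar>) / m"
      have h: "?c * (1 - \<eta>) \<le> ?h" "?h \<le> ?c * (1 + \<eta>)" using G(3)[OF a m u] by (auto simp: algebra_simps abs_le_iff)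
      have "t / ?c * (?c * (1 - \<eta>)) \<le> t / ?c * ?h" by (rule mult_left_mono[OF h(1)]) (use t c in simp)
      then show "t * (1 - \<eta>) \<le> (\<Sum>b\<leftarrow>map (\<lambda>j i. s m * a j i) [0..<m]. \<bar>ip d b u\<bar>)" unfolding supp using c by simp
      have "t / ?c * ?h \<le> t / ?c * (?c * (1 + \<eta>))" by (rule mult_left_mono[OF h(2)]) (use t c in simp)
      then show "(\<Sum>b\<leftarrow>map (\<lambda>j i. s m * a j i) [0..<m]. \<bar>ip d b u\<bar>) \<le> t * (1 + \<eta>)" unfolding supp using c by simp
    qed
    show "?W (t * (1 - \<eta>)) \<le> f m a"
      unfolding f_def by (rule parallel_body_le_zvol[OF L _ bnd(1)]) (use t \<eta> in simp)
    show "f m a \<le> ?W (t * (1 + \<eta>))"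
      unfolding f_def by (rule zvol_le_parallel_body[OF L _ bnd(2)]) (use t \<eta> in simp)
  qed
  have ind: "integrable (unif_balls d m) (indicator (G m) :: _ \<Rightarrow> real)" for m
    using G(1) by (simp add: unif_balls.emeasure_eq_measure)
  have lower: "?W (t * (1 - \<eta>)) * unif_balls.prob m d (G m) \<le> E m" if m: "m \<ge> 1" for m
  proof -
    have "?W (t * (1 - \<eta>)) * unif_balls.prob m d (G m) = (\<integral>a. ?W (t * (1 - \<eta>)) * indicator (G m) a \<partial>unif_balls d m)"
      using G(1) by simp
    also have "\<dots> \<le> E m"
      unfolding E_def
      by (rule integral_mono) (use ind f_int good(1)[OF _ m] in \<open>auto simp: f_def zvol_def split: split_indicator\<close>)
    finally show ?thesis .
  qed
  have upper: "E m \<le> ?W (t * (1 + \<eta>)) + ?W (t / ?c) * (1 - unif_balls.prob m d (G m))" if m: "m \<ge> 1" for m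
  proof -
    have "E m \<le> (\<integral>a. ?W (t * (1 + \<eta>)) + ?W (t / ?c) * (1 - indicator (G m) a) \<partial>unif_balls d m)"
      unfolding E_def
    proof (rule integral_mono_AE)
      show "AE a in unif_balls d m. f m a \<le> ?W (t * (1 + \<eta>)) + ?W (t / ?c) * (1 - indicator (G m) a)"
        using f_le[of m]
      proof eventually_elim
        case (elim a)
        then show ?case using good(2)[OF _ m, of a]
          by (cases "a \<in> G m") (auto intro: add_increasing)
      qed
    qed (use f_int ind in auto)
    also have "\<dots> = ?W (t * (1 + \<eta>)) + ?W (t / ?c) * (1 - unif_balls.prob m d (G m))"
      using ind G(1) by (simp add: unif_balls.prob_space)
    finally show ?thesis .
  qed
  have "(\<lambda>m. ?W (t * (1 - \<eta>)) * unif_balls.prob m d (G m)) \<longlonglongrightarrow> ?W (t * (1 - \<eta>)) * 1"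
    by (intro tendsto_intros G(2))
  from LIMSEQ_le[OF this E] lower show "?W (t * (1 - \<eta>)) \<le> S" by auto
  have "(\<lambda>m. ?W (t * (1 + \<eta>)) + ?W (t / ?c) * (1 - unif_balls.prob m d (G m))) \<longlonglongrightarrow> ?W (t * (1 + \<eta>)) + ?W (t / ?c) * (1 - 1)"
    by (intro tendsto_intros G(2))
  from LIMSEQ_le[OF E this] upper show "S \<le> ?W (t * (1 + \<eta>))" by auto
qed

theorem steiner_formula:
  assumes L: "body d L" and d: "d \<ge> 1" and t: "t \<ge> 0"
  shows "vol d (parallel_body d L t) = (\<Sum>j\<le>d. t ^ j * (zmean d j L / (mean_supp d ^ j * fact j)))"
proof (cases "t = 0")
  case True
  have "zmean d 0 L = vol d L"
    using unif_balls.prob_space[of 0 d] by (simp add: zmean_def zvol_def)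
  have z: "(\<Sum>j\<le>d. 0 ^ j * f j) = f 0" for f :: "nat \<Rightarrow> real"
  proof -
    have "(\<Sum>j\<le>d. 0 ^ j * f j) = (\<Sum>j\<le>d. if j = 0 then f j else 0)"
      by (intro sum.cong) auto
    then show ?thesis by simp
  qed
  show ?thesis
    unfolding True parallel_body_0[OF bodyD(1)[OF L]] z \<open>zmean d 0 L = vol d L\<close> by simp
next
  case False
  then have t: "t > 0" using t by simp
  define S where "S t = (\<Sum>j\<le>d. t ^ j * (zmean d j L / (mean_supp d ^ j * fact j)))" for t
  have S_cont: "isCont S t" unfolding S_def by (intro continuous_intros)
  define \<eta> where "\<eta> n = 1 / (real n + 2)" for n :: nat
  have \<eta>: "0 < \<eta> n" "\<eta> n < 1" for n by (simp_all add: \<eta>_def)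
  have \<eta>0: "\<eta> \<longlonglongrightarrow> 0" unfolding \<eta>_def by real_asymp
  have "(\<lambda>n. t / (1 - \<eta> n)) \<longlonglongrightarrow> t / (1 - 0)" by (intro tendsto_intros \<eta>0) simp
  then have "(\<lambda>n. S (t / (1 - \<eta> n))) \<longlonglongrightarrow> S t" using isCont_tendsto_compose[OF S_cont] by simp
  moreover have "vol d (parallel_body d L t) \<le> S (t / (1 - \<eta> n))" for n
    using steiner_sandwich(1)[OF L d, of "t / (1 - \<eta> n)" "\<eta> n"] \<eta>[of n] t by (simp add: S_def)
  ultimately have 1: "vol d (parallel_body d L t) \<le> S t" by (intro LIMSEQ_le_const) auto
  have "(\<lambda>n. t / (1 + \<eta> n)) \<longlonglongrightarrow> t / (1 + 0)" by (intro tendsto_intros \<eta>0) simp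
  then have "(\<lambda>n. S (t / (1 + \<eta> n))) \<longlonglongrightarrow> S t" using isCont_tendsto_compose[OF S_cont] by simp
  moreover have "S (t / (1 + \<eta> n)) \<le> vol d (parallel_body d L t)" for n
    using steiner_sandwich(2)[OF L d, of "t / (1 + \<eta> n)" "\<eta> n"] \<eta>[of n] t by (simp add: S_def add_pos_pos)
  ultimately have "S t \<le> vol d (parallel_body d L t)" by (intro LIMSEQ_le_const2) auto
  with 1 show ?thesis by (simp add: S_def)
qed

lemma polynomial_coeffs_unique:
  fixes a b :: "nat \<Rightarrow> real"
  assumes "\<And>t. t \<ge> 0 \<Longrightarrow> (\<Sum>j\<le>d. t ^ j * a j) = (\<Sum>j\<le>d. t ^ j * b j)" and "j \<le> d"
  shows "a j = b j"
proof (rule ccontr)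
  assume "a j \<noteq> b j"
  then have "finite {t. (\<Sum>i\<le>d. (a i - b i) * t ^ i) = 0}"
    using assms(2) by (subst polyfun_finite_roots) auto
  moreover have "{0..} \<subseteq> {t. (\<Sum>i\<le>d. (a i - b i) * t ^ i) = 0}"
    using assms(1) by (auto simp: algebra_simps sum_subtractf)
  ultimately have "finite {0::real..}" by (rule finite_subset[rotated])
  then show False by (simp add: infinite_Ici)
qed

lemma sum_reverse_atMost: "(\<Sum>j\<le>d. f j) = (\<Sum>j\<le>d. f (d - j :: nat))"
  by (rule sum.reindex_bij_witness[of _ "\<lambda>j. d - j" "\<lambda>j. d - j"]) auto

theorem intrinsic_volume_eq:
  assumes L: "body d L" and d: "d \<ge> 1" and k: "k \<le> d"
  shows "intrinsic_volume d k L =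
    zmean d (d - k) L / (mean_supp d ^ (d - k) * fact (d - k) * unit_ball_vol (real (d - k)))"
proof -
  define V where "V k = (if k \<le> d then zmean d (d - k) L / (mean_supp d ^ (d - k) * fact (d - k) * unit_ball_vol (real (d - k))) else 0)" for k
  let ?P = "\<lambda>V. (\<forall>j>d. V j = 0) \<and> (\<forall>t\<ge>0. vol d (parallel_body d L t) =
           (\<Sum>j\<le>d. t ^ (d - j) * unit_ball_vol (real (d - j)) * V j))"
  have rev: "(\<Sum>j\<le>d. t ^ (d - j) * unit_ball_vol (real (d - j)) * V j) =
      (\<Sum>j\<le>d. t ^ j * (unit_ball_vol (real j) * V (d - j)))" for V and t :: real
    by (subst sum_reverse_atMost) (simp add: mult_ac)
  have "?P V"
  proof (intro conjI allI impI)
    fix t :: real assume t: "t \<ge> 0"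
    show "vol d (parallel_body d L t) = (\<Sum>j\<le>d. t ^ (d - j) * unit_ball_vol (real (d - j)) * V j)"
      unfolding rev steiner_formula[OF L d t]
    proof (intro sum.cong refl)
      fix j assume "j \<in> {..d}"
      moreover have "unit_ball_vol (real j) \<noteq> 0" using unit_ball_vol_pos[of "real j"] by linarith
      ultimately show "t ^ j * (zmean d j L / (mean_supp d ^ j * fact j)) = t ^ j * (unit_ball_vol (real j) * V (d - j))"
        by (simp add: V_def)
    qed
  qed (simp add: V_def)
  moreover have "V' = V" if V': "?P V'" for V'
  proof
    have eq: "(\<Sum>j\<le>d. t ^ j * (unit_ball_vol (real j) * V' (d - j))) =
        (\<Sum>j\<le>d. t ^ j * (unit_ball_vol (real j) * V (d - j)))" if "t \<ge> 0" for t
    proof -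
      have "vol d (parallel_body d L t) = (\<Sum>j\<le>d. t ^ (d - j) * unit_ball_vol (real (d - j)) * V' j)"
        using V' that by blast
      moreover have "vol d (parallel_body d L t) = (\<Sum>j\<le>d. t ^ (d - j) * unit_ball_vol (real (d - j)) * V j)"
        using \<open>?P V\<close> that by blast
      ultimately show ?thesis unfolding rev by simp
    qed
    fix j
    show "V' j = V j"
    proof (cases "j \<le> d")
      case True
      have "unit_ball_vol (real (d - j)) * V' (d - (d - j)) = unit_ball_vol (real (d - j)) * V (d - (d - j))"
        by (rule polynomial_coeffs_unique[where d = d and a = "\<lambda>j. unit_ball_vol (real j) * V' (d - j)"
              and b = "\<lambda>j. unit_ball_vol (real j) * V (d - j)"])
           (use eq in simp_all)
      moreover have "unit_ball_vol (real (d - j)) \<noteq> 0"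
        using unit_ball_vol_pos[of "real (d - j)"] by linarith
      ultimately show ?thesis using True by (simp only: mult_cancel_left diff_diff_cancel) simp
    qed (use V' in \<open>simp add: V_def\<close>)
  qed
  ultimately have "(THE V. ?P V) = V" by (rule the_equality)
  then show ?thesis unfolding intrinsic_volume_def using k by (simp add: V_def)
qed

lemma parallel_body_ball:
  assumes t: "t \<ge> 0"
  shows "parallel_body d (unit_ball_rd d) t = {x \<in> Rd d. norm_rd d x \<le> 1 + t}"
proof (intro equalityI subsetI)
  fix z assume "z \<in> parallel_body d (unit_ball_rd d) t"
  then obtain x y where z: "z = (\<lambda>i\<in>{..<d}. x i + t * y i)" "norm_rd d x \<le> 1" "norm_rd d y \<le> 1"
    unfolding parallel_body_def unit_ball_eq by blast
  have "norm_rd d z \<le> norm_rd d x + norm_rd d (\<lambda>i. t * y i)"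
    unfolding z(1) L2_set_restrict by (rule norm_triangle)
  also have "\<dots> \<le> 1 + t * 1"
    unfolding norm_scale using z t by (intro add_mono mult_mono) auto
  finally show "z \<in> {x \<in> Rd d. norm_rd d x \<le> 1 + t}" by (simp add: z(1))
next
  fix z assume z: "z \<in> {x \<in> Rd d. norm_rd d x \<le> 1 + t}"
  define y where "y = (\<lambda>i\<in>{..<d}. 1 / (1 + t) * z i)"
  have "norm_rd d y \<le> 1" unfolding y_def L2_set_restrict norm_scale using z t by simp
  then have y: "y \<in> unit_ball_rd d" by (simp add: unit_ball_rd_def y_def)
  have "z i = y i + t * y i" if "i < d" for i
  proof -
    have "y i + t * y i = (1 + t) * y i" by (simp add: algebra_simps)
    also have "\<dots> = z i" using that t by (simp add: y_def)
    finally show ?thesis ..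
  qed
  then have "z = (\<lambda>i\<in>{..<d}. y i + t * y i)"
    using z by (auto simp: fun_eq_iff PiE_def extensional_def)
  then show "z \<in> parallel_body d (unit_ball_rd d) t" unfolding parallel_body_def using y by blast
qed

lemma zmean_ball_nonzero:
  assumes d: "d \<ge> 1" and j: "j \<le> d"
  shows "zmean d j (unit_ball_rd d) \<noteq> 0"
proof -
  let ?\<kappa> = "vol d (unit_ball_rd d)"
  have "(\<Sum>j\<le>d. t ^ j * (zmean d j (unit_ball_rd d) / (mean_supp d ^ j * fact j))) =
      (\<Sum>j\<le>d. t ^ j * (real (d choose j) * ?\<kappa>))" if "t \<ge> 0" for t
  proof -
    have "(\<Sum>j\<le>d. t ^ j * (zmean d j (unit_ball_rd d) / (mean_supp d ^ j * fact j))) = (1 + t) ^ d * ?\<kappa>"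
      unfolding steiner_formula[OF body_unit_ball d that, symmetric] parallel_body_ball[OF that]
      by (rule vol_ball_rd) (use that in simp)
    also have "(1 + t) ^ d = (\<Sum>j\<le>d. real (d choose j) * t ^ j)"
      using binomial_ring[of t 1 d] by (simp add: add.commute)
    finally show ?thesis by (simp add: sum_distrib_right sum_distrib_left mult_ac)
  qed
  from polynomial_coeffs_unique[OF this j] vol_unit_ball_pos[of d] j show ?thesis
    by (auto simp: mean_supp_pos)
qed

section \<open>Rotation invariant random polytopes\<close>

lemma proj_unit_ball: "proj i (unit_ball_rd (Suc i)) = unit_ball_rd i"
proof (intro equalityI subsetI)
  fix x assume "x \<in> proj i (unit_ball_rd (Suc i))"
  then obtain z where z: "norm_rd (Suc i) z \<le> 1" "x = restrict z {..<i}"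
    by (auto simp: proj_def unit_ball_eq)
  have "norm_rd i z \<le> norm_rd (Suc i) z"
    unfolding L2_set_def by (intro real_sqrt_le_mono sum_mono2) auto
  then show "x \<in> unit_ball_rd i" using z by (simp add: unit_ball_eq)
next
  fix x assume x: "x \<in> unit_ball_rd i"
  let ?z = "x(i := 0)"
  have "norm_rd (Suc i) ?z = norm_rd i x"
  proof -
    have "(\<Sum>j<i. (?z j)\<^sup>2) = (\<Sum>j<i. (x j)\<^sup>2)" by (intro sum.cong) auto
    then show ?thesis by (simp add: L2_set_def)
  qed
  moreover have "?z \<in> Rd (Suc i)" using x by (auto simp: unit_ball_eq PiE_iff extensional_def)
  ultimately have "?z \<in> unit_ball_rd (Suc i)" using x by (simp add: unit_ball_eq)
  moreover have "restrict ?z {..<i} = x"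
    using x by (auto simp: unit_ball_eq PiE_iff extensional_def fun_eq_iff)
  ultimately show "x \<in> proj i (unit_ball_rd (Suc i))" unfolding proj_def by (metis imageI)
qed

lemma hrefl_unit_ball:
  assumes "norm_rd d u = 1"
  shows "hrefl d u ` unit_ball_rd d = unit_ball_rd d"
proof -
  have "unit_ball_rd d \<subseteq> Rd d" by (rule bodyD(1)[OF body_unit_ball])
  from hrefl_vimage_eq_image[OF assms this, symmetric]
  show ?thesis using hrefl_mem_ball[OF assms] \<open>unit_ball_rd d \<subseteq> Rd d\<close> by blast
qed

lemma tower_unit_ball: "tower d (\<lambda>i. zvol i (unit_ball_rd i))"
  unfolding tower_def
proof (intro conjI allI impI)
  fix i bs and e :: "nat \<Rightarrow> real" assume "\<forall>j<i. e j = 0"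
  then show "zvol (Suc i) (unit_ball_rd (Suc i)) (e # bs) - zvol (Suc i) (unit_ball_rd (Suc i)) bs =
      2 * \<bar>e i\<bar> * zvol i (unit_ball_rd i) bs"
    using zvol_axis[OF body_unit_ball, of i e bs] by (simp add: proj_unit_ball)
next
  fix i bs show "zvol i (unit_ball_rd i) (map (\<lambda>a. restrict a {..<i}) bs) = zvol i (unit_ball_rd i) bs"
    unfolding zvol_def segs_restrict ..
next
  fix u bs assume u: "norm_rd d u = 1"
  show "zvol d (unit_ball_rd d) (map (hrefl d u) bs) = zvol d (unit_ball_rd d) bs"
    using zvol_hrefl[OF body_unit_ball u, of bs] unfolding hrefl_unit_ball[OF u] .
qed

lemma proj_pts_hull: "proj i (pts_hull (Suc i) n x) = pts_hull i n x"
  unfolding proj_def pts_hull_def image_image by (intro image_cong) auto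

lemma ip_weights: "ip d (\<lambda>i\<in>{..<d}. \<Sum>j<n. l j * x j i) u = (\<Sum>j<n. l j * ip d (x j) u)"
proof -
  have "(\<Sum>i<d. (\<Sum>j<n. l j * x j i) * u i) = (\<Sum>i<d. \<Sum>j<n. l j * (x j i * u i))"
    by (simp add: sum_distrib_right sum_distrib_left mult_ac)
  also have "\<dots> = (\<Sum>j<n. \<Sum>i<d. l j * (x j i * u i))" by (rule sum.swap)
  finally show ?thesis unfolding ip_restrict by (simp add: ip_def sum_distrib_left)
qed

lemma hrefl_sum: "hrefl d u (\<lambda>i\<in>{..<d}. \<Sum>j<n. l j * x j i) = (\<lambda>i\<in>{..<d}. \<Sum>j<n. l j * hrefl d u (x j) i)"
proof
  fix i
  have "(\<Sum>j<n. l j * x j i) - 2 * (\<Sum>j<n. l j * ip d (x j) u) * u i =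
      (\<Sum>j<n. l j * (x j i - 2 * ip d (x j) u * u i))"
    by (simp add: right_diff_distrib sum_subtractf sum_distrib_left sum_distrib_right mult_ac)
  then show "hrefl d u (\<lambda>i\<in>{..<d}. \<Sum>j<n. l j * x j i) i = (\<lambda>i\<in>{..<d}. \<Sum>j<n. l j * hrefl d u (x j) i) i"
    unfolding hrefl_def ip_weights by simp
qed

lemma hrefl_pts_hull: "hrefl d u ` pts_hull d n x = pts_hull d n (\<lambda>j. hrefl d u (x j))"
  unfolding pts_hull_def image_image hrefl_sum ..

lemma norm_rd_mono: "i \<le> d \<Longrightarrow> norm_rd i x \<le> norm_rd d x"
  unfolding L2_set_def by (intro real_sqrt_le_mono sum_mono2) auto

lemma weights_average_le:
  assumes "l \<in> weights n" "\<And>j. j < n \<Longrightarrow> f j \<le> r"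
  shows "(\<Sum>j<n. l j * f j) \<le> r"
proof -
  have "(\<Sum>j<n. l j * f j) \<le> (\<Sum>j<n. l j * r)"
    using assms by (intro sum_mono mult_left_mono) (auto simp: weights_def PiE_iff)
  also have "\<dots> = r" using assms(1) by (simp add: weights_def sum_distrib_right[symmetric])
  finally show ?thesis .
qed

lemma pts_hull_subset_ball:
  assumes "\<And>j. j < n \<Longrightarrow> norm_rd d (x j) \<le> 1" and "i \<le> d"
  shows "pts_hull i n x \<subseteq> {z \<in> Rd i. norm_rd i z \<le> 1}"
proof
  fix z assume z: "z \<in> pts_hull i n x"
  then obtain l where l: "l \<in> weights n" "z = (\<lambda>c\<in>{..<i}. \<Sum>j<n. l j * x j c)"
    unfolding pts_hull_def by blast
  have "norm_rd i z \<le> 1"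
  proof (rule norm_le_of_support)
    fix u :: "nat \<Rightarrow> real" assume u: "norm_rd i u = 1"
    have "ip i (x j) u \<le> 1" if "j < n" for j
    proof -
      have "norm_rd i (x j) \<le> 1" using norm_rd_mono[OF assms(2), of "x j"] assms(1)[OF that] by simp
      then show ?thesis using ip_le_norm[of i "x j" u] unfolding u by simp
    qed
    then show "ip i z u \<le> 1" unfolding l(2) ip_weights by (rule weights_average_le[OF l(1)])
  qed simp
  then show "z \<in> {z \<in> Rd i. norm_rd i z \<le> 1}" using z pts_hull_subset by blast
qed

locale symmetric_sample =
  fixes d n :: nat and \<nu> :: "(nat \<Rightarrow> real) measure"
  assumes prob: "prob_space \<nu>" and sets_\<nu> [measurable_cong]: "sets \<nu> = sets (lborel_rd d)"
    and ball: "AE x in \<nu>. norm_rd d x \<le> 1"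
    and symm: "\<And>u. norm_rd d u = 1 \<Longrightarrow> distr \<nu> (lborel_rd d) (hrefl d u) = \<nu>"
    and n: "n > 0" and d: "d \<ge> 1"
begin

abbreviation Q :: "(nat \<Rightarrow> nat \<Rightarrow> real) measure" where
  "Q \<equiv> \<Pi>\<^sub>M j\<in>{..<n}. \<nu>"

lemma space_\<nu>: "space \<nu> = Rd d"
  using sets_eq_imp_space_eq[OF sets_\<nu>] by simp

sublocale \<nu>: prob_space \<nu>
  by (rule prob)

sublocale Q: prob_space Q
  by (rule prob_space_PiM) (rule prob)

lemma AE_ball: "AE x in Q. \<forall>j<n. norm_rd d (x j) \<le> 1"
proof -
  have "AE x in Q. norm_rd d (x j) \<le> 1" if "j < n" for j
    by (rule AE_PiM_component[OF prob]) (use that ball in auto)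
  then have "AE x in Q. \<forall>j\<in>{..<n}. norm_rd d (x j) \<le> 1"
    by (intro AE_finite_allI) auto
  then show ?thesis by eventually_elim simp
qed

lemma measurable_sample_coord: "j < n \<Longrightarrow> (\<lambda>x. x j i) \<in> borel_measurable Q"
  by (rule measurable_PiM_coord[of _ _ _ d]) (auto simp: sets_\<nu>)

lemma distr_Q_hrefl:
  assumes u: "norm_rd d u = 1"
  shows "distr Q Q (\<lambda>x. \<lambda>j\<in>{..<n}. hrefl d u (x j)) = Q"
proof -
  have m: "hrefl d u \<in> \<nu> \<rightarrow>\<^sub>M \<nu>"
    using measurable_hrefl[of d u] by (simp cong: measurable_cong_sets add: sets_\<nu>)
  have "distr Q Q (compose {..<n} (hrefl d u)) = (\<Pi>\<^sub>M j\<in>{..<n}. distr \<nu> \<nu> (hrefl d u))"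
    by (rule distr_PiM_finite_prob_space') (use prob m in auto)
  also have "distr \<nu> \<nu> (hrefl d u) = distr \<nu> (lborel_rd d) (hrefl d u)"
    by (rule distr_cong) (auto simp: sets_\<nu>)
  also have "\<dots> = \<nu>" by (rule symm[OF u])
  finally show ?thesis unfolding compose_def .
qed

definition mean_zvol :: "nat \<Rightarrow> (nat \<Rightarrow> real) list \<Rightarrow> real" where
  "mean_zvol i as = (\<integral>x. zvol i (pts_hull i n x) as \<partial>Q)"

lemma measurable_zvol_sample: "(\<lambda>x. zvol i (pts_hull i n x) as) \<in> borel_measurable Q"
proof -
  have "(\<lambda>x. zvol i (pts_hull i n x) (map (\<lambda>j. as ! j) [0..<length as])) \<in> borel_measurable Q"
    by (rule measurable_zvol_pts_hull) (auto intro: measurable_sample_coord)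
  then show ?thesis by (simp add: map_nth)
qed

lemma integrable_zvol_sample:
  assumes "i \<le> d"
  shows "integrable Q (\<lambda>x. zvol i (pts_hull i n x) as)"
proof (rule Q.integrable_const_bound)
  let ?K = "\<Sum>a\<leftarrow>as. norm_rd i a"
  have K: "norm_rd i a \<le> ?K" if "a \<in> set as" for a
    using that by (intro member_le_sum_list) auto
  show "AE x in Q. norm (zvol i (pts_hull i n x) as) \<le> vol i {x \<in> Rd i. norm_rd i x \<le> 1 + ?K * length as}"
    using AE_ball
  proof eventually_elim
    case (elim x)
    then have "pts_hull i n x \<subseteq> {z \<in> Rd i. norm_rd i z \<le> 1}"
      using assms by (intro pts_hull_subset_ball) auto
    from zvol_bound[OF this zero_less_one K body_pts_hull[OF n]] show ?case by simp
  qed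
qed (rule measurable_zvol_sample)

lemma tower_mean_zvol: "tower d mean_zvol"
  unfolding tower_def
proof (intro conjI allI impI)
  fix i bs and e :: "nat \<Rightarrow> real" assume i: "i < d" and e: "\<forall>j<i. e j = 0"
  have "mean_zvol (Suc i) (e # bs) - mean_zvol (Suc i) bs =
      (\<integral>x. zvol (Suc i) (pts_hull (Suc i) n x) (e # bs) - zvol (Suc i) (pts_hull (Suc i) n x) bs \<partial>Q)"
    unfolding mean_zvol_def using i by (intro Bochner_Integration.integral_diff[symmetric] integrable_zvol_sample) auto
  also have "\<dots> = (\<integral>x. 2 * \<bar>e i\<bar> * zvol i (pts_hull i n x) bs \<partial>Q)"
    using zvol_axis[OF body_pts_hull[OF n], of i e] e by (simp add: proj_pts_hull)
  finally show "mean_zvol (Suc i) (e # bs) - mean_zvol (Suc i) bs = 2 * \<bar>e i\<bar> * mean_zvol i bs"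
    by (simp add: mean_zvol_def)
next
  fix i bs show "mean_zvol i (map (\<lambda>a. restrict a {..<i}) bs) = mean_zvol i bs"
    unfolding mean_zvol_def zvol_def segs_restrict ..
next
  fix u bs assume u: "norm_rd d u = 1"
  have eq: "zvol d (pts_hull d n x) (map (hrefl d u) bs) = zvol d (pts_hull d n (\<lambda>j\<in>{..<n}. hrefl d u (x j))) bs"
    if "x \<in> space Q" for x
  proof -
    have "hrefl d u (hrefl d u (x j)) = x j" if "j < n" for j
      unfolding ip_hrefl(4)[OF u] by (rule PiE_restrict) (use \<open>x \<in> space Q\<close> that in \<open>auto simp: space_PiM space_\<nu>\<close>)
    then have "hrefl d u ` pts_hull d n (\<lambda>j. hrefl d u (x j)) = pts_hull d n x"
      unfolding hrefl_pts_hull by (intro pts_hull_cong) simp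
    moreover have "pts_hull d n (\<lambda>j\<in>{..<n}. hrefl d u (x j)) = pts_hull d n (\<lambda>j. hrefl d u (x j))"
      by (intro pts_hull_cong) simp
    ultimately show ?thesis
      using zvol_hrefl[OF body_pts_hull[OF n] u, of "\<lambda>j. hrefl d u (x j)" bs] by simp
  qed
  have m: "(\<lambda>x. \<lambda>j\<in>{..<n}. hrefl d u (x j)) \<in> Q \<rightarrow>\<^sub>M Q"
  proof (intro measurable_restrict)
    fix j assume j: "j \<in> {..<n}"
    have "hrefl d u \<in> \<nu> \<rightarrow>\<^sub>M \<nu>"
      using measurable_hrefl[of d u] by (simp cong: measurable_cong_sets add: sets_\<nu>)
    then show "(\<lambda>x. hrefl d u (x j)) \<in> Q \<rightarrow>\<^sub>M \<nu>"
      by (rule measurable_compose[OF measurable_component_singleton[OF j]])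
  qed
  have "mean_zvol d (map (hrefl d u) bs) = (\<integral>x. zvol d (pts_hull d n (\<lambda>j\<in>{..<n}. hrefl d u (x j))) bs \<partial>Q)"
    unfolding mean_zvol_def by (intro Bochner_Integration.integral_cong refl eq)
  also have "\<dots> = (\<integral>x. zvol d (pts_hull d n x) bs \<partial>distr Q Q (\<lambda>x. \<lambda>j\<in>{..<n}. hrefl d u (x j)))"
    by (rule integral_distr[OF m measurable_zvol_sample, symmetric])
  also have "\<dots> = mean_zvol d bs"
    unfolding distr_Q_hrefl[OF u] mean_zvol_def ..
  finally show "mean_zvol d (map (hrefl d u) bs) = mean_zvol d bs" .
qed

lemma mean_mixed_diff:
  assumes "length as \<le> d"
  shows "vol (d - length as) (unit_ball_rd (d - length as)) * (\<integral>x. mixed_diff (zvol d (pts_hull d n x)) as \<partial>Q)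
    = (\<integral>x. vol (d - length as) (pts_hull (d - length as) n x) \<partial>Q) * mixed_diff (zvol d (unit_ball_rd d)) as"
proof -
  obtain \<gamma> where \<gamma>: "\<And>J. tower d J \<Longrightarrow> mixed_diff (J d) as = \<gamma> * J (d - length as) []"
    using tower_mixed_diff[OF assms] by blast
  have "(\<integral>x. mixed_diff (\<lambda>is. zvol d (pts_hull d n x) (map (\<lambda>a. a) is)) as \<partial>Q) = mixed_diff (mean_zvol d) as"
    using mixed_diff_integral[of UNIV Q "\<lambda>x. zvol d (pts_hull d n x)" as] integrable_zvol_sample[of d]
    by (simp add: mean_zvol_def[abs_def])
  then have "(\<integral>x. mixed_diff (zvol d (pts_hull d n x)) as \<partial>Q) = \<gamma> * mean_zvol (d - length as) []"
    using \<gamma>[OF tower_mean_zvol] by simp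
  moreover have "mixed_diff (zvol d (unit_ball_rd d)) as = \<gamma> * vol (d - length as) (unit_ball_rd (d - length as))"
    using \<gamma>[OF tower_unit_ball] by (simp add: zvol_def)
  ultimately show ?thesis by (simp add: mean_zvol_def zvol_def)
qed

lemma mean_zmean:
  assumes j: "j \<le> d"
  shows "vol (d - j) (unit_ball_rd (d - j)) * (\<integral>x. zmean d j (pts_hull d n x) \<partial>Q)
    = (\<integral>x. vol (d - j) (pts_hull (d - j) n x) \<partial>Q) * zmean d j (unit_ball_rd d)"
proof -
  let ?U = "unif_balls d j"
  interpret P: pair_prob_space Q ?U ..
  let ?F = "\<lambda>x a is. zvol d (pts_hull d n x) (map a is)"
  have AE_pair: "AE p in Q \<Otimes>\<^sub>M ?U. (\<forall>l\<in>{..<n}. norm_rd d (fst p l) \<le> 1) \<and> (\<forall>l\<in>{..<j}. norm_rd d (snd p l) \<le> 1)"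
  proof (rule P.AE_pair_measure)
    have 1: "(\<lambda>p. norm_rd d (fst p l)) \<in> borel_measurable (Q \<Otimes>\<^sub>M ?U)" if "l < n" for l
    proof -
      have "(\<lambda>p. fst p l i) \<in> borel_measurable (Q \<Otimes>\<^sub>M ?U)" for i
        by (rule measurable_compose[OF measurable_fst measurable_sample_coord[OF that]])
      then show ?thesis unfolding L2_set_def by measurable
    qed
    have 2: "(\<lambda>p. norm_rd d (snd p l)) \<in> borel_measurable (Q \<Otimes>\<^sub>M ?U)" if "l < j" for l
    proof -
      have "(\<lambda>a. a l i) \<in> borel_measurable ?U" for i
        by (rule measurable_PiM_coord[of _ _ _ d]) (use that in auto)
      then have "(\<lambda>p. snd p l i) \<in> borel_measurable (Q \<Otimes>\<^sub>M ?U)" for i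
        by (rule measurable_compose[OF measurable_snd])
      then show ?thesis unfolding L2_set_def by measurable
    qed
    show "{p \<in> space (Q \<Otimes>\<^sub>M ?U). (\<forall>l\<in>{..<n}. norm_rd d (fst p l) \<le> 1) \<and> (\<forall>l\<in>{..<j}. norm_rd d (snd p l) \<le> 1)} \<in> sets (Q \<Otimes>\<^sub>M ?U)"
      using 1 2 by (intro sets.sets_Collect_conj sets.sets_Collect_finite_All borel_measurable_le) auto
    show "AE x in Q. AE y in ?U. (\<forall>l\<in>{..<n}. norm_rd d (fst (x, y) l) \<le> 1) \<and> (\<forall>l\<in>{..<j}. norm_rd d (snd (x, y) l) \<le> 1)"
      using AE_ball
    proof eventually_elim
      case (elim x)
      show ?case using AE_unif_balls[of j d] by eventually_elim (use elim in simp)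
    qed
  qed
  have int: "integrable (Q \<Otimes>\<^sub>M ?U) (\<lambda>p. ?F (fst p) (snd p) is)" if js: "set is \<subseteq> {..<j}" for "is"
  proof (rule P.integrable_const_bound)
    show "(\<lambda>p. ?F (fst p) (snd p) is) \<in> borel_measurable (Q \<Otimes>\<^sub>M ?U)"
    proof (rule measurable_zvol_pts_hull)
      show "(\<lambda>p. fst p l i) \<in> borel_measurable (Q \<Otimes>\<^sub>M ?U)" if "l < n" for l i
        by (rule measurable_compose[OF measurable_fst measurable_sample_coord[OF that]])
      show "(\<lambda>p. snd p l i) \<in> borel_measurable (Q \<Otimes>\<^sub>M ?U)" if "l \<in> set is" for l i
      proof (rule measurable_compose[OF measurable_snd])
        show "(\<lambda>a. a l i) \<in> borel_measurable ?U"
          by (rule measurable_PiM_coord[of _ _ _ d]) (use that js in auto)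
      qed
    qed
    show "AE p in Q \<Otimes>\<^sub>M ?U. norm (?F (fst p) (snd p) is) \<le> vol d {x \<in> Rd d. norm_rd d x \<le> 1 + 1 * length is}"
      using AE_pair
    proof eventually_elim
      case (elim p)
      then have sub: "pts_hull d n (fst p) \<subseteq> {z \<in> Rd d. norm_rd d z \<le> 1}"
        by (intro pts_hull_subset_ball) auto
      have K: "norm_rd d b \<le> 1" if "b \<in> set (map (snd p) is)" for b
        using that elim js by auto
      show ?case
        using zvol_bound[of _ _ _ "map (snd p) is", OF sub zero_less_one K body_pts_hull[OF n]] by simp
    qed
  qed
  have "integrable (Q \<Otimes>\<^sub>M ?U) (\<lambda>p. mixed_diff (?F (fst p) (snd p)) [0..<j])"
    using mixed_diff_integral[of "{..<j}" "Q \<Otimes>\<^sub>M ?U" "\<lambda>p. ?F (fst p) (snd p)" "[0..<j]", OF int]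
    by (simp add: subset_iff)
  then have "integrable (Q \<Otimes>\<^sub>M ?U) (\<lambda>(x, a). mixed_diff (zvol d (pts_hull d n x)) (map a [0..<j]))"
    by (simp add: mixed_diff_map split_beta')
  from P.Fubini_integral[OF this]
  have "(\<integral>x. zmean d j (pts_hull d n x) \<partial>Q) = (\<integral>a. \<integral>x. mixed_diff (zvol d (pts_hull d n x)) (map a [0..<j]) \<partial>Q \<partial>?U)"
    by (simp add: zmean_def)
  then have "vol (d - j) (unit_ball_rd (d - j)) * (\<integral>x. zmean d j (pts_hull d n x) \<partial>Q) =
    (\<integral>a. vol (d - j) (unit_ball_rd (d - j)) * (\<integral>x. mixed_diff (zvol d (pts_hull d n x)) (map a [0..<j]) \<partial>Q) \<partial>?U)"
    by simp
  also have "\<dots> = (\<integral>a. (\<integral>x. vol (d - j) (pts_hull (d - j) n x) \<partial>Q) * mixed_diff (zvol d (unit_ball_rd d)) (map a [0..<j]) \<partial>?U)"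
    using mean_mixed_diff[of "map a [0..<j]" for a] j by simp
  also have "\<dots> = (\<integral>x. vol (d - j) (pts_hull (d - j) n x) \<partial>Q) * zmean d j (unit_ball_rd d)"
    by (simp add: zmean_def)
  finally show ?thesis .
qed

theorem mean_intrinsic_volume_ratio:
  assumes k: "k \<le> d"
  shows "(\<integral>x. intrinsic_volume d k (pts_hull d n x) \<partial>Q) / intrinsic_volume d k (unit_ball_rd d)
    = (\<integral>x. vol k (pts_hull k n x) \<partial>Q) / vol k (unit_ball_rd k)"
proof -
  let ?c = "mean_supp d ^ (d - k) * fact (d - k) * unit_ball_vol (real (d - k))"
  have "?c \<noteq> 0" using mean_supp_pos[OF d] unit_ball_vol_pos[of "real (d - k)"] by (simp del: unit_ball_vol_pos)
  moreover have "zmean d (d - k) (unit_ball_rd d) \<noteq> 0" by (rule zmean_ball_nonzero[OF d]) simp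
  moreover have "vol k (unit_ball_rd k) \<noteq> 0" using vol_unit_ball_pos[of k] by simp
  moreover have "vol k (unit_ball_rd k) * (\<integral>x. zmean d (d - k) (pts_hull d n x) \<partial>Q)
    = (\<integral>x. vol k (pts_hull k n x) \<partial>Q) * zmean d (d - k) (unit_ball_rd d)"
    using mean_zmean[of "d - k"] k by simp
  ultimately show ?thesis
    unfolding intrinsic_volume_eq[OF body_pts_hull[OF n] d k] intrinsic_volume_eq[OF body_unit_ball d k]
    by (simp add: field_simps)
qed

lemma measurable_intrinsic_volume:
  assumes k: "k \<le> d"
  shows "(\<lambda>x. intrinsic_volume d k (pts_hull d n x)) \<in> borel_measurable Q"
proof -
  let ?j = "d - k"
  have "(\<lambda>p. mixed_diff (\<lambda>is. zvol d (pts_hull d n (fst p)) (map (snd p) is)) [0..<?j]) \<in> borel_measurable (Q \<Otimes>\<^sub>M unif_balls d ?j)"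
  proof (rule mixed_diff_measurable[of "{..<?j}"])
    fix "is" assume js: "set is \<subseteq> {..<?j}"
    show "(\<lambda>p. zvol d (pts_hull d n (fst p)) (map (snd p) is)) \<in> borel_measurable (Q \<Otimes>\<^sub>M unif_balls d ?j)"
    proof (rule measurable_zvol_pts_hull)
      show "(\<lambda>p. fst p l i) \<in> borel_measurable (Q \<Otimes>\<^sub>M unif_balls d ?j)" if "l < n" for l i
        by (rule measurable_compose[OF measurable_fst measurable_sample_coord[OF that]])
      show "(\<lambda>p. snd p l i) \<in> borel_measurable (Q \<Otimes>\<^sub>M unif_balls d ?j)" if "l \<in> set is" for l i
      proof (rule measurable_compose[OF measurable_snd])
        show "(\<lambda>a. a l i) \<in> borel_measurable (unif_balls d ?j)"
          by (rule measurable_PiM_coord[of _ _ _ d]) (use that js in auto)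
      qed
    qed
  qed auto
  then have "(\<lambda>(x, a). mixed_diff (zvol d (pts_hull d n x)) (map a [0..<?j])) \<in> borel_measurable (Q \<Otimes>\<^sub>M unif_balls d ?j)"
    by (simp add: mixed_diff_map split_beta')
  then have "(\<lambda>x. zmean d ?j (pts_hull d n x)) \<in> borel_measurable Q"
    unfolding zmean_def by (rule unif_balls.borel_measurable_lebesgue_integral)
  then show ?thesis
    unfolding intrinsic_volume_eq[OF body_pts_hull[OF n] d k] by measurable
qed

end

lemma convex_hull_eq_pts_hull:
  assumes n: "n > 0" and X: "\<And>j. j < n \<Longrightarrow> X j \<in> Rd d"
  shows "convex_rd d hull (X ` {..<n}) = pts_hull d n X"
proof (rule hull_unique)
  show "X ` {..<n} \<subseteq> pts_hull d n X"
  proof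
    fix z assume "z \<in> X ` {..<n}"
    then obtain j where j: "j < n" "z = X j" by auto
    have "restrict (X j) {..<d} = X j" by (rule PiE_restrict[OF X[OF j(1)]])
    then show "z \<in> pts_hull d n X" using pts_hull_vertex[OF j(1), of X d] j(2) by (simp only:)
  qed
  show "convex_rd d (pts_hull d n X)" using body_pts_hull[OF n] by (simp add: body_def)
  fix T assume T: "X ` {..<n} \<subseteq> T" "convex_rd d T"
  have *: "(\<lambda>i\<in>{..<d}. \<Sum>j<m. l j * X j i) \<in> T"
    if "m > 0" "m \<le> n" "\<And>j. j < m \<Longrightarrow> l j \<ge> 0" "(\<Sum>j<m. l j) = 1" for m l
    using that
  proof (induction m arbitrary: l)
    case (Suc m)
    define t where "t = (\<Sum>j<m. l j)"
    have t: "t \<ge> 0" unfolding t_def using Suc.prems by (intro sum_nonneg) auto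
    have lm: "l m \<ge> 0" "t + l m = 1" using Suc.prems by (auto simp: t_def)
    have Xm: "X m \<in> T" using T(1) Suc.prems by auto
    show ?case
    proof (cases "t = 0")
      case True
      then have "l j = 0" if "j < m" for j
        using sum_nonneg_eq_0_iff[of "{..<m}" l] Suc.prems(3) that by (auto simp: t_def)
      then have "(\<lambda>i\<in>{..<d}. \<Sum>j<Suc m. l j * X j i) = restrict (X m) {..<d}"
        using lm True by auto
      also have "\<dots> = X m" by (rule PiE_restrict) (use X[of m] Suc.prems in simp)
      finally show ?thesis using Xm by simp
    next
      case False
      then have tp: "t > 0" using t by simp
      have m: "m > 0" using False by (auto simp: t_def intro: gr0I)
      have "(\<Sum>j<m. l j / t) = 1" using False by (simp add: sum_divide_distrib[symmetric] t_def)
      then have IH: "(\<lambda>i\<in>{..<d}. \<Sum>j<m. l j / t * X j i) \<in> T"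
        using Suc.prems m tp by (intro Suc.IH) auto
      have "(\<lambda>i\<in>{..<d}. t * (\<lambda>i\<in>{..<d}. \<Sum>j<m. l j / t * X j i) i + l m * X m i) \<in> T"
        using T(2) IH Xm t lm unfolding convex_rd_def by blast
      also have "(\<lambda>i\<in>{..<d}. t * (\<lambda>i\<in>{..<d}. \<Sum>j<m. l j / t * X j i) i + l m * X m i) =
          (\<lambda>i\<in>{..<d}. \<Sum>j<Suc m. l j * X j i)"
        using False by (auto simp: sum_distrib_left)
      finally show ?thesis .
    qed
  qed simp
  show "pts_hull d n X \<subseteq> T"
    unfolding pts_hull_def using *[OF n order_refl] by (auto simp: weights_def PiE_iff simp del: restrict_apply)
qed

section \<open>Volume of a random polytope\<close>

context symmetric_sample
begin

definition tail :: "real \<Rightarrow> real" where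
  "tail h = measure \<nu> {x \<in> Rd d. h \<le> x (d - 1)}"

lemma measurable_\<nu>_ip [measurable]: "(\<lambda>x. ip k x u) \<in> borel_measurable \<nu>"
  using measurable_ip[of k u d] by (simp cong: measurable_cong_sets add: sets_\<nu>)

lemma half_space_sets: "{x \<in> Rd d. h \<le> ip k x u} \<in> sets \<nu>"
proof -
  have "{x \<in> space \<nu>. h \<le> ip k x u} \<in> sets \<nu>" by measurable
  then show ?thesis by (simp add: space_\<nu>)
qed

lemma measure_\<nu>_hrefl:
  assumes u: "norm_rd d u = 1" and S: "{x \<in> Rd d. P x} \<in> sets \<nu>"
  shows "measure \<nu> {x \<in> Rd d. P (hrefl d u x)} = measure \<nu> {x \<in> Rd d. P x}"
proof -
  have S': "{x \<in> Rd d. P x} \<in> sets (lborel_rd d)" using S by (simp add: sets_\<nu>)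
  have m: "hrefl d u \<in> \<nu> \<rightarrow>\<^sub>M lborel_rd d"
    using measurable_hrefl[of d u] by (simp cong: measurable_cong_sets add: sets_\<nu>)
  have "measure \<nu> {x \<in> Rd d. P x} = measure (distr \<nu> (lborel_rd d) (hrefl d u)) {x \<in> Rd d. P x}"
    unfolding symm[OF u] ..
  also have "\<dots> = measure \<nu> (hrefl d u -` {x \<in> Rd d. P x} \<inter> space \<nu>)"
    by (rule measure_distr[OF m S'])
  also have "hrefl d u -` {x \<in> Rd d. P x} \<inter> space \<nu> = {x \<in> Rd d. P (hrefl d u x)}"
    by (auto simp: space_\<nu>)
  finally show ?thesis ..
qed

lemma tail_direction:
  assumes u: "norm_rd d u = 1"
  shows "measure \<nu> {x \<in> Rd d. h \<le> ip d x u} = tail h"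
proof -
  obtain i where i: "d = Suc i" using d by (cases d) auto
  define e where "e = (\<lambda>j. if j = i then 1 else 0 :: real)"
  have ip_e: "ip d x e = x i" for x
    by (simp add: ip_def e_def i if_distrib cong: if_cong)
  have "(norm_rd d e)\<^sup>2 = 1" unfolding ip_self[symmetric] ip_e by (simp add: e_def)
  then have e: "norm_rd d e = 1" by (intro power2_eq_imp_eq[of "norm_rd d e" 1]) simp_all
  obtain w where w: "norm_rd d w = 1" "\<And>j. j < i \<Longrightarrow> hrefl d w u j = 0" "\<bar>hrefl d w u i\<bar> = 1"
    using ex_hrefl_to_axis[of i u] u unfolding i by metis
  have "measure \<nu> {x \<in> Rd d. h \<le> ip d x u} = measure \<nu> {x \<in> Rd d. h \<le> ip d (hrefl d w x) u}"
    by (rule measure_\<nu>_hrefl[OF w(1) half_space_sets, symmetric])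
  also have "\<dots> = measure \<nu> {x \<in> Rd d. h \<le> x i * hrefl d w u i}"
    using ip_hrefl_axis[where i = i and w = w and u = u] w unfolding i by simp
  also have "\<dots> = measure \<nu> {x \<in> Rd d. h \<le> x i}"
  proof (cases "hrefl d w u i = 1")
    case False
    then have "hrefl d w u i = -1" using w(3) by linarith
    moreover have "measure \<nu> {x \<in> Rd d. h \<le> - ip d x e} = measure \<nu> {x \<in> Rd d. h \<le> ip d x e}"
      using measure_\<nu>_hrefl[OF e half_space_sets, of h d e] unfolding ip_hrefl(2)[OF e] .
    ultimately show ?thesis unfolding ip_e by simp
  qed simp
  also have "i = d - 1" using i by simp
  finally show ?thesis unfolding tail_def .
qed

lemma tail_direction_proj:
  assumes k: "k \<le> d" and u: "norm_rd k u = 1"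
  shows "measure \<nu> {x \<in> Rd d. h \<le> ip k x u} = tail h"
proof -
  define u' where "u' = (\<lambda>i. if i < k then u i else 0)"
  have ip': "ip d x u' = ip k x u" for x
  proof -
    have "(\<Sum>i<d. x i * u' i) = (\<Sum>i<k. x i * u' i)"
      by (rule sum.mono_neutral_right) (use k in \<open>auto simp: u'_def\<close>)
    also have "\<dots> = (\<Sum>i<k. x i * u i)" by (intro sum.cong) (auto simp: u'_def)
    finally show ?thesis by (simp add: ip_def)
  qed
  have "(norm_rd d u')\<^sup>2 = ip k u' u" unfolding ip_self[symmetric] ip' ..
  also have "\<dots> = ip k u u" unfolding ip_def by (intro sum.cong) (auto simp: u'_def)
  also have "\<dots> = 1" unfolding ip_self u by simp
  finally have "norm_rd d u' = 1" by (intro power2_eq_imp_eq[of "norm_rd d u'" 1]) simp_all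
  from tail_direction[OF this, of h] show ?thesis unfolding ip' .
qed

lemma prob_half_space:
  assumes j: "j < n"
  shows "{x \<in> space Q. h \<le> ip k (x j) u} \<in> sets Q"
    and "Q.prob {x \<in> space Q. h \<le> ip k (x j) u} = measure \<nu> {x \<in> Rd d. h \<le> ip k x u}"
proof -
  have m: "(\<lambda>x. x j) \<in> Q \<rightarrow>\<^sub>M \<nu>" using j by simp
  have "distr Q \<nu> (\<lambda>x. x j) = \<nu>" by (rule distr_PiM_component) (use j prob in auto)
  then have "measure \<nu> {x \<in> Rd d. h \<le> ip k x u} = measure (distr Q \<nu> (\<lambda>x. x j)) {x \<in> Rd d. h \<le> ip k x u}" by simp
  also have "\<dots> = Q.prob ((\<lambda>x. x j) -` {x \<in> Rd d. h \<le> ip k x u} \<inter> space Q)"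
    by (rule measure_distr[OF m half_space_sets])
  also have eq: "(\<lambda>x. x j) -` {x \<in> Rd d. h \<le> ip k x u} \<inter> space Q = {x \<in> space Q. h \<le> ip k (x j) u}"
    using measurable_space[OF m] by (auto simp: space_\<nu>)
  finally show "Q.prob {x \<in> space Q. h \<le> ip k (x j) u} = measure \<nu> {x \<in> Rd d. h \<le> ip k x u}" ..
  show "{x \<in> space Q. h \<le> ip k (x j) u} \<in> sets Q"
    using measurable_sets[OF m half_space_sets, of h k u] unfolding eq .
qed

lemma hull_event: "{q \<in> space (Q \<Otimes>\<^sub>M lborel_rd k). snd q \<in> pts_hull k n (fst q)} \<in> sets (Q \<Otimes>\<^sub>M lborel_rd k)"
  by (rule measurable_zvol_pts_hull(2)[where js = "[]"]) (auto intro: measurable_sample_coord)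

lemma prob_mem_hull_le:
  assumes k: "k \<le> d" and z: "z \<in> Rd k" "norm_rd k z > h" and h: "h > 0"
  shows "emeasure Q {x \<in> space Q. z \<in> pts_hull k n x} \<le> ennreal (n * tail h)"
proof -
  define u where "u = (\<lambda>i. 1 / norm_rd k z * z i)"
  have pos: "norm_rd k z > 0" using z(2) h by simp
  have u: "norm_rd k u = 1" unfolding u_def norm_scale using pos by simp
  have zu: "ip k z u = norm_rd k z"
    unfolding u_def ip_commute[of k z] ip_scale ip_self using pos by (simp add: power2_eq_square)
  let ?H = "\<lambda>j. {x \<in> space Q. h \<le> ip k (x j) u}"
  have "{x \<in> space Q. z \<in> pts_hull k n x} \<subseteq> (\<Union>j\<in>{..<n}. ?H j)"
  proof (rule ccontr)
    assume "\<not> ?thesis"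
    then obtain x where x: "x \<in> space Q" "z \<in> pts_hull k n x" "\<And>j. j < n \<Longrightarrow> \<not> h \<le> ip k (x j) u"
      by blast
    then obtain l where l: "l \<in> weights n" "z = (\<lambda>i\<in>{..<k}. \<Sum>j<n. l j * x j i)" unfolding pts_hull_def by blast
    have "ip k z u \<le> h" unfolding l(2) ip_weights by (rule weights_average_le[OF l(1)]) (use x(3) in force)
    then show False using zu z(2) by simp
  qed
  then have "emeasure Q {x \<in> space Q. z \<in> pts_hull k n x} \<le> emeasure Q (\<Union>j\<in>{..<n}. ?H j)"
    by (rule emeasure_mono) (intro sets.finite_UN prob_half_space(1), auto)
  also have "\<dots> = ennreal (Q.prob (\<Union>j\<in>{..<n}. ?H j))" by (rule Q.emeasure_eq_measure)
  also have "Q.prob (\<Union>j\<in>{..<n}. ?H j) \<le> (\<Sum>j\<in>{..<n}. Q.prob (?H j))"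
    by (rule Q.finite_measure_subadditive_finite) (use prob_half_space(1) in auto)
  also have "(\<Sum>j\<in>{..<n}. Q.prob (?H j)) = (\<Sum>j\<in>{..<n}. tail h)"
    by (intro sum.cong refl) (simp add: prob_half_space(2) tail_direction_proj[OF k u])
  finally show ?thesis by (simp add: ennreal_leI)
qed

lemma mean_vol_le:
  assumes k: "k \<le> d" and h: "h > 0"
  shows "(\<integral>x. vol k (pts_hull k n x) \<partial>Q) \<le> (h ^ k + n * tail h) * vol k (unit_ball_rd k)"
proof -
  let ?B = "unit_ball_rd k" and ?hB = "{z \<in> Rd k. norm_rd k z \<le> h}"
  define S where "S = {z \<in> ?B. h < norm_rd k z}"
  have S [measurable]: "S \<in> sets (lborel_rd k)"
  proof -
    have "{z \<in> space (lborel_rd k). norm_rd k z \<le> 1 \<and> h < norm_rd k z} \<in> sets (lborel_rd k)" by measurable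
    also have "{z \<in> space (lborel_rd k). norm_rd k z \<le> 1 \<and> h < norm_rd k z} = S"
      by (auto simp: S_def unit_ball_eq)
    finally show ?thesis .
  qed
  have SB: "S \<subseteq> ?B" by (auto simp: S_def)
  define H where "H = {q \<in> space (Q \<Otimes>\<^sub>M lborel_rd k). snd q \<in> pts_hull k n (fst q)} \<inter> (space Q \<times> S)"
  have H: "H \<in> sets (Q \<Otimes>\<^sub>M lborel_rd k)" unfolding H_def using hull_event S by auto
  interpret P: pair_sigma_finite Q "lborel_rd k" ..
  have sec1: "Pair x -` H = pts_hull k n x \<inter> S" if "x \<in> space Q" for x
    using that pts_hull_subset[of k n x] by (auto simp: H_def space_pair_measure)
  have sec2: "(\<lambda>x. (x, z)) -` H = (if z \<in> S then {x \<in> space Q. z \<in> pts_hull k n x} else {})" for z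
    using pts_hull_subset by (auto simp: H_def space_pair_measure S_def unit_ball_eq)
  have hullS: "pts_hull k n x \<in> sets (lborel_rd k)" for x by (rule bodyD(4)[OF body_pts_hull[OF n]])
  have fin: "emeasure (lborel_rd k) S < \<infinity>"
    using emeasure_mono[OF SB unit_ball_sets] emeasure_unit_ball_finite[of k] by (rule order_le_less_trans)
  have "(\<integral>\<^sup>+x. emeasure (lborel_rd k) (pts_hull k n x \<inter> S) \<partial>Q) = (\<integral>\<^sup>+x. emeasure (lborel_rd k) (Pair x -` H) \<partial>Q)"
    by (intro nn_integral_cong) (simp add: sec1)
  also have "\<dots> = emeasure (Q \<Otimes>\<^sub>M lborel_rd k) H" by (rule lborel_rd.emeasure_pair_measure_alt[OF H, symmetric])
  also have "\<dots> = (\<integral>\<^sup>+z. emeasure Q ((\<lambda>x. (x, z)) -` H) \<partial>lborel_rd k)" by (rule P.emeasure_pair_measure_alt2[OF H])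
  also have "\<dots> \<le> (\<integral>\<^sup>+z. ennreal (n * tail h) * indicator S z \<partial>lborel_rd k)"
  proof (rule nn_integral_mono)
    fix z show "emeasure Q ((\<lambda>x. (x, z)) -` H) \<le> ennreal (n * tail h) * indicator S z"
      unfolding sec2 using prob_mem_hull_le[OF k _ _ h, of z]
      by (cases "z \<in> S") (auto simp: S_def unit_ball_eq)
  qed
  also have "\<dots> = ennreal (n * tail h) * emeasure (lborel_rd k) S" by (simp add: nn_integral_cmult)
  also have "\<dots> \<le> ennreal (n * tail h) * emeasure (lborel_rd k) ?B"
    by (intro mult_left_mono emeasure_mono SB) auto
  also have "\<dots> = ennreal (n * tail h * vol k ?B)"
    using emeasure_unit_ball_finite[of k] by (simp add: emeasure_eq_ennreal_measure ennreal_mult' tail_def)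
  finally have 1: "(\<integral>\<^sup>+x. emeasure (lborel_rd k) (pts_hull k n x \<inter> S) \<partial>Q) \<le> ennreal (n * tail h * vol k ?B)" .
  have "ennreal (\<integral>x. vol k (pts_hull k n x) \<partial>Q) = (\<integral>\<^sup>+x. ennreal (vol k (pts_hull k n x)) \<partial>Q)"
    using integrable_zvol_sample[OF k, of "[]"] by (intro nn_integral_eq_integral[symmetric]) (auto simp: zvol_def)
  also have "\<dots> \<le> (\<integral>\<^sup>+x. ennreal (h ^ k * vol k ?B) + emeasure (lborel_rd k) (pts_hull k n x \<inter> S) \<partial>Q)"
  proof (rule nn_integral_mono_AE)
    show "AE x in Q. ennreal (vol k (pts_hull k n x)) \<le> ennreal (h ^ k * vol k ?B) + emeasure (lborel_rd k) (pts_hull k n x \<inter> S)"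
      using AE_ball
    proof eventually_elim
      case (elim x)
      have sub: "pts_hull k n x \<subseteq> {z \<in> Rd k. norm_rd k z \<le> 1}"
        using elim k by (intro pts_hull_subset_ball) auto
      have "ennreal (vol k (pts_hull k n x)) = emeasure (lborel_rd k) (pts_hull k n x)"
        using emeasure_body_finite[OF body_pts_hull[OF n], of k x] by (simp add: emeasure_eq_ennreal_measure)
      also have "\<dots> \<le> emeasure (lborel_rd k) (?hB \<union> (pts_hull k n x \<inter> S))"
        by (rule emeasure_mono) (use sub hullS S ball_rd_sets in \<open>auto simp: S_def unit_ball_eq\<close>)
      also have "\<dots> \<le> emeasure (lborel_rd k) ?hB + emeasure (lborel_rd k) (pts_hull k n x \<inter> S)"
        by (rule emeasure_subadditive) (use hullS S ball_rd_sets in auto)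
      also have "emeasure (lborel_rd k) ?hB = ennreal (h ^ k * vol k ?B)"
        unfolding vol_ball_rd[OF h, symmetric] using emeasure_bounded_finite[OF subset_refl, of k h]
        by (simp add: emeasure_eq_ennreal_measure)
      finally show ?case .
    qed
  qed
  also have "\<dots> = ennreal (h ^ k * vol k ?B) + (\<integral>\<^sup>+x. emeasure (lborel_rd k) (pts_hull k n x \<inter> S) \<partial>Q)"
  proof -
    have "(\<lambda>x. emeasure (lborel_rd k) (Pair x -` H)) \<in> borel_measurable Q"
      by (rule lborel_rd.measurable_emeasure_Pair[OF H])
    then have "(\<lambda>x. emeasure (lborel_rd k) (pts_hull k n x \<inter> S)) \<in> borel_measurable Q"
      by (subst (asm) measurable_cong[OF arg_cong[where f = "emeasure (lborel_rd k)", OF sec1]])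
    then show ?thesis by (subst nn_integral_add) (simp_all add: Q.emeasure_space_1)
  qed
  also have "\<dots> \<le> ennreal (h ^ k * vol k ?B) + ennreal (n * tail h * vol k ?B)"
    by (rule add_left_mono[OF 1])
  also have "\<dots> = ennreal ((h ^ k + n * tail h) * vol k ?B)"
    using h by (simp add: ennreal_plus[symmetric] tail_def distrib_right del: ennreal_plus)
  finally show ?thesis
    by (subst (asm) ennreal_le_iff) (use h in \<open>auto simp: tail_def\<close>)
qed

lemma prob_all_below:
  assumes k: "k \<le> d" and u: "norm_rd k u = 1"
  shows "{x \<in> space Q. \<forall>j<n. ip k (x j) u < h} \<in> sets Q"
    and "Q.prob {x \<in> space Q. \<forall>j<n. ip k (x j) u < h} = (1 - tail h) ^ n"
proof -
  interpret pr: product_sigma_finite "\<lambda>_::nat. \<nu>"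
    by (simp add: product_sigma_finite_def \<nu>.sigma_finite_measure_axioms)
  let ?A = "{x \<in> Rd d. ip k x u < h}"
  have A: "?A \<in> sets \<nu>"
  proof -
    have "{x \<in> space \<nu>. ip k x u < h} \<in> sets \<nu>" by measurable
    then show ?thesis by (simp add: space_\<nu>)
  qed
  have eq: "{x \<in> space Q. \<forall>j<n. ip k (x j) u < h} = Pi\<^sub>E {..<n} (\<lambda>_. ?A)"
    unfolding set_eq_iff mem_Collect_eq space_PiM space_\<nu> PiE_iff[of _ "{..<n}"] by blast
  show "{x \<in> space Q. \<forall>j<n. ip k (x j) u < h} \<in> sets Q"
    unfolding eq using A by (intro sets_PiM_I_finite) auto
  have mA: "measure \<nu> ?A = 1 - tail h"
  proof -
    have "?A = space \<nu> - {x \<in> Rd d. h \<le> ip k x u}" 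
    proof (rule set_eqI)
      fix x show "x \<in> ?A \<longleftrightarrow> x \<in> space \<nu> - {x \<in> Rd d. h \<le> ip k x u}"
        unfolding space_\<nu> mem_Collect_eq Diff_iff not_le[symmetric] by blast
    qed
    then show ?thesis
      using \<nu>.prob_compl[OF half_space_sets, of h k u] tail_direction_proj[OF k u, of h] by (simp only:)
  qed
  have "emeasure Q (Pi\<^sub>E {..<n} (\<lambda>_. ?A)) = (\<Prod>j<n. emeasure \<nu> ?A)"
    by (rule pr.emeasure_PiM) (use A in auto)
  also have "\<dots> = ennreal ((1 - tail h) ^ n)"
    unfolding \<nu>.emeasure_eq_measure mA
    by (subst prod_constant) (use mA measure_nonneg[of \<nu> ?A] in \<open>simp add: ennreal_power\<close>)
  finally show "Q.prob {x \<in> space Q. \<forall>j<n. ip k (x j) u < h} = (1 - tail h) ^ n"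
    unfolding eq using mA measure_nonneg[of \<nu> ?A] by (simp add: measure_def)
qed

lemma mean_vol_ge:
  assumes k: "k \<le> d" and h: "0 < h" "h + real k / real N \<le> h'" and N: "N \<ge> 1"
  shows "h ^ k * vol k (unit_ball_rd k) * (1 - (2 * real N + 1) ^ k * exp (- (real n * tail h'))) \<le> (\<integral>x. vol k (pts_hull k n x) \<partial>Q)"
proof -
  obtain T where T: "finite T" "card T \<le> (2 * N + 1) ^ k" "\<And>v. v \<in> T \<Longrightarrow> norm_rd k v = 1"
    "\<And>u. norm_rd k u = 1 \<Longrightarrow> \<exists>v\<in>T. norm_rd k (\<lambda>i. u i - v i) \<le> real k / real N"
    using sphere_net[OF N, of k] by metis
  define Bad where "Bad = (\<Union>v\<in>T. {x \<in> space Q. \<forall>j<n. ip k (x j) v < h'})"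
  have Bad: "Bad \<in> sets Q" unfolding Bad_def by (intro sets.finite_UN T(1) prob_all_below(1) k T(3))
  have t: "0 \<le> tail h'" "tail h' \<le> 1" unfolding tail_def by (simp_all add: \<nu>.prob_le_1)
  have "Q.prob Bad \<le> (\<Sum>v\<in>T. Q.prob {x \<in> space Q. \<forall>j<n. ip k (x j) v < h'})"
    unfolding Bad_def by (rule Q.finite_measure_subadditive_finite) (use T(1) prob_all_below(1)[OF k T(3)] in auto)
  also have "\<dots> = card T * (1 - tail h') ^ n"
    by (simp add: prob_all_below(2)[OF k T(3)])
  also have "\<dots> \<le> (2 * real N + 1) ^ k * exp (- (real n * tail h'))"
  proof (rule mult_mono)
    have "real (card T) \<le> real ((2 * N + 1) ^ k)" using T(2) by (simp only: of_nat_le_iff)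
    then show "real (card T) \<le> (2 * real N + 1) ^ k" by (simp add: add.commute)
    have "(1 - tail h') ^ n \<le> exp (- tail h') ^ n"
      using t exp_ge_add_one_self[of "- tail h'"] by (intro power_mono) auto
    then show "(1 - tail h') ^ n \<le> exp (- (real n * tail h'))" by (simp add: exp_of_nat_mult[symmetric])
  qed (use t in auto)
  finally have pB: "Q.prob Bad \<le> (2 * real N + 1) ^ k * exp (- (real n * tail h'))" .
  let ?c = "h ^ k * vol k (unit_ball_rd k)"
  have "?c * (1 - Q.prob Bad) = (\<integral>x. ?c * indicator (space Q - Bad) x \<partial>Q)"
    using Bad by (simp add: Q.prob_compl)
  also have "\<dots> \<le> (\<integral>x. vol k (pts_hull k n x) \<partial>Q)"
  proof (rule integral_mono_AE)
    show "integrable Q (\<lambda>x. ?c * indicator (space Q - Bad) x)"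
      using Bad by (intro integrable_mult_right integrable_real_indicator) (auto simp: Q.emeasure_eq_measure)
    show "integrable Q (\<lambda>x. vol k (pts_hull k n x))"
      using integrable_zvol_sample[OF k, of "[]"] by (simp add: zvol_def)
    show "AE x in Q. ?c * indicator (space Q - Bad) x \<le> vol k (pts_hull k n x)"
      using AE_ball
    proof eventually_elim
      case (elim x)
      have b: "body k (pts_hull k n x)" by (rule body_pts_hull[OF n])
      show ?case
      proof (cases "x \<in> space Q - Bad")
        case True
        have "{z \<in> Rd k. norm_rd k z \<le> h} \<subseteq> pts_hull k n x"
        proof (rule ball_subset_body[OF b])
          fix u :: "nat \<Rightarrow> real" assume u: "norm_rd k u = 1"
          obtain v where v: "v \<in> T" "norm_rd k (\<lambda>i. u i - v i) \<le> real k / real N" using T(4)[OF u] by blast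
          have "x \<notin> {x \<in> space Q. \<forall>j<n. ip k (x j) v < h'}" using True v(1) unfolding Bad_def by blast
          then obtain j where j: "j < n" "h' \<le> ip k (x j) v" using True by (auto simp: not_less)
          have "norm_rd k (x j) \<le> 1" using norm_rd_mono[OF k, of "x j"] elim j(1) by force
          then have "norm_rd k (\<lambda>i. u i - v i) * norm_rd k (x j) \<le> real k / real N * 1"
            using v(2) by (intro mult_mono) auto
          moreover have "\<bar>ip k (\<lambda>i. u i - v i) (x j)\<bar> \<le> norm_rd k (\<lambda>i. u i - v i) * norm_rd k (x j)" by (rule ip_le_norm)
          ultimately have "\<bar>ip k (x j) u - ip k (x j) v\<bar> \<le> real k / real N"
            unfolding ip_diff by (simp add: ip_commute)
          then have "h \<le> ip k (restrict (x j) {..<k}) u" using j(2) h(2) by simp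
          then show "\<exists>z\<in>pts_hull k n x. h \<le> ip k z u" using pts_hull_vertex[OF j(1)] by blast
        qed
        moreover have "pts_hull k n x \<in> fmeasurable (lborel_rd k)"
          by (rule fmeasurableI[OF bodyD(4)[OF b]]) (use emeasure_body_finite[OF b] in simp)
        ultimately have "vol k {z \<in> Rd k. norm_rd k z \<le> h} \<le> vol k (pts_hull k n x)"
          by (intro measure_mono_fmeasurable ball_rd_sets)
        then show ?thesis using True by (simp add: vol_ball_rd[OF h(1)])
      qed (simp add: measure_nonneg)
    qed
  qed
  finally have "?c * (1 - Q.prob Bad) \<le> (\<integral>x. vol k (pts_hull k n x) \<partial>Q)" .
  moreover have "?c * (1 - (2 * real N + 1) ^ k * exp (- (real n * tail h'))) \<le> ?c * (1 - Q.prob Bad)"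
    using pB h by (intro mult_left_mono) auto
  ultimately show ?thesis by linarith
qed

end

section \<open>Tails of the beta distribution\<close>

lemma measurable_beta_density [measurable]: "beta_density d \<beta> \<in> borel_measurable (lborel_rd d)"
  unfolding beta_density_def[abs_def] by measurable

lemma sets_beta_distribution: "sets (beta_distribution d \<beta>) = sets (lborel_rd d)"
  by (simp add: beta_distribution_def uniform_sphere_def)

definition direction :: "nat \<Rightarrow> (nat \<Rightarrow> real) \<Rightarrow> (nat \<Rightarrow> real)" where
  "direction d x = (\<lambda>i\<in>{..<d}. x i / norm_rd d x)"

lemma measurable_direction [measurable]: "direction d \<in> lborel_rd d \<rightarrow>\<^sub>M lborel_rd d"
  unfolding direction_def[abs_def] by (rule measurable_into_rd) measurable

lemma uniform_sphere_eq: "uniform_sphere d = distr (unif_ball d) (lborel_rd d) (direction d)"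
  unfolding uniform_sphere_def unif_ball_def direction_def[abs_def] ..

lemma norm_direction: "norm_rd d (direction d x) \<le> 1"
proof -
  have "norm_rd d (direction d x) = norm_rd d (\<lambda>i. 1 / norm_rd d x * x i)"
    unfolding direction_def L2_set_restrict by simp
  also have "\<dots> \<le> 1" unfolding norm_scale by simp
  finally show ?thesis .
qed

lemma hrefl_direction:
  assumes "norm_rd d u = 1"
  shows "hrefl d u (direction d x) = direction d (hrefl d u x)"
proof -
  have "hrefl d u (direction d x) = hrefl d u (\<lambda>i. 1 / norm_rd d x * x i)"
    unfolding direction_def hrefl_restrict by simp
  also have "\<dots> = (\<lambda>i\<in>{..<d}. 1 / norm_rd d x * hrefl d u x i)" by (rule hrefl_scale)
  also have "\<dots> = direction d (hrefl d u x)"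
    unfolding direction_def ip_hrefl(5)[OF assms] by simp
  finally show ?thesis .
qed

lemma symmetric_sample_beta:
  assumes "prob_space (beta_distribution d \<beta>)" "n > 0" "d \<ge> 1"
  shows "symmetric_sample d n (beta_distribution d \<beta>)"
proof (rule symmetric_sample.intro)
  show "prob_space (beta_distribution d \<beta>)" by fact
  show "n > 0" by fact
  show "d \<ge> 1" by fact
  show "sets (beta_distribution d \<beta>) = sets (lborel_rd d)" by (rule sets_beta_distribution)
  show "AE x in beta_distribution d \<beta>. norm_rd d x \<le> 1"
  proof (cases "\<beta> = -1")
    case True
    have S: "{x \<in> space (lborel_rd d). norm_rd d x \<le> 1} \<in> sets (lborel_rd d)" by measurable
    have m: "direction d \<in> unif_ball d \<rightarrow>\<^sub>M lborel_rd d" by measurable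
    have "AE x in uniform_sphere d. norm_rd d x \<le> 1"
      unfolding uniform_sphere_eq by (subst AE_distr_iff[OF m S]) (simp add: norm_direction)
    then show ?thesis unfolding beta_distribution_def using True by simp
  next
    case False
    have "AE x in density (lborel_rd d) (\<lambda>x. ennreal (beta_density d \<beta> x)). norm_rd d x \<le> 1"
      by (subst AE_density) (auto simp: beta_density_def)
    then show ?thesis unfolding beta_distribution_def using False by simp
  qed
  fix u assume u: "norm_rd d u = 1"
  show "distr (beta_distribution d \<beta>) (lborel_rd d) (hrefl d u) = beta_distribution d \<beta>"
  proof (cases "\<beta> = -1")
    case True
    have m: "direction d \<in> unif_ball d \<rightarrow>\<^sub>M lborel_rd d" by measurable
    have r: "hrefl d u \<in> unif_ball d \<rightarrow>\<^sub>M lborel_rd d" by measurable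
    have "distr (uniform_sphere d) (lborel_rd d) (hrefl d u) = distr (unif_ball d) (lborel_rd d) (hrefl d u \<circ> direction d)"
      unfolding uniform_sphere_eq by (rule distr_distr[OF measurable_hrefl m])
    also have "hrefl d u \<circ> direction d = direction d \<circ> hrefl d u"
      using hrefl_direction[OF u] by auto
    also have "distr (unif_ball d) (lborel_rd d) (direction d \<circ> hrefl d u) =
        distr (distr (unif_ball d) (lborel_rd d) (hrefl d u)) (lborel_rd d) (direction d)"
      by (rule distr_distr[OF measurable_direction r, symmetric])
    also have "\<dots> = uniform_sphere d" unfolding distr_hrefl_unif_ball[OF u] uniform_sphere_eq ..
    finally show ?thesis using True by (simp add: beta_distribution_def)
  next
    case False
    have "distr (density (lborel_rd d) (\<lambda>x. ennreal (beta_density d \<beta> x))) (lborel_rd d) (hrefl d u) =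
        density (lborel_rd d) (\<lambda>x. ennreal (beta_density d \<beta> x))"
      by (rule distr_density_hrefl[OF u]) (simp_all add: beta_density_def ip_hrefl(5)[OF u])
    then show ?thesis using False by (simp add: beta_distribution_def)
  qed
qed

lemma norm_rd_Suc_sq: "(norm_rd (Suc m) x)\<^sup>2 = (norm_rd m x)\<^sup>2 + (x m)\<^sup>2"
  unfolding ip_self[symmetric] by (simp add: ip_def power2_eq_square)

lemma norm_rd_upd: "norm_rd m (x(m := t)) = norm_rd m x"
  by (rule L2_set_cong) auto

lemma emeasure_cylinder:
  assumes r: "r > 0" and pq: "p \<le> q"
  shows "emeasure (lborel_rd (Suc m)) {y \<in> Rd (Suc m). y m \<in> {p..q} \<and> norm_rd m y \<le> r} =
    ennreal ((q - p) * r ^ m * vol m (unit_ball_rd m))"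
    and "{y \<in> Rd (Suc m). y m \<in> {p..q} \<and> norm_rd m y \<le> r} \<in> sets (lborel_rd (Suc m))"
proof -
  let ?S = "{y \<in> Rd (Suc m). y m \<in> {p..q} \<and> norm_rd m y \<le> r}"
  have "{y \<in> space (lborel_rd (Suc m)). y m \<in> {p..q} \<and> norm_rd m y \<le> r} \<in> sets (lborel_rd (Suc m))" by measurable
  then show S: "?S \<in> sets (lborel_rd (Suc m))" by simp
  have sl: "emeasure lborel {y. x(m := y) \<in> ?S} = ennreal (q - p) * indicator {x \<in> Rd m. norm_rd m x \<le> r} x"
    if "x \<in> Rd m" for x
  proof -
    have "x(m := y) \<in> Rd (Suc m)" for y using that by (auto simp: PiE_iff extensional_def)
    then have "{y. x(m := y) \<in> ?S} = (if norm_rd m x \<le> r then {p..q} else {})"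
      by (auto simp: norm_rd_upd)
    then show ?thesis using that pq by (auto simp: indicator_def)
  qed
  have "emeasure (lborel_rd (Suc m)) ?S = (\<integral>\<^sup>+x. ennreal (q - p) * indicator {x \<in> Rd m. norm_rd m x \<le> r} x \<partial>lborel_rd m)"
    unfolding emeasure_slices(1)[OF S] by (intro nn_integral_cong sl) simp
  also have "\<dots> = ennreal (q - p) * emeasure (lborel_rd m) {x \<in> Rd m. norm_rd m x \<le> r}"
    by (rule nn_integral_cmult_indicator[OF ball_rd_sets])
  also have "emeasure (lborel_rd m) {x \<in> Rd m. norm_rd m x \<le> r} = ennreal (r ^ m * vol m (unit_ball_rd m))"
    unfolding vol_ball_rd[OF r, symmetric] using emeasure_bounded_finite[OF subset_refl, of m r]
    by (simp add: emeasure_eq_ennreal_measure)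
  finally show "emeasure (lborel_rd (Suc m)) ?S = ennreal ((q - p) * r ^ m * vol m (unit_ball_rd m))"
    using pq r by (simp add: ennreal_mult'[symmetric] mult.assoc)
qed

lemma measure_cylinder:
  assumes "r > 0" "p \<le> q"
  shows "vol (Suc m) {y \<in> Rd (Suc m). y m \<in> {p..q} \<and> norm_rd m y \<le> r} = (q - p) * r ^ m * vol m (unit_ball_rd m)"
  using emeasure_cylinder(1)[OF assms, of m] assms by (simp add: measure_def)

lemma exp_2_le: "exp 2 \<le> (9 :: real)"
proof -
  have "exp 2 = exp 1 * exp (1 :: real)" by (simp add: exp_add[symmetric])
  also have "\<dots> \<le> 3 * 3" by (intro mult_mono exp_le) auto
  finally show ?thesis by simp
qed

lemma one_minus_inverse_power:
  assumes m: "m \<ge> (2::nat)"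
  shows "1 / 9 \<le> (1 - 1 / real m) ^ m"
proof -
  have "- (1 / real m) - 2 * (1 / real m)\<^sup>2 \<le> ln (1 - 1 / real m)"
    using m by (intro ln_one_minus_pos_lower_bound) auto
  then have "real m * (- (1 / real m) - 2 * (1 / real m)\<^sup>2) \<le> real m * ln (1 - 1 / real m)"
    by (rule mult_left_mono) simp
  moreover have "- 2 \<le> real m * (- (1 / real m) - 2 * (1 / real m)\<^sup>2)"
    using m by (simp add: field_simps power2_eq_square)
  ultimately have "- 2 \<le> real m * ln (1 - 1 / real m)" by linarith
  then have "exp (- 2) \<le> exp (real m * ln (1 - 1 / real m))" by simp
  also have "\<dots> = (1 - 1 / real m) ^ m"
    using m by (simp add: exp_of_nat_mult)
  finally have "exp (- 2) \<le> (1 - 1 / real m) ^ m" .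
  moreover have "1 / 9 \<le> exp (- 2 :: real)" using exp_2_le by (simp add: exp_minus field_simps)
  ultimately show ?thesis by linarith
qed

lemma vol_mono_rd:
  assumes "S \<subseteq> T" "S \<in> sets (lborel_rd d)" "T \<in> sets (lborel_rd d)" "T \<subseteq> {x \<in> Rd d. norm_rd d x \<le> r}"
  shows "vol d S \<le> vol d T"
  using assms emeasure_bounded_finite[OF assms(4)] by (intro measure_mono_fmeasurable fmeasurableI) auto

lemma cylinder_bounded:
  "{y \<in> Rd (Suc m). y m \<in> {p..q} \<and> norm_rd m y \<le> r} \<subseteq> {y \<in> Rd (Suc m). norm_rd (Suc m) y \<le> r + \<bar>p\<bar> + \<bar>q\<bar>}"
proof
  fix y assume y: "y \<in> {y \<in> Rd (Suc m). y m \<in> {p..q} \<and> norm_rd m y \<le> r}"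
  have "norm_rd (Suc m) y \<le> norm_rd m y + \<bar>y m\<bar>"
  proof (rule power2_le_imp_le)
    show "(norm_rd (Suc m) y)\<^sup>2 \<le> (norm_rd m y + \<bar>y m\<bar>)\<^sup>2"
      unfolding norm_rd_Suc_sq power2_sum by simp
  qed simp
  moreover have "p \<le> y m" "y m \<le> q" "norm_rd m y \<le> r" "y \<in> Rd (Suc m)" using y by simp_all
  ultimately show "y \<in> {y \<in> Rd (Suc m). norm_rd (Suc m) y \<le> r + \<bar>p\<bar> + \<bar>q\<bar>}"
    unfolding mem_Collect_eq by linarith
qed

lemma ball_volume_ratio:
  assumes m: "m \<ge> 2"
  shows "vol m (unit_ball_rd m) \<le> 9 * real m * vol (Suc m) (unit_ball_rd (Suc m))"
    and "vol (Suc m) (unit_ball_rd (Suc m)) \<le> 2 * vol m (unit_ball_rd m)"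
proof -
  let ?r = "1 - 1 / real m"
  let ?C = "{y \<in> Rd (Suc m). y m \<in> {0..1 / real m} \<and> norm_rd m y \<le> ?r}"
  have r: "0 < ?r" using m by simp
  have sub: "?C \<subseteq> unit_ball_rd (Suc m)"
  proof
    fix y assume y: "y \<in> ?C"
    have "(norm_rd (Suc m) y)\<^sup>2 \<le> ?r\<^sup>2 + (1 / real m)\<^sup>2"
      unfolding norm_rd_Suc_sq using y by (intro add_mono power_mono) auto
    also have "\<dots> \<le> 1" using m by (simp add: field_simps power2_eq_square)
    finally have "norm_rd (Suc m) y \<le> 1" by (simp add: power_le_one_iff abs_square_le_1)
    then show "y \<in> unit_ball_rd (Suc m)" using y by (simp add: unit_ball_eq)
  qed
  have "1 / real m * (1 / 9) * vol m (unit_ball_rd m) \<le> 1 / real m * ?r ^ m * vol m (unit_ball_rd m)"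
    by (intro mult_right_mono mult_left_mono one_minus_inverse_power[OF m]) auto
  also have "\<dots> = vol (Suc m) ?C" using measure_cylinder[OF r, of 0 "1 / real m" m] by simp
  also have "\<dots> \<le> vol (Suc m) (unit_ball_rd (Suc m))"
    by (rule vol_mono_rd[OF sub emeasure_cylinder(2)[OF r] unit_ball_sets, where r = 1]) (auto simp: unit_ball_eq)
  finally show "vol m (unit_ball_rd m) \<le> 9 * real m * vol (Suc m) (unit_ball_rd (Suc m))"
    using m by (simp add: field_simps)
  let ?D = "{y \<in> Rd (Suc m). y m \<in> {-1..1} \<and> norm_rd m y \<le> 1}"
  have sub': "unit_ball_rd (Suc m) \<subseteq> ?D"
  proof
    fix y assume y: "y \<in> unit_ball_rd (Suc m)"
    then have "norm_rd (Suc m) y \<le> 1" by (simp add: unit_ball_eq)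
    then have "\<bar>y m\<bar> \<le> 1" "norm_rd m y \<le> 1"
      using abs_coord_le_norm[of m "Suc m" y] norm_rd_mono[of m "Suc m" y] by auto
    then show "y \<in> ?D" using y by (simp add: unit_ball_eq abs_le_iff minus_le_iff)
  qed
  have "vol (Suc m) (unit_ball_rd (Suc m)) \<le> vol (Suc m) ?D"
    by (rule vol_mono_rd[OF sub' unit_ball_sets emeasure_cylinder(2) cylinder_bounded]) auto
  also have "\<dots> = 2 * vol m (unit_ball_rd m)"
    using measure_cylinder[of 1 "-1" 1 m] by simp
  finally show "vol (Suc m) (unit_ball_rd (Suc m)) \<le> 2 * vol m (unit_ball_rd m)" .
qed

text \<open>The cone \<open>{y. h |y| \<le> y\<^sub>m}\<close> in the ball is compared with cylinders around the last axis.\<close>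

lemma sphere_tail:
  assumes m: "m \<ge> 2" and h: "0 < h" "h < 1"
  defines "A \<equiv> real (Suc m) / 2 - 1" and "T \<equiv> measure (uniform_sphere (Suc m)) {x \<in> Rd (Suc m). h \<le> x m}"
  shows "T \<le> 18 * (A + 1) * (1 - h\<^sup>2) powr A" and "h / (36 * (A + 1)) * (1 - h\<^sup>2) powr (A + 1) \<le> T"
proof -
  let ?d = "Suc m"
  let ?B = "unit_ball_rd ?d" and ?\<kappa> = "vol ?d (unit_ball_rd ?d)" and ?\<mu> = "vol m (unit_ball_rd m)"
  define r where "r = sqrt (1 - h\<^sup>2)"
  have h2: "0 < 1 - h\<^sup>2" "1 - h\<^sup>2 \<le> 1" using h by (simp_all add: abs_square_less_1)
  have r: "0 < r" "r\<^sup>2 = 1 - h\<^sup>2" using h2 by (auto simp: r_def)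
  have mA: "real m = 2 * A + 1" by (simp add: A_def field_simps)
  have rm: "r ^ m = (1 - h\<^sup>2) powr (A + 1 / 2)"
  proof -
    have r': "r = (1 - h\<^sup>2) powr (1 / 2)" using h2 by (simp add: r_def powr_half_sqrt)
    have "r ^ m = r powr real m" using r by (simp add: powr_realpow)
    also have "\<dots> = (1 - h\<^sup>2) powr (A + 1 / 2)"
      unfolding r' powr_powr mA by (simp add: field_simps)
    finally show ?thesis .
  qed
  define K where "K = {y \<in> ?B. h \<le> y m / norm_rd ?d y}"
  have K: "K \<in> sets (lborel_rd ?d)"
  proof -
    have "{y \<in> space (lborel_rd ?d). norm_rd ?d y \<le> 1 \<and> h \<le> y m / norm_rd ?d y} \<in> sets (lborel_rd ?d)" by measurable
    also have "{y \<in> space (lborel_rd ?d). norm_rd ?d y \<le> 1 \<and> h \<le> y m / norm_rd ?d y} = K"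
      by (auto simp: K_def unit_ball_eq)
    finally show ?thesis .
  qed
  have T: "T = vol ?d K / ?\<kappa>"
  proof -
    have dm: "direction ?d \<in> unif_ball ?d \<rightarrow>\<^sub>M lborel_rd ?d" by measurable
    have S: "{x \<in> Rd ?d. h \<le> x m} \<in> sets (lborel_rd ?d)"
    proof -
      have "{x \<in> space (lborel_rd ?d). h \<le> x m} \<in> sets (lborel_rd ?d)" by measurable
      then show ?thesis by simp
    qed
    have S2: "direction ?d -` {x \<in> Rd ?d. h \<le> x m} \<inter> space (unif_ball ?d) \<in> sets (lborel_rd ?d)"
      using measurable_sets[OF dm S] by simp
    have "T = measure (unif_ball ?d) (direction ?d -` {x \<in> Rd ?d. h \<le> x m} \<inter> space (unif_ball ?d))"
      unfolding T_def uniform_sphere_eq by (rule measure_distr[OF dm S])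
    also have "\<dots> = vol ?d (?B \<inter> (direction ?d -` {x \<in> Rd ?d. h \<le> x m} \<inter> space (unif_ball ?d))) / ?\<kappa>"
      unfolding unif_ball_def
      by (rule measure_uniform_measure)
         (use emeasure_unit_ball_pos[of ?d] emeasure_unit_ball_finite[of ?d] S2 in \<open>auto simp: unif_ball_def\<close>)
    also have "?B \<inter> (direction ?d -` {x \<in> Rd ?d. h \<le> x m} \<inter> space (unif_ball ?d)) = K"
      by (auto simp: K_def direction_def unit_ball_eq)
    finally show ?thesis .
  qed
  have pos: "?\<kappa> > 0" "?\<mu> > 0" by (rule vol_unit_ball_pos)+
  have cone: "h * norm_rd ?d y \<le> y m \<and> norm_rd ?d y > 0" if "y \<in> K" for y
  proof -
    have "norm_rd ?d y \<noteq> 0" using that h by (auto simp: K_def)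
    then have "norm_rd ?d y > 0" by (simp add: order_less_le)
    then show ?thesis using that by (simp add: K_def pos_le_divide_eq)
  qed
  show "T \<le> 18 * (A + 1) * (1 - h\<^sup>2) powr A"
  proof -
    let ?C = "{y \<in> Rd ?d. y m \<in> {0..1} \<and> norm_rd m y \<le> r}"
    have "K \<subseteq> ?C"
    proof
      fix y assume y: "y \<in> K"
      then have B: "y \<in> Rd ?d" "norm_rd ?d y \<le> 1" by (auto simp: K_def unit_ball_eq)
      have c: "h * norm_rd ?d y \<le> y m" "norm_rd ?d y > 0" using cone[OF y] by auto
      have "0 \<le> h * norm_rd ?d y" using h c(2) by simp
      then have ym0: "0 \<le> y m" using c(1) by linarith
      have ym1: "y m \<le> 1" using abs_coord_le_norm[of m ?d y] B(2) by simp
      note ym = ym0 ym1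
      have "(h * norm_rd ?d y)\<^sup>2 \<le> (y m)\<^sup>2" using c h by (intro power_mono) auto
      then have "(norm_rd m y)\<^sup>2 \<le> (1 - h\<^sup>2) * (norm_rd ?d y)\<^sup>2"
        using norm_rd_Suc_sq[where m = m and x = y] by (simp add: power_mult_distrib algebra_simps)
      also have "\<dots> \<le> (1 - h\<^sup>2) * 1" using h2 B by (intro mult_left_mono power_le_one) auto
      finally have "(norm_rd m y)\<^sup>2 \<le> r\<^sup>2" using r by simp
      then have "norm_rd m y \<le> r" by (rule power2_le_imp_le) (use r in simp)
      then show "y \<in> ?C" using B ym by simp
    qed
    then have "vol ?d K \<le> vol ?d ?C"
      by (rule vol_mono_rd[OF _ K emeasure_cylinder(2)[OF r(1)] cylinder_bounded]) simp
    also have "\<dots> = r ^ m * ?\<mu>" using measure_cylinder[OF r(1), of 0 1 m] by simp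
    also have "\<dots> \<le> r ^ m * (9 * real m * ?\<kappa>)"
      using r by (intro mult_left_mono ball_volume_ratio(1)[OF m]) auto
    finally have "T \<le> 9 * real m * r ^ m" unfolding T using pos by (simp add: divide_le_eq mult_ac)
    also have "\<dots> \<le> 18 * (A + 1) * (1 - h\<^sup>2) powr A"
      unfolding rm
    proof (rule mult_mono)
      show "(1 - h\<^sup>2) powr (A + 1 / 2) \<le> (1 - h\<^sup>2) powr A" using h2 by (intro powr_mono') auto
    qed (use m mA in auto)
    finally show ?thesis .
  qed
  show "h / (36 * (A + 1)) * (1 - h\<^sup>2) powr (A + 1) \<le> T"
  proof -
    let ?q = "1 - 1 / real m"
    let ?C = "{y \<in> Rd ?d. y m \<in> {h * ?q..h} \<and> norm_rd m y \<le> ?q * r}"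
    have q: "?q > 0" "?q \<le> 1" using m by auto
    have qr: "?q * r > 0" using q r by simp
    have hq: "h * ?q \<le> h" using h q by (simp add: mult_left_le)
    have "?C \<subseteq> K"
    proof
      fix y assume y: "y \<in> ?C"
      then have y: "y \<in> Rd ?d" "h * ?q \<le> y m" "y m \<le> h" "norm_rd m y \<le> ?q * r" by auto
      have ym: "y m > 0" using y(2) h q by (meson mult_pos_pos order_less_le_trans)
      have "h\<^sup>2 * (norm_rd m y)\<^sup>2 \<le> h\<^sup>2 * (?q * r)\<^sup>2" using y by (intro mult_left_mono power_mono) auto
      also have "\<dots> = r\<^sup>2 * (h * ?q)\<^sup>2" by (simp add: power_mult_distrib)
      also have "\<dots> \<le> r\<^sup>2 * (y m)\<^sup>2" using y h q by (intro mult_left_mono power_mono) auto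
      finally have "(h * norm_rd ?d y)\<^sup>2 \<le> (y m)\<^sup>2"
        unfolding power_mult_distrib norm_rd_Suc_sq r(2) by (simp add: algebra_simps)
      then have c: "h * norm_rd ?d y \<le> y m" by (rule power2_le_imp_le) (use ym in simp)
      then have "h * norm_rd ?d y \<le> h * 1" using y(3) by simp
      then have "norm_rd ?d y \<le> 1" using h by simp
      moreover have "norm_rd ?d y > 0" using ym abs_coord_le_norm[of m ?d y] by simp
      ultimately show "y \<in> K" using y(1) c by (simp add: K_def unit_ball_eq pos_le_divide_eq)
    qed
    then have "vol ?d ?C \<le> vol ?d K"
      by (rule vol_mono_rd[OF _ emeasure_cylinder(2)[OF qr hq] K, where r = 1]) (auto simp: K_def unit_ball_eq)
    moreover have "vol ?d ?C = h / real m * (?q ^ m * r ^ m) * ?\<mu>"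
      unfolding measure_cylinder[OF qr hq] power_mult_distrib by (simp add: right_diff_distrib)
    moreover have "h / real m * (1 / 9 * r ^ m) * ?\<mu> \<le> h / real m * (?q ^ m * r ^ m) * ?\<mu>"
      using h r by (intro mult_right_mono mult_left_mono one_minus_inverse_power[OF m]) auto
    ultimately have "h / (9 * real m) * r ^ m * ?\<mu> \<le> vol ?d K" by simp
    moreover have "?\<kappa> / 2 \<le> ?\<mu>" using ball_volume_ratio(2)[OF m] by simp
    then have "h / (9 * real m) * r ^ m * (?\<kappa> / 2) \<le> h / (9 * real m) * r ^ m * ?\<mu>"
      using h r by (intro mult_left_mono) auto
    ultimately have "h / (9 * real m) * r ^ m * (?\<kappa> / 2) \<le> vol ?d K" by linarith
    then have "h / (18 * real m) * r ^ m \<le> T" unfolding T using pos by (simp add: le_divide_eq mult_ac)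
    moreover have "h / (36 * (A + 1)) * (1 - h\<^sup>2) powr (A + 1) \<le> h / (18 * real m) * r ^ m"
      unfolding rm
    proof (rule mult_mono)
      show "(1 - h\<^sup>2) powr (A + 1) \<le> (1 - h\<^sup>2) powr (A + 1 / 2)" using h2 by (intro powr_mono') auto
      show "h / (36 * (A + 1)) \<le> h / (18 * real m)"
        using h m mA by (intro divide_left_mono mult_pos_pos) auto
    qed (use h m in auto)
    ultimately show ?thesis by linarith
  qed
qed

lemma beta_slice:
  fixes \<beta> C t :: real and m :: nat
  defines "f \<equiv> \<lambda>x. if norm_rd (Suc m) x < 1 then C * (1 - (norm_rd (Suc m) x)\<^sup>2) powr \<beta> else 0"
    and "g \<equiv> \<lambda>x. if norm_rd m x < 1 then C * (1 - (norm_rd m x)\<^sup>2) powr \<beta> else 0"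
  shows "(\<integral>\<^sup>+x. ennreal (f (x(m := t))) \<partial>lborel_rd m) =
    (if \<bar>t\<bar> < 1 then ennreal ((1 - t\<^sup>2) powr (\<beta> + real m / 2)) else 0) * (\<integral>\<^sup>+x. ennreal (g x) \<partial>lborel_rd m)"
proof (cases "\<bar>t\<bar> < 1")
  case False
  have "f (x(m := t)) = 0" for x
  proof -
    have "1 \<le> norm_rd (Suc m) (x(m := t))"
      using False abs_coord_le_norm[of m "Suc m" "x(m := t)"] by simp
    then show ?thesis by (simp add: f_def)
  qed
  then show ?thesis using False by simp
next
  case True
  define r where "r = sqrt (1 - t\<^sup>2)"
  have t2: "1 - t\<^sup>2 > 0" using True by (simp add: abs_square_less_1)
  have r: "r > 0" "r\<^sup>2 = 1 - t\<^sup>2" using t2 by (auto simp: r_def)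
  have fm: "f \<in> borel_measurable (lborel_rd (Suc m))" unfolding f_def by measurable
  have "(\<lambda>x. x(m := t)) \<in> lborel_rd m \<rightarrow>\<^sub>M lborel_rd (Suc m)"
    by (rule measurable_fun_upd[where J = "{..<m}"]) (auto simp: lessThan_Suc)
  then have m1: "(\<lambda>x. ennreal (f (x(m := t)))) \<in> borel_measurable (lborel_rd m)"
    using fm by (intro measurable_compose[OF _ measurable_ennreal] measurable_compose[OF _ fm])
  have scal: "ennreal (f ((\<lambda>i\<in>{..<m}. 0 + r * x i)(m := t))) = ennreal ((1 - t\<^sup>2) powr \<beta>) * ennreal (g x)" for x
  proof -
    let ?y = "(\<lambda>i\<in>{..<m}. 0 + r * x i)(m := t)"
    have "norm_rd m ?y = r * norm_rd m x"
      unfolding norm_rd_upd L2_set_restrict using norm_scale[where d = m and c = r and x = x] r by simp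
    then have N: "(norm_rd (Suc m) ?y)\<^sup>2 = r\<^sup>2 * (norm_rd m x)\<^sup>2 + t\<^sup>2"
      unfolding norm_rd_Suc_sq by (simp add: power_mult_distrib)
    have one: "1 - (norm_rd (Suc m) ?y)\<^sup>2 = (1 - t\<^sup>2) * (1 - (norm_rd m x)\<^sup>2)"
      unfolding N r(2) by (simp add: algebra_simps)
    have sq: "z < 1 \<longleftrightarrow> 0 < 1 - z\<^sup>2" if "z \<ge> 0" for z :: real
      using that by (simp add: abs_square_less_1)
    have lt: "norm_rd (Suc m) ?y < 1 \<longleftrightarrow> norm_rd m x < 1"
      unfolding sq[OF L2_set_nonneg] one using t2 by (simp add: zero_less_mult_iff)
    show ?thesis
    proof (cases "norm_rd m x < 1")
      case True
      have "f ?y = (1 - t\<^sup>2) powr \<beta> * g x"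
      proof -
        have "0 \<le> 1 - (norm_rd m x)\<^sup>2" using True sq[OF L2_set_nonneg, of x "{..<m}"] by simp
        then show ?thesis
          using True lt unfolding f_def g_def one by (simp add: powr_mult t2 less_imp_le)
      qed
      then show ?thesis by (simp add: ennreal_mult')
    next
      case False
      then show ?thesis using lt by (simp add: f_def g_def)
    qed
  qed
  have gm: "g \<in> borel_measurable (lborel_rd m)" unfolding g_def by measurable
  have "(\<integral>\<^sup>+x. ennreal (f (x(m := t))) \<partial>lborel_rd m) =
      ennreal (\<bar>r\<bar> ^ m) * (\<integral>\<^sup>+x. ennreal (f ((\<lambda>i\<in>{..<m}. 0 + r * x i)(m := t))) \<partial>lborel_rd m)"
    by (rule nn_integral_affine_rd[OF _ m1]) (use r in simp)
  also have "\<dots> = ennreal (\<bar>r\<bar> ^ m) * (ennreal ((1 - t\<^sup>2) powr \<beta>) * (\<integral>\<^sup>+x. ennreal (g x) \<partial>lborel_rd m))"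
    unfolding scal using gm by (subst nn_integral_cmult) auto
  also have "\<dots> = ennreal (\<bar>r\<bar> ^ m * (1 - t\<^sup>2) powr \<beta>) * (\<integral>\<^sup>+x. ennreal (g x) \<partial>lborel_rd m)"
    by (simp add: ennreal_mult' mult.assoc)
  also have "\<bar>r\<bar> ^ m * (1 - t\<^sup>2) powr \<beta> = (1 - t\<^sup>2) powr (\<beta> + real m / 2)"
  proof -
    have "\<bar>r\<bar> ^ m = r powr real m" using r by (simp add: powr_realpow)
    also have "\<dots> = (1 - t\<^sup>2) powr (1 / 2 * real m)"
      unfolding powr_powr[symmetric] using t2 by (simp add: r_def powr_half_sqrt)
    finally show ?thesis by (simp add: powr_add)
  qed
  finally show ?thesis unfolding if_P[OF True] .
qed

lemma one_minus_powr_lower: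
  assumes a: "a > (0::real)"
  shows "1 / 3 \<le> (a / (a + 1)) powr a"
proof -
  have "ln (1 + 1 / a) \<le> 1 / a" using a by (intro ln_add_one_self_le_self) simp
  then have "a * ln (1 + 1 / a) \<le> a * (1 / a)" using a by (intro mult_left_mono) auto
  then have le: "a * ln (1 + 1 / a) \<le> 1" using a by simp
  have "1 + 1 / a = (a + 1) / a" using a by (simp add: field_simps)
  then have "ln (a / (a + 1)) = - ln (1 + 1 / a)" using a by (simp add: ln_div)
  then have "(a / (a + 1)) powr a = exp (- (a * ln (1 + 1 / a)))" using a by (simp add: powr_def)
  also have "\<dots> \<ge> exp (- 1)" using le by simp
  finally have "exp (- 1) \<le> (a / (a + 1)) powr a" .
  moreover have "1 / 3 \<le> exp (- 1 :: real)" using exp_le by (simp add: exp_minus field_simps)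
  ultimately show ?thesis by linarith
qed

lemma beta_weight_integral_bounds:
  fixes a :: real
  assumes a: "a \<ge> 1 / 2"
  defines "\<phi> \<equiv> \<lambda>t::real. if \<bar>t\<bar> < 1 then ennreal ((1 - t\<^sup>2) powr a) else 0"
  shows "ennreal (1 / (4 * (a + 1))) \<le> (\<integral>\<^sup>+t. \<phi> t \<partial>lborel)" "(\<integral>\<^sup>+t. \<phi> t \<partial>lborel) \<le> ennreal 2"
    and "0 < h \<Longrightarrow> h < 1 \<Longrightarrow> (\<integral>\<^sup>+t. \<phi> t * indicator {h..} t \<partial>lborel) \<le> ennreal ((1 - h\<^sup>2) powr a * (1 - h))"
    and "0 < h \<Longrightarrow> h < 1 \<Longrightarrow>
      ennreal ((1 - h\<^sup>2) powr (a + 1) / (9 * (a + 1))) \<le> (\<integral>\<^sup>+t. \<phi> t * indicator {h..} t \<partial>lborel)"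
proof -
  have mono: "(1 - s\<^sup>2) powr a \<le> (1 - t\<^sup>2) powr a" if "\<bar>t\<bar> \<le> \<bar>s\<bar>" "\<bar>s\<bar> \<le> 1" for s t :: real
  proof -
    have "t\<^sup>2 \<le> s\<^sup>2" using that(1) by (simp add: abs_le_square_iff)
    moreover have "s\<^sup>2 \<le> 1" using that(2) by (simp add: abs_square_le_1)
    ultimately show ?thesis using a by (intro powr_mono2) auto
  qed
  let ?\<delta> = "1 / (2 * (a + 1))"
  have \<delta>: "0 < ?\<delta>" "?\<delta> \<le> 1 / 3" using a by (auto simp: field_simps)
  have half: "1 / 2 \<le> (1 - ?\<delta>\<^sup>2) powr a"
  proof -
    let ?y = "?\<delta>\<^sup>2"
    have "?\<delta>\<^sup>2 \<le> (1 / 3)\<^sup>2" using \<delta> by (intro power_mono) auto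
    then have y: "0 \<le> ?y" "?y \<le> 1 / 2" by (auto simp: power2_eq_square)
    have "- ?y - 2 * ?y\<^sup>2 \<le> ln (1 - ?y)" using y by (intro ln_one_minus_pos_lower_bound) auto
    moreover have "2 * ?y\<^sup>2 \<le> ?y"
      unfolding power2_eq_square[of ?y] using mult_right_mono[OF y(2) y(1)] by linarith
    ultimately have "- 2 * ?y \<le> ln (1 - ?y)" by linarith
    then have "a * (- 2 * ?y) \<le> a * ln (1 - ?y)" using a by (intro mult_left_mono) auto
    moreover have "- 1 / 2 \<le> a * (- 2 * ?y)"
    proof -
      have "a * (4 * ?y) \<le> 1" using a by (simp add: power2_eq_square divide_simps) (simp add: algebra_simps)
      then show ?thesis by simp
    qed
    ultimately have "exp (- 1 / 2) \<le> exp (a * ln (1 - ?y))" by simp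
    also have "\<dots> = (1 - ?y) powr a" using y by (simp add: powr_def)
    finally have "exp (- 1 / 2) \<le> (1 - ?y) powr a" .
    moreover have "1 / 2 \<le> exp (- 1 / 2 :: real)" using exp_ge_add_one_self[of "- 1 / 2 :: real"] by simp
    ultimately show ?thesis by linarith
  qed
  have "ennreal (1 / (4 * (a + 1))) = ennreal (1 / 2 * ?\<delta>)" by simp
  also have "\<dots> = ennreal (1 / 2) * ennreal ?\<delta>" by (rule ennreal_mult') simp
  also have "\<dots> = (\<integral>\<^sup>+t. ennreal (1 / 2) * indicator {0..?\<delta>} t \<partial>lborel)"
    using \<delta>(1) by (subst nn_integral_cmult_indicator) simp_all
  also have "\<dots> \<le> (\<integral>\<^sup>+t. \<phi> t \<partial>lborel)"
  proof (rule nn_integral_mono)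
    fix t :: real
    show "ennreal (1 / 2) * indicator {0..?\<delta>} t \<le> \<phi> t"
    proof (cases "t \<in> {0..?\<delta>}")
      case True
      then have "t \<le> ?\<delta>" "0 \<le> t" by simp_all
      then have "t \<le> 1 / 3" "0 \<le> t" using \<delta>(2) by linarith+
      then have \<phi>t: "\<phi> t = ennreal ((1 - t\<^sup>2) powr a)" by (simp add: \<phi>_def)
      have "1 / 2 \<le> (1 - t\<^sup>2) powr a"
        by (rule order_trans[OF half mono]) (use True \<delta> in auto)
      then show ?thesis unfolding \<phi>t indicator_simps(1)[OF True] mult_1_right by (rule ennreal_leI)
    qed simp
  qed
  finally show "ennreal (1 / (4 * (a + 1))) \<le> (\<integral>\<^sup>+t. \<phi> t \<partial>lborel)" .
  have le1: "(1 - t\<^sup>2) powr a \<le> 1" if "\<bar>t\<bar> < 1" for t :: real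
    using mono[of 0 t] that by simp
  have "(\<integral>\<^sup>+t. \<phi> t \<partial>lborel) \<le> (\<integral>\<^sup>+t. indicator {-1..1 :: real} t \<partial>lborel)"
    by (rule nn_integral_mono) (use le1 in \<open>auto simp: \<phi>_def indicator_def abs_less_iff\<close>)
  also have "\<dots> = ennreal 2" by simp
  finally show "(\<integral>\<^sup>+t. \<phi> t \<partial>lborel) \<le> ennreal 2" .
  assume h: "0 < h" "h < 1"
  have "(\<integral>\<^sup>+t. \<phi> t * indicator {h..} t \<partial>lborel) \<le> (\<integral>\<^sup>+t. ennreal ((1 - h\<^sup>2) powr a) * indicator {h..1} t \<partial>lborel)"
  proof (rule nn_integral_mono)
    fix t :: real
    show "\<phi> t * indicator {h..} t \<le> ennreal ((1 - h\<^sup>2) powr a) * indicator {h..1} t"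
    proof (cases "h \<le> t \<and> t < 1")
      case True
      then have "(1 - t\<^sup>2) powr a \<le> (1 - h\<^sup>2) powr a" using h by (intro mono) auto
      then show ?thesis using True h by (simp add: \<phi>_def ennreal_leI)
    next
      case False
      then show ?thesis using h by (auto simp: \<phi>_def indicator_def)
    qed
  qed
  also have "\<dots> = ennreal ((1 - h\<^sup>2) powr a * (1 - h))"
    using h by (simp add: nn_integral_cmult_indicator ennreal_mult')
  finally show "(\<integral>\<^sup>+t. \<phi> t * indicator {h..} t \<partial>lborel) \<le> ennreal ((1 - h\<^sup>2) powr a * (1 - h))" .
  have h2: "0 < 1 - h\<^sup>2" "1 - h\<^sup>2 \<le> 1" using h by (simp_all add: abs_square_less_1)
  define \<eta> where "\<eta> = (1 - h\<^sup>2) / (3 * (a + 1))"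
  have "1 \<le> 3 * (a + 1)" using a by simp
  with h2(2) have "1 - h\<^sup>2 \<le> 3 * (a + 1)" by (rule order_trans)
  then have \<eta>: "0 < \<eta>" "\<eta> \<le> 1" using h2(1) a by (simp_all add: \<eta>_def)
  have key: "(1 - h\<^sup>2) * (a / (a + 1)) \<le> 1 - (h + \<eta>)\<^sup>2"
  proof -
    have "2 * h * \<eta> + \<eta>\<^sup>2 \<le> 2 * 1 * \<eta> + 1 * \<eta>"
      unfolding power2_eq_square using \<eta> h by (intro add_mono mult_right_mono) auto
    also have "\<dots> = (1 - h\<^sup>2) / (a + 1)"
    proof -
      have "2 * 1 * (D / (3 * c)) + 1 * (D / (3 * c)) = D / c" for D c :: real by simp
      then show ?thesis unfolding \<eta>_def .
    qed
    finally have "(1 - h\<^sup>2) - (1 - h\<^sup>2) / (a + 1) \<le> 1 - (h + \<eta>)\<^sup>2" by (simp add: power2_sum)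
    moreover have "(1 - h\<^sup>2) - (1 - h\<^sup>2) / (a + 1) = (1 - h\<^sup>2) * (a / (a + 1))" using a by (simp add: field_simps)
    ultimately show ?thesis by simp
  qed
  have "0 < (1 - h\<^sup>2) * (a / (a + 1))" using h2 a by simp
  then have "(h + \<eta>)\<^sup>2 < 1" using key by linarith
  then have h\<eta>: "h + \<eta> < 1" using h \<eta> by (simp add: abs_square_less_1)
  have "(1 - h\<^sup>2) powr a * (1 / 3) \<le> (1 - h\<^sup>2) powr a * (a / (a + 1)) powr a"
    using a by (intro mult_left_mono one_minus_powr_lower) auto
  also have "\<dots> = ((1 - h\<^sup>2) * (a / (a + 1))) powr a"
    by (rule powr_mult[symmetric])
  also have "\<dots> \<le> (1 - (h + \<eta>)\<^sup>2) powr a" using key a h2 by (intro powr_mono2) auto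
  finally have low: "(1 - h\<^sup>2) powr a / 3 \<le> (1 - (h + \<eta>)\<^sup>2) powr a" by simp
  have "(1 - h\<^sup>2) powr (a + 1) / (9 * (a + 1)) = (1 - h\<^sup>2) powr a / 3 * \<eta>"
    using h2 a by (simp add: powr_add \<eta>_def field_simps)
  then have "ennreal ((1 - h\<^sup>2) powr (a + 1) / (9 * (a + 1))) = ennreal ((1 - h\<^sup>2) powr a / 3 * \<eta>)"
    by (rule arg_cong)
  also have "\<dots> = ennreal ((1 - h\<^sup>2) powr a / 3) * ennreal \<eta>"
    using \<eta> by (intro ennreal_mult'') simp
  also have "\<dots> = (\<integral>\<^sup>+t. ennreal ((1 - h\<^sup>2) powr a / 3) * indicator {h..h + \<eta>} t \<partial>lborel)"
    using \<eta> by (simp add: nn_integral_cmult_indicator)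
  also have "\<dots> \<le> (\<integral>\<^sup>+t. \<phi> t * indicator {h..} t \<partial>lborel)"
  proof (rule nn_integral_mono)
    fix t :: real
    show "ennreal ((1 - h\<^sup>2) powr a / 3) * indicator {h..h + \<eta>} t \<le> \<phi> t * indicator {h..} t"
    proof (cases "t \<in> {h..h + \<eta>}")
      case True
      then have "(1 - h\<^sup>2) powr a / 3 \<le> (1 - t\<^sup>2) powr a"
        using h h\<eta> by (intro order_trans[OF low mono]) auto
      then show ?thesis using True h h\<eta> by (simp add: \<phi>_def ennreal_leI)
    qed simp
  qed
  finally show "ennreal ((1 - h\<^sup>2) powr (a + 1) / (9 * (a + 1))) \<le> (\<integral>\<^sup>+t. \<phi> t * indicator {h..} t \<partial>lborel)" .
qed

lemma beta_density_tail:
  assumes \<beta>: "\<beta> \<noteq> -1" and P: "prob_space (beta_distribution (Suc m) \<beta>)" and h: "0 < h" "h < 1"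
  defines "A \<equiv> real (Suc m) / 2 + \<beta>" and "T \<equiv> measure (beta_distribution (Suc m) \<beta>) {x \<in> Rd (Suc m). h \<le> x m}"
  assumes A: "A \<ge> 1"
  shows "T \<le> 18 * (A + 1) * (1 - h\<^sup>2) powr A" and "h / (36 * (A + 1)) * (1 - h\<^sup>2) powr (A + 1) \<le> T"
proof -
  let ?d = "Suc m" and ?a = "A - 1 / 2"
  let ?\<nu> = "beta_distribution ?d \<beta>"
  interpret prob_space ?\<nu> by (rule P)
  define C where "C = Gamma (real ?d / 2 + \<beta> + 1) / (pi powr (real ?d / 2) * Gamma (\<beta> + 1))"
  define g where "g x = (if norm_rd m x < 1 then C * (1 - (norm_rd m x)\<^sup>2) powr \<beta> else 0)" for x
  define I where "I = (\<integral>\<^sup>+x. ennreal (g x) \<partial>lborel_rd m)"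
  define \<phi> where "\<phi> = (\<lambda>t::real. if \<bar>t\<bar> < 1 then ennreal ((1 - t\<^sup>2) powr ?a) else 0)"
  have a: "?a \<ge> 1 / 2" using A by simp
  have b3: "(\<integral>\<^sup>+t. \<phi> t * indicator {h..} t \<partial>lborel) \<le> ennreal ((1 - h\<^sup>2) powr ?a * (1 - h))"
    using beta_weight_integral_bounds(3)[OF a h] unfolding \<phi>_def .
  have b4: "ennreal ((1 - h\<^sup>2) powr (?a + 1) / (9 * (?a + 1))) \<le> (\<integral>\<^sup>+t. \<phi> t * indicator {h..} t \<partial>lborel)"
    using beta_weight_integral_bounds(4)[OF a h] unfolding \<phi>_def .
  have \<nu>: "?\<nu> = density (lborel_rd ?d) (\<lambda>x. ennreal (beta_density ?d \<beta> x))"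
    using \<beta> by (simp add: beta_distribution_def)
  have \<phi>m [measurable]: "\<phi> \<in> borel_measurable borel" unfolding \<phi>_def by measurable
  have slice: "(\<integral>\<^sup>+x. ennreal (beta_density ?d \<beta> (x(m := t))) \<partial>lborel_rd m) = \<phi> t * I" for t
  proof -
    have "\<beta> + real m / 2 = ?a" by (simp add: A_def field_simps)
    then show ?thesis
      using beta_slice[where m = m and C = C and \<beta> = \<beta> and t = t] unfolding beta_density_def C_def[symmetric] I_def g_def \<phi>_def by simp
  qed
  have emeas: "emeasure ?\<nu> {x \<in> Rd ?d. x m \<in> S} = (\<integral>\<^sup>+t. \<phi> t * indicator S t \<partial>lborel) * I"
    if S [measurable]: "S \<in> sets borel" for S
  proof -
    have D: "{x \<in> Rd ?d. x m \<in> S} \<in> sets (lborel_rd ?d)"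
    proof -
      have "{x \<in> space (lborel_rd ?d). x m \<in> S} \<in> sets (lborel_rd ?d)" by measurable
      then show ?thesis by simp
    qed
    have "emeasure ?\<nu> {x \<in> Rd ?d. x m \<in> S} =
        (\<integral>\<^sup>+x. ennreal (beta_density ?d \<beta> x) * indicator {x \<in> Rd ?d. x m \<in> S} x \<partial>lborel_rd ?d)"
      unfolding \<nu> by (rule emeasure_density[OF _ D]) measurable
    also have "\<dots> = (\<integral>\<^sup>+x. ennreal (beta_density ?d \<beta> x) * indicator S (x m) \<partial>lborel_rd ?d)"
      by (intro nn_integral_cong) (simp add: indicator_def)
    also have "\<dots> = (\<integral>\<^sup>+t. \<integral>\<^sup>+x. ennreal (beta_density ?d \<beta> (x(m := t))) * indicator S t \<partial>lborel_rd m \<partial>lborel)"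
    proof -
      have "(\<lambda>x. ennreal (beta_density ?d \<beta> x) * indicator S (x m)) \<in> borel_measurable (lborel_rd ?d)" by measurable
      then show ?thesis
        unfolding lessThan_Suc by (subst lborel_prod.product_nn_integral_insert_rev) auto
    qed
    also have "\<dots> = (\<integral>\<^sup>+t. \<phi> t * indicator S t * I \<partial>lborel)"
    proof (rule nn_integral_cong)
      fix t :: real
      have "(\<integral>\<^sup>+x. ennreal (beta_density ?d \<beta> (x(m := t))) * indicator S t \<partial>lborel_rd m) =
          (\<integral>\<^sup>+x. ennreal (beta_density ?d \<beta> (x(m := t))) \<partial>lborel_rd m) * indicator S t"
        by (cases "t \<in> S") simp_all
      then show "(\<integral>\<^sup>+x. ennreal (beta_density ?d \<beta> (x(m := t))) * indicator S t \<partial>lborel_rd m) = \<phi> t * indicator S t * I"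
        unfolding slice by (simp add: mult_ac)
    qed
    also have "\<dots> = (\<integral>\<^sup>+t. \<phi> t * indicator S t \<partial>lborel) * I" 
      by (rule nn_integral_multc) (intro borel_measurable_times_ennreal borel_measurable_indicator, use \<phi>m S in auto)
    finally show ?thesis .
  qed
  define J where "J = (\<integral>\<^sup>+t. \<phi> t \<partial>lborel)"
  have "space ?\<nu> = Rd ?d" using sets_eq_imp_space_eq[OF sets_beta_distribution] by simp
  then have JI: "J * I = 1" using emeas[of UNIV] emeasure_space_1 by (simp add: J_def)
  have Jlow: "ennreal (1 / (4 * (?a + 1))) \<le> J" and Jup: "J \<le> ennreal 2" unfolding J_def \<phi>_def by (rule beta_weight_integral_bounds[OF a])+
  have a4: "0 < 1 / (4 * (?a + 1))" using A by simp
  have "J < \<infinity>" using Jup ennreal_less_top[of 2] by (simp add: order_le_less_trans)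
  then obtain j where j: "J = ennreal j" "j \<ge> 0" by (cases J) auto
  have "1 / (4 * (?a + 1)) \<le> j" using Jlow unfolding j(1) ennreal_le_iff[OF j(2)] .
  moreover have "j \<le> 2" using Jup unfolding j(1) by (subst (asm) ennreal_le_iff) simp_all
  ultimately have jb: "1 / (4 * (?a + 1)) \<le> j" "j \<le> 2" by blast+
  have j0: "j > 0" using jb(1) a4 by linarith
  have "I \<noteq> \<infinity>"
  proof
    assume "I = \<infinity>"
    then have "J * I = \<infinity>" using j j0 by (simp add: ennreal_mult_eq_top_iff)
    then show False using JI by simp
  qed
  then obtain i where i: "I = ennreal i" "i \<ge> 0" by (cases I) auto
  have "ennreal (j * i) = 1" using JI i j by (simp add: ennreal_mult)
  then have ji: "j * i = 1" using i j by (simp add: ennreal_eq_1)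
  have i_eq: "i = 1 / j" using ji j0 by (simp add: field_simps)
  have ib: "i \<le> 4 * (?a + 1)" "1 / 2 \<le> i"
    using jb j0 A unfolding i_eq by (simp_all add: field_simps)
  have T: "ennreal T = (\<integral>\<^sup>+t. \<phi> t * indicator {h..} t \<partial>lborel) * ennreal i"
    using emeas[of "{h..}"] unfolding T_def emeasure_eq_measure[symmetric] i(1) by simp
  have h2: "0 < 1 - h\<^sup>2" "1 - h\<^sup>2 \<le> 1" using h by (simp_all add: abs_square_less_1)
  have "ennreal T \<le> ennreal ((1 - h\<^sup>2) powr ?a * (1 - h)) * ennreal i"
    unfolding T by (rule mult_right_mono[OF b3]) simp
  also have "\<dots> = ennreal ((1 - h\<^sup>2) powr ?a * (1 - h) * i)"
    using i by (intro ennreal_mult''[symmetric])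
  finally have "T \<le> (1 - h\<^sup>2) powr ?a * (1 - h) * i"
    using h i by (subst (asm) ennreal_le_iff) auto
  also have "\<dots> \<le> (1 - h\<^sup>2) powr ?a * (1 - h\<^sup>2) powr (1 / 2) * (18 * (A + 1))"
  proof (intro mult_mono)
    have "1 - h \<le> 1 - h\<^sup>2" using h by (simp add: power2_eq_square mult_left_le)
    also have "1 - h\<^sup>2 = (1 - h\<^sup>2) powr 1" using h2 by simp
    also have "\<dots> \<le> (1 - h\<^sup>2) powr (1 / 2)" using h2 by (intro powr_mono') auto
    finally show "1 - h \<le> (1 - h\<^sup>2) powr (1 / 2)" .
    show "i \<le> 18 * (A + 1)" using ib A by simp
  qed (use h i in auto)
  also have "\<dots> = 18 * (A + 1) * (1 - h\<^sup>2) powr A" by (simp add: powr_add[symmetric])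
  finally show "T \<le> 18 * (A + 1) * (1 - h\<^sup>2) powr A" .
  let ?l = "(1 - h\<^sup>2) powr (?a + 1) / (9 * (?a + 1))"
  have l0: "?l \<ge> 0" using A by simp
  have "ennreal (?l * i) = ennreal ?l * ennreal i" using i by (intro ennreal_mult'')
  also have "\<dots> \<le> ennreal T" unfolding T by (rule mult_right_mono[OF b4]) simp
  finally have "?l * i \<le> T" by (subst (asm) ennreal_le_iff) (auto simp: T_def)
  moreover have "h / (36 * (A + 1)) * (1 - h\<^sup>2) powr (A + 1) \<le> ?l * i"
  proof -
    have "h / (36 * (A + 1)) * (1 - h\<^sup>2) powr (A + 1) \<le> 1 / (18 * (?a + 1)) * (1 - h\<^sup>2) powr (?a + 1)"
    proof (rule mult_mono)
      show "(1 - h\<^sup>2) powr (A + 1) \<le> (1 - h\<^sup>2) powr (?a + 1)" using h2 by (intro powr_mono') auto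
      have "h / (36 * (A + 1)) \<le> 1 / (36 * (A + 1))" using h A by (intro divide_right_mono) auto
      also have "\<dots> \<le> 1 / (18 * (?a + 1))" using A by (intro divide_left_mono mult_pos_pos) auto
      finally show "h / (36 * (A + 1)) \<le> 1 / (18 * (?a + 1))" .
    qed (use A in auto)
    also have "\<dots> = ?l * (1 / 2)" by simp
    also have "\<dots> \<le> ?l * i" using ib l0 by (intro mult_left_mono) auto
    finally show ?thesis .
  qed
  ultimately show "h / (36 * (A + 1)) * (1 - h\<^sup>2) powr (A + 1) \<le> T" by linarith
qed

lemma beta_tail:
  assumes P: "prob_space (beta_distribution d \<beta>)" and h: "0 < h" "h < 1" and d: "d \<ge> 4" and \<beta>: "\<beta> \<ge> -1"
  defines "A \<equiv> real d / 2 + \<beta>" and "T \<equiv> measure (beta_distribution d \<beta>) {x \<in> Rd d. h \<le> x (d - 1)}"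
  shows "T \<le> 18 * (A + 1) * (1 - h\<^sup>2) powr A" and "h / (36 * (A + 1)) * (1 - h\<^sup>2) powr (A + 1) \<le> T"
proof -
  obtain m where m: "d = Suc m" "m \<ge> 3" using d by (cases d) auto
  have A: "A \<ge> 1" using d \<beta> by (simp add: A_def)
  show "T \<le> 18 * (A + 1) * (1 - h\<^sup>2) powr A"
    using sphere_tail(1)[of m h] beta_density_tail(1)[of \<beta> m h] P h m A
    by (cases "\<beta> = -1") (auto simp: A_def T_def beta_distribution_def)
  show "h / (36 * (A + 1)) * (1 - h\<^sup>2) powr (A + 1) \<le> T"
    using sphere_tail(2)[of m h] beta_density_tail(2)[of \<beta> m h] P h m A
    by (cases "\<beta> = -1") (auto simp: A_def T_def beta_distribution_def)
qed

section \<open>The limit\<close>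

lemma beta_polytope_ratio:
  assumes "prob_space M" and indep: "prob_space.indep_vars M (\<lambda>_. lborel_rd d) X {..<n}"
    and distr: "\<And>i. i < n \<Longrightarrow> distr M (lborel_rd d) (X i) = beta_distribution d \<beta>"
    and n: "n > 0" and d: "d \<ge> 1" and k: "k \<le> d"
  shows "symmetric_sample d n (beta_distribution d \<beta>)"
    and "(\<integral>\<omega>. intrinsic_volume d k (convex_rd d hull ((\<lambda>i. X i \<omega>) ` {..<n})) \<partial>M) / intrinsic_volume d k (unit_ball_rd d) =
      (\<integral>x. vol k (pts_hull k n x) \<partial>(\<Pi>\<^sub>M j\<in>{..<n}. beta_distribution d \<beta>)) / vol k (unit_ball_rd k)"
proof -
  interpret M: prob_space M by fact
  let ?\<nu> = "beta_distribution d \<beta>" and ?L = "\<Pi>\<^sub>M i\<in>{..<n}. lborel_rd d"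
  have rv: "X i \<in> M \<rightarrow>\<^sub>M lborel_rd d" if "i < n" for i
    using indep that unfolding M.indep_vars_def by blast
  have "prob_space ?\<nu>" using M.prob_space_distr[OF rv[OF n]] distr[OF n] by simp
  then show sym: "symmetric_sample d n ?\<nu>" using n d by (rule symmetric_sample_beta)
  interpret symmetric_sample d n ?\<nu> by (rule sym)
  have "{..<n} \<noteq> {}" using n by blast
  then have "distr M ?L (\<lambda>\<omega>. \<lambda>i\<in>{..<n}. X i \<omega>) = (\<Pi>\<^sub>M i\<in>{..<n}. distr M (lborel_rd d) (X i))"
    using M.indep_vars_iff_distr_eq_PiM'[of "{..<n}" X "\<lambda>_. lborel_rd d"] rv indep by simp
  also have "\<dots> = Q" by (intro PiM_cong) (simp_all add: distr)
  finally have Q: "distr M ?L (\<lambda>\<omega>. \<lambda>i\<in>{..<n}. X i \<omega>) = Q" .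
  have sets: "sets Q = sets ?L" by (intro sets_PiM_cong) (simp_all add: sets_\<nu>)
  have f: "(\<lambda>x. intrinsic_volume d k (pts_hull d n x)) \<in> borel_measurable ?L"
    using measurable_intrinsic_volume[OF k] by (simp cong: measurable_cong_sets add: sets)
  have g: "(\<lambda>\<omega>. \<lambda>i\<in>{..<n}. X i \<omega>) \<in> M \<rightarrow>\<^sub>M ?L" by (intro measurable_restrict rv) simp
  have hull: "convex_rd d hull ((\<lambda>i. X i \<omega>) ` {..<n}) = pts_hull d n (\<lambda>i\<in>{..<n}. X i \<omega>)" if \<omega>: "\<omega> \<in> space M" for \<omega>
  proof -
    have "convex_rd d hull ((\<lambda>i. X i \<omega>) ` {..<n}) = pts_hull d n (\<lambda>i. X i \<omega>)"
    proof (rule convex_hull_eq_pts_hull[OF n])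
      show "X j \<omega> \<in> Rd d" if "j < n" for j using measurable_space[OF rv[OF that] \<omega>] by simp
    qed
    also have "\<dots> = pts_hull d n (\<lambda>i\<in>{..<n}. X i \<omega>)" by (rule pts_hull_cong) simp
    finally show ?thesis .
  qed
  have "(\<integral>\<omega>. intrinsic_volume d k (convex_rd d hull ((\<lambda>i. X i \<omega>) ` {..<n})) \<partial>M) =
      (\<integral>\<omega>. intrinsic_volume d k (pts_hull d n (\<lambda>i\<in>{..<n}. X i \<omega>)) \<partial>M)"
    by (intro Bochner_Integration.integral_cong refl) (simp only: hull)
  also have "\<dots> = (\<integral>x. intrinsic_volume d k (pts_hull d n x) \<partial>Q)"
    unfolding Q[symmetric] by (rule integral_distr[OF g f, symmetric])
  finally show "(\<integral>\<omega>. intrinsic_volume d k (convex_rd d hull ((\<lambda>i. X i \<omega>) ` {..<n})) \<partial>M) / intrinsic_volume d k (unit_ball_rd d) =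
      (\<integral>x. vol k (pts_hull k n x) \<partial>Q) / vol k (unit_ball_rd k)"
    using mean_intrinsic_volume_ratio[OF k] by simp
qed

lemma beta_polytope_bounds:
  assumes sym: "symmetric_sample d n (beta_distribution d \<beta>)" and d4: "d \<ge> 4" and k: "k \<le> d" and \<beta>: "\<beta> \<ge> -1"
  defines "A \<equiv> real d / 2 + \<beta>"
    and "v \<equiv> (\<integral>x. vol k (pts_hull k n x) \<partial>(\<Pi>\<^sub>M j\<in>{..<n}. beta_distribution d \<beta>)) / vol k (unit_ball_rd k)"
  shows "0 < h \<Longrightarrow> h < 1 \<Longrightarrow> v \<le> h ^ k + real n * (18 * (A + 1) * (1 - h\<^sup>2) powr A)"
    and "0 < h \<Longrightarrow> h + real k / real N \<le> h' \<Longrightarrow> h' < 1 \<Longrightarrow> N \<ge> 1 \<Longrightarrow>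
      h ^ k * (1 - (2 * real N + 1) ^ k * exp (- (real n * (h' / (36 * (A + 1)) * (1 - h'\<^sup>2) powr (A + 1))))) \<le> v"
proof -
  interpret symmetric_sample d n "beta_distribution d \<beta>" by (rule sym)
  have \<kappa>: "vol k (unit_ball_rd k) > 0" by (rule vol_unit_ball_pos)
  note T = beta_tail[OF prob _ _ d4 \<beta>, folded A_def tail_def]
  show "v \<le> h ^ k + real n * (18 * (A + 1) * (1 - h\<^sup>2) powr A)" if h: "0 < h" "h < 1"
  proof -
    have "v \<le> h ^ k + n * tail h" using mean_vol_le[OF k h(1)] \<kappa> by (simp add: v_def divide_le_eq)
    also have "\<dots> \<le> h ^ k + n * (18 * (A + 1) * (1 - h\<^sup>2) powr A)"
      by (intro add_left_mono mult_left_mono T(1) h) simp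
    finally show ?thesis .
  qed
  show "h ^ k * (1 - (2 * real N + 1) ^ k * exp (- (real n * (h' / (36 * (A + 1)) * (1 - h'\<^sup>2) powr (A + 1))))) \<le> v"
    if h: "0 < h" "h + real k / real N \<le> h'" "h' < 1" "N \<ge> 1"
  proof -
    have "0 \<le> real k / real N" by simp
    then have h': "0 < h'" using h by linarith
    have "h ^ k * (1 - (2 * real N + 1) ^ k * exp (- (real n * (h' / (36 * (A + 1)) * (1 - h'\<^sup>2) powr (A + 1)))))
      \<le> h ^ k * (1 - (2 * real N + 1) ^ k * exp (- (real n * tail h')))"
      using h(1) by (intro mult_left_mono diff_left_mono exp_le_cancel_iff[THEN iffD2] le_imp_neg_le T(2) h' h(3)) auto
    also have "\<dots> \<le> v"
      using mean_vol_ge[OF k h(1,2,4)] \<kappa> by (simp add: v_def le_divide_eq mult_ac)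
    finally show ?thesis .
  qed
qed

lemma power_sqrt_limit: "((\<lambda>K::real. (1 - 2 * s / K) powr (K / 2)) \<longlongrightarrow> exp (- s)) at_top"
  by real_asymp

lemma poly_exp_limit: "c > 0 \<Longrightarrow> ((\<lambda>A::real. 18 * (A + 1) * exp (- c * A)) \<longlongrightarrow> 0) at_top"
  by real_asymp

lemma net_error_limit:
  assumes "c > 0" "b > 0" "C > 0"
  shows "((\<lambda>A::real. exp (2 * (A + 1) * ln (C * (A + 1)\<^sup>2) - b * exp (c * A) / (A + 1)\<^sup>2)) \<longlongrightarrow> 0) at_top"
  using assms by real_asymp

lemma sqrt_power_eq:
  assumes "0 < (z::real)"
  shows "sqrt z ^ k = z powr (real k / 2)"
proof -
  have "sqrt z ^ k = (z powr (1 / 2)) powr real k" using assms by (simp add: powr_half_sqrt powr_realpow)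
  then show ?thesis by (simp add: powr_powr)
qed

theorem corollary3p2:
  fixes x :: real
    and \<beta> \<epsilon> :: "nat \<Rightarrow> real"
    and k n :: "nat \<Rightarrow> nat"
    and M :: "nat \<Rightarrow> 'a measure"
    and X :: "nat \<Rightarrow> nat \<Rightarrow> 'a \<Rightarrow> nat \<Rightarrow> real"
  assumes "x > 0"
    and "\<And>d. d \<ge> 2 \<Longrightarrow> \<beta> d \<ge> -1"
    and "\<And>d. d \<ge> 2 \<Longrightarrow> k d \<in> {1..d}"
    and "filterlim k at_top sequentially"
    and "\<epsilon> \<longlonglongrightarrow> 0"
    and "\<And>d. d \<ge> 2 \<Longrightarrow>
           real (n d) = (real (k d) / (2 * x + \<epsilon> d)) powr (real d / 2 + \<beta> d)"
    and "\<And>d. d \<ge> 2 \<Longrightarrow> prob_space (M d)"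
    and "\<And>d. d \<ge> 2 \<Longrightarrow>
           prob_space.indep_vars (M d) (\<lambda>_. lborel_rd d) (X d) {..<n d}"
    and "\<And>d i. d \<ge> 2 \<Longrightarrow> i < n d \<Longrightarrow>
           distr (M d) (lborel_rd d) (X d i) = beta_distribution d (\<beta> d)"
  shows "(\<lambda>d. (\<integral>\<omega>. intrinsic_volume d (k d) (convex_rd d hull ((\<lambda>i. X d i \<omega>) ` {..<n d})) \<partial>M d)
              / intrinsic_volume d (k d) (unit_ball_rd d))
         \<longlonglongrightarrow> exp (- x)"
proof -
  let ?R = "\<lambda>d. (\<integral>\<omega>. intrinsic_volume d (k d) (convex_rd d hull ((\<lambda>i. X d i \<omega>) ` {..<n d})) \<partial>M d)
              / intrinsic_volume d (k d) (unit_ball_rd d)"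
  define A where "A d = real d / 2 + \<beta> d" for d
  define v where "v d = (\<integral>y. vol (k d) (pts_hull (k d) (n d) y) \<partial>(\<Pi>\<^sub>M j\<in>{..<n d}. beta_distribution d (\<beta> d))) / vol (k d) (unit_ball_rd (k d))" for d
  have Alow: "real d / 2 - 1 \<le> A d" if "d \<ge> 2" for d using assms(2)[OF that] by (simp add: A_def)
  have A: "filterlim A at_top sequentially"
  proof (rule filterlim_at_top_mono)
    show "filterlim (\<lambda>d. real d / 2 - 1) at_top sequentially" by real_asymp
    show "\<forall>\<^sub>F d in sequentially. real d / 2 - 1 \<le> A d"
      using eventually_ge_at_top[of 2] by eventually_elim (rule Alow)
  qed
  have K: "filterlim (\<lambda>d. real (k d)) at_top sequentially"
    by (rule filterlim_compose[OF filterlim_real_sequentially assms(4)])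
  have k: "1 \<le> k d" "k d \<le> d" "real (k d) \<le> 2 * (A d + 1)" if "d \<ge> 2" for d
    using assms(3)[OF that] Alow[OF that] by auto
  have den: "(\<lambda>d. 2 * x + \<epsilon> d) \<longlonglongrightarrow> 2 * x" using tendsto_add[OF tendsto_const assms(5), of "2 * x"] by simp
  have denpos: "\<forall>\<^sub>F d in sequentially. 2 * x + \<epsilon> d > 0"
    using order_tendstoD(1)[OF den, of 0] assms(1) by simp
  have npos: "n d > 0" if "d \<ge> 2" "2 * x + \<epsilon> d > 0" for d
  proof -
    have "real (n d) > 0" using assms(6)[OF that(1)] k(1)[OF that(1)] that(2) by simp
    then show ?thesis by simp
  qed
  have nmul: "real (n d) * (2 * s / real (k d)) powr A d = (2 * s / (2 * x + \<epsilon> d)) powr A d"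
    if "d \<ge> 2" "2 * x + \<epsilon> d > 0" "s > 0" for d s
  proof -
    have "real (n d) * (2 * s / real (k d)) powr A d = (real (k d) / (2 * x + \<epsilon> d) * (2 * s / real (k d))) powr A d"
      unfolding assms(6)[OF that(1)] A_def[symmetric] by (rule powr_mult[symmetric])
    also have "real (k d) / (2 * x + \<epsilon> d) * (2 * s / real (k d)) = 2 * s / (2 * x + \<epsilon> d)"
      using k(1)[OF that(1)] by simp
    finally show ?thesis .
  qed
  have sym: "symmetric_sample d (n d) (beta_distribution d (\<beta> d))" and R: "?R d = v d"
    if "d \<ge> 4" "2 * x + \<epsilon> d > 0" for d
  proof -
    have d: "d \<ge> 2" "d \<ge> 1" using that by auto
    note * = beta_polytope_ratio[OF assms(7)[OF d(1)] assms(8)[OF d(1)] assms(9)[OF d(1)] npos[OF d(1) that(2)] d(2) k(2)[OF d(1)]]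
    show "symmetric_sample d (n d) (beta_distribution d (\<beta> d))" by (rule *(1))
    show "?R d = v d" unfolding v_def by (rule *(2))
  qed
  have upper: "\<forall>\<^sub>F d in sequentially. v d < b" if b: "exp (- x) < b" for b
  proof -
    obtain s where s: "0 < s" "s < x" "exp (- s) < b"
    proof (cases "b \<ge> 1")
      case True
      have "exp (- (x / 2)) < 1" using assms(1) by simp
      then have "exp (- (x / 2)) < b" using True by linarith
      then show ?thesis using assms(1) by (intro that[of "x / 2"]) auto
    next
      case False
      have "0 < b" using b exp_gt_zero[of "- x"] by linarith
      then have "ln (exp (- x)) < ln b" using b by (subst ln_less_cancel_iff) auto
      moreover have "ln b < 0" using \<open>0 < b\<close> False by (intro ln_less_zero) auto
      ultimately have l: "- x < ln b" "ln b < 0" by simp_all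
      have "- ((x - ln b) / 2) < ln b" using l(1) by argo
      then have "exp (- ((x - ln b) / 2)) < exp (ln b)" by (simp only: exp_less_cancel_iff)
      moreover have "0 < (x - ln b) / 2" "(x - ln b) / 2 < x" using l assms(1) by argo+
      ultimately show ?thesis using \<open>0 < b\<close> by (intro that[of "(x - ln b) / 2"]) (simp_all only: exp_ln)
    qed
    define q where "q = (s + x) / (2 * x)"
    have q: "0 < q" "q < 1" "s / x < q" using s assms(1) by (auto simp: q_def field_simps)
    define c where "c = - ln q"
    have c: "c > 0" "q = exp (- c)" using q by (auto simp: c_def)
    have "(\<lambda>d. 2 * s / (2 * x + \<epsilon> d)) \<longlonglongrightarrow> 2 * s / (2 * x)"
      by (intro tendsto_divide tendsto_const den) (use assms(1) in simp)
    then have "(\<lambda>d. 2 * s / (2 * x + \<epsilon> d)) \<longlonglongrightarrow> s / x" by simp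
    from order_tendstoD(2)[OF this q(3)] have qe: "\<forall>\<^sub>F d in sequentially. 2 * s / (2 * x + \<epsilon> d) < q" .
    define U where "U d = (1 - 2 * s / real (k d)) powr (real (k d) / 2) + 18 * (A d + 1) * exp (- c * A d)" for d
    have "U \<longlonglongrightarrow> exp (- s) + 0"
      unfolding U_def
      by (intro tendsto_add filterlim_compose[OF power_sqrt_limit K] filterlim_compose[OF poly_exp_limit[OF c(1)] A])
    then have "\<forall>\<^sub>F d in sequentially. U d < b" using s(3) by (intro order_tendstoD(2)) auto
    moreover have "\<forall>\<^sub>F d in sequentially. 2 * s < real (k d)" using K by (simp add: filterlim_at_top_dense)
    ultimately show ?thesis
      using denpos qe eventually_ge_at_top[of 4]
    proof eventually_elim
      case (elim d)
      define h where "h = sqrt (1 - 2 * s / real (k d))"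
      have d: "d \<ge> 2" using elim by simp
      have z: "0 < 1 - 2 * s / real (k d)" "1 - 2 * s / real (k d) < 1" using elim s k(1)[OF d] by (auto simp: divide_less_eq)
      have h: "0 < h" "h < 1" "1 - h\<^sup>2 = 2 * s / real (k d)" using z by (auto simp: h_def)
      have A0: "A d \<ge> 1" using Alow[OF d] elim by simp
      have "v d \<le> h ^ k d + real (n d) * (18 * (A d + 1) * (1 - h\<^sup>2) powr A d)"
        using beta_polytope_bounds(1)[OF sym[OF elim(5,3)] elim(5) k(2)[OF d] assms(2)[OF d] h(1,2)]
        unfolding v_def A_def .
      also have "h ^ k d = (1 - 2 * s / real (k d)) powr (real (k d) / 2)"
        unfolding h_def by (rule sqrt_power_eq[OF z(1)])
      also have "real (n d) * (18 * (A d + 1) * (1 - h\<^sup>2) powr A d) = 18 * (A d + 1) * (2 * s / (2 * x + \<epsilon> d)) powr A d"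
        unfolding h(3) using nmul[OF d elim(3) s(1)] by (simp add: mult_ac)
      also have "(2 * s / (2 * x + \<epsilon> d)) powr A d \<le> q powr A d"
        using elim s A0 by (intro powr_mono2) auto
      also have "q powr A d = exp (- c * A d)" unfolding c(2) by (simp add: powr_def)
      finally have "v d \<le> U d" using A0 by (simp add: U_def)
      then show ?case using elim by simp
    qed
  qed
  have lower: "\<forall>\<^sub>F d in sequentially. a < v d" if a: "a < exp (- x)" for a
  proof -
    obtain s where s: "x < s" "a < exp (- s)"
    proof (cases "a \<le> 0")
      case True
      then show ?thesis by (intro that[of "x + 1"]) (auto intro: le_less_trans)
    next
      case False
      then have "ln a < ln (exp (- x))" using a by (subst ln_less_cancel_iff) auto
      then have l: "ln a < - x" by simp
      then have "ln a < - ((x - ln a) / 2)" by argo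
      then have "exp (ln a) < exp (- ((x - ln a) / 2))" by (simp only: exp_less_cancel_iff)
      moreover have "x < (x - ln a) / 2" using l by argo
      ultimately show ?thesis using False by (intro that[of "(x - ln a) / 2"]) (simp_all only: exp_ln not_le)
    qed
    define s' where "s' = (s + x) / 2"
    have s': "x < s'" "s' < s" using s by (auto simp: s'_def)
    define q where "q = (s' + x) / (2 * x)"
    have q: "1 < q" "q < s' / x" using s' assms(1) by (auto simp: q_def field_simps)
    define c where "c = ln q"
    have c: "c > 0" "q = exp c" using q by (auto simp: c_def)
    have "(\<lambda>d. 2 * s' / (2 * x + \<epsilon> d)) \<longlonglongrightarrow> 2 * s' / (2 * x)"
      by (intro tendsto_divide tendsto_const den) (use assms(1) in simp)
    then have "(\<lambda>d. 2 * s' / (2 * x + \<epsilon> d)) \<longlonglongrightarrow> s' / x" by simp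
    from order_tendstoD(1)[OF this q(2)] have qe: "\<forall>\<^sub>F d in sequentially. q < 2 * s' / (2 * x + \<epsilon> d)" .
    define C where "C = 8 / (s - s') + 3"
    define b where "b = s' / 72"
    have C: "C > 0" unfolding C_def using s' by (intro add_pos_pos) auto
    have b: "b > 0" unfolding b_def using s' assms(1) by simp
    define E where "E d = exp (2 * (A d + 1) * ln (C * (A d + 1)\<^sup>2) - b * exp (c * A d) / (A d + 1)\<^sup>2)" for d
    define V where "V d = (1 - 2 * s / real (k d)) powr (real (k d) / 2) * (1 - E d)" for d
    have "V \<longlonglongrightarrow> exp (- s) * (1 - 0)"
      unfolding V_def E_def
      by (intro tendsto_mult tendsto_diff tendsto_const filterlim_compose[OF power_sqrt_limit K]
          filterlim_compose[OF net_error_limit[OF c(1) b C] A])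
    then have "\<forall>\<^sub>F d in sequentially. a < V d" using s(2) by (intro order_tendstoD(1)) auto
    moreover have "\<forall>\<^sub>F d in sequentially. 4 * s < real (k d)" using K by (simp add: filterlim_at_top_dense)
    ultimately show ?thesis
      using denpos qe eventually_ge_at_top[of 4]
    proof eventually_elim
      case (elim d)
      define \<kappa> where "\<kappa> = real (k d)"
      define h where "h = sqrt (1 - 2 * s / \<kappa>)"
      define h' where "h' = sqrt (1 - 2 * s' / \<kappa>)"
      define N where "N = nat \<lceil>\<kappa>\<^sup>2 / (s - s')\<rceil>"
      have d: "d \<ge> 2" using elim by simp
      have \<kappa>: "\<kappa> > 4 * s" "\<kappa> \<ge> 1" "\<kappa> \<le> 2 * (A d + 1)" using elim k[OF d] by (auto simp: \<kappa>_def)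
      have s0: "0 < s'" "0 < s" using s' assms(1) by auto
      have z: "1 / 2 < 1 - 2 * s / \<kappa>" "1 - 2 * s / \<kappa> < 1 - 2 * s' / \<kappa>" "1 - 2 * s' / \<kappa> < 1"
        using \<kappa> s' s0 by (auto simp: field_simps)
      have h: "0 < h" "h\<^sup>2 = 1 - 2 * s / \<kappa>" using z(1) by (auto simp: h_def)
      have h': "h' < 1" "h'\<^sup>2 = 1 - 2 * s' / \<kappa>" "h < h'" using z by (auto simp: h_def h'_def)
      have h'half: "1 / 2 \<le> h'"
      proof (rule power2_le_imp_le)
        show "(1 / 2)\<^sup>2 \<le> h'\<^sup>2" unfolding h'(2) using z by (simp add: power2_eq_square)
      qed (use h h' in simp)
      have gap: "(s - s') / \<kappa> \<le> h' - h"
      proof -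
        have "2 * ((s - s') / \<kappa>) = (h' - h) * (h' + h)"
          using h(2) h'(2) by (simp add: power2_eq_square algebra_simps diff_divide_distrib)
        also have "\<dots> \<le> (h' - h) * 2" using h h' by (intro mult_left_mono) auto
        finally have "2 * ((s - s') / \<kappa>) \<le> 2 * (h' - h)" by (simp only: mult.commute)
        then show ?thesis by (simp only: mult_le_cancel_left_pos zero_less_numeral)
      qed
      have Ng: "\<kappa>\<^sup>2 / (s - s') \<le> real N" unfolding N_def by linarith
      have kk: "0 < \<kappa>\<^sup>2 / (s - s')" using \<kappa> s' by simp
      have N0: "real N > 0" using Ng kk by linarith
      then have N: "N \<ge> 1" by simp
      have "\<kappa> / real N \<le> (s - s') / \<kappa>"
        using Ng N0 \<kappa> s' by (simp add: field_simps power2_eq_square)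
      then have hN: "h + real (k d) / real N \<le> h'" using gap by (simp add: \<kappa>_def)
      have A0: "A d \<ge> 1" using Alow[OF d] elim by simp
      have N_le: "2 * real N + 1 \<le> C * (A d + 1)\<^sup>2"
      proof -
        have "real N \<le> \<kappa>\<^sup>2 / (s - s') + 1" unfolding N_def using kk by linarith
        also have "\<kappa>\<^sup>2 / (s - s') \<le> (2 * (A d + 1))\<^sup>2 / (s - s')"
          using \<kappa> s' by (intro divide_right_mono power_mono) auto
        also have "(2 * (A d + 1))\<^sup>2 / (s - s') = 4 / (s - s') * (A d + 1)\<^sup>2"
          by (simp only: power_mult_distrib) simp
        finally have "2 * real N + 1 \<le> 2 * (4 / (s - s') * (A d + 1)\<^sup>2) + 3" by linarith
        also have "2 * (4 / (s - s') * (A d + 1)\<^sup>2) = 8 / (s - s') * (A d + 1)\<^sup>2" by simp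
        also have "3 \<le> 3 * (A d + 1)\<^sup>2" using A0 by (simp add: power2_eq_square) (use mult_mono[of 1 "A d + 1" 1 "A d + 1"] in simp)
        finally show ?thesis by (simp add: C_def distrib_right)
      qed
      have err: "(2 * real N + 1) ^ k d * exp (- (real (n d) * (h' / (36 * (A d + 1)) * (1 - h'\<^sup>2) powr (A d + 1)))) \<le> E d"
      proof -
        have "(2 * real N + 1) ^ k d = exp (\<kappa> * ln (2 * real N + 1))"
          by (simp add: \<kappa>_def exp_of_nat_mult)
        moreover have "\<kappa> * ln (2 * real N + 1) \<le> 2 * (A d + 1) * ln (C * (A d + 1)\<^sup>2)"
        proof (rule mult_mono)
          show "ln (2 * real N + 1) \<le> ln (C * (A d + 1)\<^sup>2)" using N_le by (intro ln_mono) auto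
        qed (use \<kappa> A0 in auto)
        moreover have "b * exp (c * A d) / (A d + 1)\<^sup>2 \<le> real (n d) * (h' / (36 * (A d + 1)) * (1 - h'\<^sup>2) powr (A d + 1))"
        proof -
          have e: "1 - h'\<^sup>2 = 2 * s' / \<kappa>" unfolding h'(2) by simp
          have "real (n d) * (h' / (36 * (A d + 1)) * (1 - h'\<^sup>2) powr (A d + 1)) =
              (real (n d) * (2 * s' / \<kappa>) powr A d) * (h' / (36 * (A d + 1)) * (2 * s' / \<kappa>))"
            unfolding e using s0 \<kappa> by (simp add: powr_add)
          also have "real (n d) * (2 * s' / \<kappa>) powr A d = (2 * s' / (2 * x + \<epsilon> d)) powr A d"
            unfolding \<kappa>_def by (rule nmul[OF d elim(3) s0(1)])
          finally have eq: "real (n d) * (h' / (36 * (A d + 1)) * (1 - h'\<^sup>2) powr (A d + 1)) =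
             (2 * s' / (2 * x + \<epsilon> d)) powr A d * (h' / (36 * (A d + 1)) * (2 * s' / \<kappa>))" .
          have "b * exp (c * A d) / (A d + 1)\<^sup>2 = exp c powr A d * (1 / 2 / (36 * (A d + 1)) * (s' / (A d + 1)))"
          proof -
            have "exp c powr A d = exp (c * A d)" by (simp add: powr_def)
            moreover have "s' / 72 * e / B\<^sup>2 = e * (1 / 2 / (36 * B) * (s' / B))" for e B :: real
              by (simp add: power2_eq_square mult_ac)
            ultimately show ?thesis unfolding b_def by (simp only:)
          qed
          also have "\<dots> \<le> (2 * s' / (2 * x + \<epsilon> d)) powr A d * (h' / (36 * (A d + 1)) * (2 * s' / \<kappa>))"
          proof (intro mult_mono)
            show "exp c powr A d \<le> (2 * s' / (2 * x + \<epsilon> d)) powr A d"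
              using elim A0 unfolding c(2) by (intro powr_mono2) auto
            show "1 / 2 / (36 * (A d + 1)) \<le> h' / (36 * (A d + 1))"
              using h'half A0 by (intro divide_right_mono) auto
            have "\<kappa> * s' \<le> 2 * (A d + 1) * s'" using \<kappa> s0 by (intro mult_right_mono) auto
            then show "s' / (A d + 1) \<le> 2 * s' / \<kappa>" using \<kappa> A0 by (simp add: field_simps)
          qed (use h h' A0 s0 \<kappa> in auto)
          finally show ?thesis unfolding eq .
        qed
        ultimately show ?thesis unfolding E_def by (simp add: exp_add[symmetric])
      qed
      have "V d = h ^ k d * (1 - E d)"
        unfolding V_def h_def \<kappa>_def[symmetric] using sqrt_power_eq[of "1 - 2 * s / \<kappa>" "k d"] z by (simp add: \<kappa>_def)
      also have "\<dots> \<le> h ^ k d * (1 - (2 * real N + 1) ^ k d * exp (- (real (n d) * (h' / (36 * (A d + 1)) * (1 - h'\<^sup>2) powr (A d + 1)))))"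
        using h err by (intro mult_left_mono) auto
      also have "\<dots> \<le> v d"
        using beta_polytope_bounds(2)[OF sym[OF elim(5,3)] elim(5) k(2)[OF d] assms(2)[OF d] h(1) hN h'(1) N]
        unfolding v_def A_def .
      finally show ?case using elim by simp
    qed
  qed
  have "v \<longlonglongrightarrow> exp (- x)" by (rule order_tendstoI[OF lower upper])
  moreover have "\<forall>\<^sub>F d in sequentially. v d = ?R d"
    using denpos eventually_ge_at_top[of 4] by eventually_elim (rule R[symmetric])
  ultimately show ?thesis by (rule Lim_transform_eventually)
qed

end
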